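(* Let $X\subset\mathbf{R}^n$ be a real algebraic convex hypersurface homeomorphic to $\mathbf{R}^{n-1}$. Then $X$ is an entire graph. Furthermore, if $X$ is strictly convex, then its projective closure is a $\mathcal{C}^1$ hypersurface.
   Context: A convex hypersurface is the boundary of a convex subset of $\mathbf{R}^n$ with interior points. It is strictly convex if it does not contain any line segments. $X\subset\mathbf{R}^n$ is real algebraic if it is the zero set of a polynomial function $\mathbf{R}^n\to\mathbf{R}$. $X\subset\mathbf{R}^n$ is an entire graph if there exists a line $\ell\subset\mathbf{R}^n$ such that $X$ intersects every line parallel to $\ell$ at exactly one point (equivalently, after a rigid motion, $X$ is the graph of a function $\mathbf{R}^{n-1}\to\mathbf{R}$). The projective closure of $X$ is the closure in $\mathbf{RP}^n$ of $i(X)$, where $i:\mathbf{R}^n\to\mathbf{RP}^n$, $i(x_1,\dots,x_n)=[x_1:\dots:x_n:1]$, is the standard embedding. A $\mathcal{C}^1$ hypersurface is a set which may be represented locally as the graph of a continuously differentiable function of $n-1$ variables; for subsets of $\mathbf{RP}^n$ this is understood in local (smooth) coordinates. *)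

theory Defs
  imports "HOL-Analysis.Analysis"
begin

section \<open>Hypersurfaces in Euclidean space\<close>

definition convex_hypersurface :: "'a::euclidean_space set \<Rightarrow> bool" where
  "convex_hypersurface X \<longleftrightarrow> (\<exists>K. convex K \<and> interior K \<noteq> {} \<and> X = frontier K)"

definition no_segments :: "'a::euclidean_space set \<Rightarrow> bool" where
  "no_segments X \<longleftrightarrow> \<not> (\<exists>a b. a \<noteq> b \<and> closed_segment a b \<subseteq> X)"

definition strictly_convex_hypersurface :: "'a::euclidean_space set \<Rightarrow> bool" where
  "strictly_convex_hypersurface X \<longleftrightarrow> convex_hypersurface X \<and> no_segments X"

definition real_algebraic :: "'a::euclidean_space set \<Rightarrow> bool" where
  "real_algebraic X \<longleftrightarrow> (\<exists>p. real_polynomial_function p \<and> X = {x. p x = 0})"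

definition is_line :: "'a::euclidean_space set \<Rightarrow> bool" where
  "is_line l \<longleftrightarrow> affine l \<and> aff_dim l = 1"

definition entire_graph :: "'a::euclidean_space set \<Rightarrow> bool" where
  "entire_graph X \<longleftrightarrow>
     (\<exists>l. is_line l \<and> (\<forall>m. is_line m \<and> affine_parallel l m \<longrightarrow> (\<exists>!x. x \<in> X \<inter> m)))"

text \<open>
  Used for \<open>W\<close> relatively open in a linear subspace \<open>H\<close>. The function \<open>g\<close> is a gradient field;
  its component normal to \<open>H\<close> is irrelevant and can be projected away without losing continuity,
  so this is continuous differentiability of \<open>f\<close> as a function on an open subset of \<open>H\<close>.
\<close>
definition C1_on :: "'a::euclidean_space set \<Rightarrow> ('a \<Rightarrow> real) \<Rightarrow> bool" where
  "C1_on W f \<longleftrightarrow>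
     (\<exists>g. continuous_on W g \<and> (\<forall>y\<in>W. (f has_derivative (\<lambda>h. g y \<bullet> h)) (at y within W)))"

text \<open>
  Near \<open>p\<close>, the set \<open>X\<close> is the graph of a \<open>C\<^sup>1\<close> function of \<open>n - 1\<close> variables. The space
  \<open>\<real>\<^sup>n\<^sup>-\<^sup>1\<close> of the variables is realised as the hyperplane orthogonal to a unit vector \<open>u\<close>, and
  the graph is taken in the direction \<open>u\<close>.
\<close>
definition C1_graph_near :: "'a::euclidean_space set \<Rightarrow> 'a \<Rightarrow> bool" where
  "C1_graph_near X p \<longleftrightarrow>
     (\<exists>U u W f. open U \<and> p \<in> U \<and> norm u = 1 \<and>
        openin (top_of_set {y. u \<bullet> y = 0}) W \<and> C1_on W f \<and>
        X \<inter> U = (\<lambda>y. y + f y *\<^sub>R u) ` W)"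


section \<open>Real projective space\<close>

text \<open>\<open>\<real>\<^sup>n\<^sup>+\<^sup>1\<close> is taken as \<open>\<real>\<^sup>n \<times> \<real>\<close>, the second component being the last homogeneous coordinate.\<close>

definition proportional :: "(real^'n) \<times> real \<Rightarrow> (real^'n) \<times> real \<Rightarrow> bool" where
  "proportional v w \<longleftrightarrow> v \<noteq> 0 \<and> w \<noteq> 0 \<and> (\<exists>c. v = c *\<^sub>R w)"

lemma part_equivp_proportional: "part_equivp proportional"
proof (rule part_equivpI)
  show "\<exists>v::(real^'n) \<times> real. proportional v v"
    by (rule exI[of _ "(0, 1)"])
       (auto simp: proportional_def zero_prod_def intro: exI[of _ "1::real"])
  show "symp (proportional :: (real^'n) \<times> real \<Rightarrow> _)"
  proof (rule sympI)
    fix v w :: "(real^'n) \<times> real"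
    assume "proportional v w"
    then obtain c where c: "v \<noteq> 0" "w \<noteq> 0" "v = c *\<^sub>R w"
      by (auto simp: proportional_def)
    then have "w = inverse c *\<^sub>R v"
      by auto
    with c show "proportional w v"
      unfolding proportional_def by blast
  qed
  show "transp (proportional :: (real^'n) \<times> real \<Rightarrow> _)"
    by (rule transpI) (force simp: proportional_def)
qed

quotient_type (overloaded) 'n rp = "(real^('n::finite)) \<times> real" / partial: proportional
  morphisms rep_rp homog
  by (rule part_equivp_proportional)

text \<open>\<open>homog (x, t)\<close> is the point \<open>[x\<^sub>1 : \<dots> : x\<^sub>n : t]\<close>; it is meaningful only for \<open>(x, t) \<noteq> 0\<close>.\<close>

lemma homog_eq_iff: "v \<noteq> 0 \<Longrightarrow> w \<noteq> 0 \<Longrightarrow> homog v = homog w \<longleftrightarrow> (\<exists>c. v = c *\<^sub>R w)"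
  for v w :: "(real^'n::finite) \<times> real"
proof -
  assume "v \<noteq> 0" "w \<noteq> 0"
  then have "proportional v v" "proportional w w"
    by (auto simp: proportional_def intro: exI[of _ "1::real"])
  then show ?thesis
    using Quotient3_rel[OF Quotient3_rp, of v w] \<open>v \<noteq> 0\<close> \<open>w \<noteq> 0\<close> by (auto simp: proportional_def)
qed

text \<open>The quotient topology of \<open>\<real>\<^sup>n\<^sup>+\<^sup>1 - {0}\<close>.\<close>

instantiation rp :: (finite) topological_space
begin

definition open_rp :: "'a rp set \<Rightarrow> bool" where
  "open_rp U \<longleftrightarrow> open {v. v \<noteq> 0 \<and> homog v \<in> U}"

instance
proof
  show "open (UNIV :: 'a rp set)"
    by (simp add: open_rp_def open_Collect_neq)
next
  fix S T :: "'a rp set"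
  assume "open S" "open T"
  then have "open ({v. v \<noteq> 0 \<and> homog v \<in> S} \<inter> {v. v \<noteq> 0 \<and> homog v \<in> T})"
    unfolding open_rp_def by (rule open_Int)
  also have "{v. v \<noteq> 0 \<and> homog v \<in> S} \<inter> {v. v \<noteq> 0 \<and> homog v \<in> T} =
      {v. v \<noteq> 0 \<and> homog v \<in> S \<inter> T}"
    by blast
  finally show "open (S \<inter> T)"
    unfolding open_rp_def .
next
  fix K :: "'a rp set set"
  assume "\<forall>S\<in>K. open S"
  then have "open (\<Union>S\<in>K. {v. v \<noteq> 0 \<and> homog v \<in> S})"
    unfolding open_rp_def by (intro open_UN) auto
  also have "(\<Union>S\<in>K. {v. v \<noteq> 0 \<and> homog v \<in> S}) = {v. v \<noteq> 0 \<and> homog v \<in> \<Union>K}"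
    by blast
  finally show "open (\<Union>K)"
    unfolding open_rp_def .
qed

end

definition rp_embed :: "real^'n::finite \<Rightarrow> 'n rp" where
  "rp_embed x = homog (x, 1)"

definition projective_closure :: "(real^'n) set \<Rightarrow> 'n rp set" where
  "projective_closure X = closure (rp_embed ` X)"

text \<open>
  Inverses of the \<open>n + 1\<close> standard affine charts. \<open>rp_param None\<close> covers the points whose last
  homogeneous coordinate is nonzero, \<open>rp_param (Some k)\<close> those whose \<open>k\<close>-th one is nonzero; in the
  latter case the \<open>k\<close>-th local coordinate serves as the last homogeneous coordinate.
\<close>
fun rp_param :: "'n::finite option \<Rightarrow> real^'n \<Rightarrow> 'n rp" where
  "rp_param None x = homog (x, 1)"
| "rp_param (Some k) x = homog (\<chi> j. if j = k then 1 else x $ j, x $ k)"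

text \<open>
  The transition maps between these charts are smooth, so it does not matter which chart around
  a given point is used.
\<close>
definition rp_C1_hypersurface :: "'n::finite rp set \<Rightarrow> bool" where
  "rp_C1_hypersurface Y \<longleftrightarrow>
     (\<forall>q\<in>Y. \<exists>c x. q = rp_param c x \<and> C1_graph_near (rp_param c -` Y) x)"

end

theory Submission
  imports Defs
begin

text \<open>
Let \<open>K\<close> be a closed convex set with interior points whose boundary \<open>X\<close> is the zero set of a
polynomial. All the consequences of algebraicity come from one parity principle for plane
curves: near a point, finite or infinite, the half-branches of a real algebraic curve that are
tangent to a given line come in an even number, because every branch passes through the point
and contributes two. A planar section of \<open>X\<close> that had exactly one such half-branch is therefore
impossible (\<open>no_single_branch\<close>). After a projective change of coordinates the half-branch is
the curve \<open>s = g t\<close> with \<open>g t \<longlonglongrightarrow> 0\<close> as \<open>t\<close> tends to infinity, and the parity is seen from the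
sign of a polynomial of even degree at both ends of the \<open>t\<close>-axis.

The principle is applied three times, always by placing the offending half-branch in a plane
through an interior point of \<open>K\<close>. If \<open>u\<close> is a recession direction of \<open>K\<close> but \<open>-u\<close> is not, a line
parallel to \<open>u\<close> that misses the interior of \<open>K\<close> would produce a half-branch of \<open>X\<close> with an
asymptote parallel to \<open>u\<close> and no partner at the other end of it (\<open>line_meets_interior\<close>). If \<open>K\<close>
contains no line, a second recession direction would produce a lone half-branch tangent to the
line at infinity (\<open>recession_cone_subset_ray\<close>). If \<open>X\<close> contains no segment, two supporting
hyperplanes at one point would produce the lone edge of an angle (\<open>unique_support_normal\<close>).

For the first conclusion it remains to find \<open>u\<close>. Were the recession cone a linear subspace, \<open>K\<close>
would be the product of that subspace with a compact convex set \<open>C\<close>, and \<open>X\<close> would retract onto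
the relative boundary of \<open>C\<close>, topologically a sphere. This is impossible because \<open>X\<close>, being homeomorphic to a
Euclidean space, is contractible (\<open>asymmetric_recession_direction\<close>). Every line parallel to \<open>u\<close>
then meets the interior of \<open>K\<close>, enters \<open>K\<close> once and stays there.

For the second conclusion, a convex hypersurface is continuously differentiable as soon as its
supporting hyperplanes are unique, since they then depend continuously on the point
(\<open>C1_graph_near_convex_frontier\<close>). This settles the finite points. The only point of the
projective closure at infinity is the direction \<open>u\<close>. In a chart around it the part of \<open>K\<close> near
infinity becomes a convex set again; its supporting hyperplane at that point is unique because
a second one would be a nonconstant affine function, invariant under \<open>u\<close>, that is bounded on one
side on \<open>K\<close>, while \<open>K\<close> projects along \<open>u\<close> onto everything
(\<open>C1_graph_near_point_at_infinity\<close>).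
\<close>


section \<open>Half-branches of plane algebraic curves\<close>

text \<open>
Bivariate polynomials are polynomials in \<open>s\<close> whose coefficients are polynomials in \<open>t\<close>, so that
\<open>degree\<close>, \<open>pderiv\<close> and pseudo-division refer to \<open>s\<close>, the coordinate transverse to the branch.
\<close>
abbreviation eval2 :: "real poly poly \<Rightarrow> real \<Rightarrow> real \<Rightarrow> real" where
  "eval2 P s t \<equiv> poly (poly P [:s:]) t"

lemma eval2_conv_map_poly: "eval2 P s t = poly (map_poly (\<lambda>a. poly a t) P) s"
  by (induction P) (auto simp: map_poly_pCons algebra_simps)

lemma coeff_poly_const_arg:
  fixes P :: "real poly poly"
  shows "coeff (poly P [:s:]) i = poly (map_poly (\<lambda>a. coeff a i) P) s"
  by (induction P) (auto simp: map_poly_pCons algebra_simps)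

lemma pderiv_map_poly_eval:
  fixes P :: "real poly poly"
  shows "pderiv (map_poly (\<lambda>a. poly a t) P) = map_poly (\<lambda>a. poly a t) (pderiv P)"
proof (rule poly_eqI)
  fix n
  show "coeff (pderiv (map_poly (\<lambda>a. poly a t) P)) n = coeff (map_poly (\<lambda>a. poly a t) (pderiv P)) n"
    by (simp add: coeff_pderiv coeff_map_poly flip: of_nat_Suc) 
qed

lemma poly_nonzero_far_out:
  fixes a :: "real poly"
  assumes "a \<noteq> 0"
  obtains T where "\<And>t. \<bar>t\<bar> > T \<Longrightarrow> poly a t \<noteq> 0"
proof -
  have "bounded {t. poly a t = 0}"
    using poly_roots_finite[OF assms] by (rule finite_imp_bounded)
  then obtain B where "\<forall>t\<in>{t. poly a t = 0}. \<bar>t\<bar> \<le> B"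
    unfolding bounded_iff by auto
  then show thesis
    using that[of B] by force
qed

lemma poly_nonzero_near:
  fixes a :: "real poly"
  assumes "a \<noteq> 0"
  obtains d where "d > 0" "\<And>s. 0 < \<bar>s\<bar> \<Longrightarrow> \<bar>s\<bar> < d \<Longrightarrow> poly a s \<noteq> 0"
proof -
  have "finite ({s. poly a s = 0} - {0})"
    using poly_roots_finite[OF assms] by auto
  then obtain d where "d > 0" and d: "\<forall>x\<in>{s. poly a s = 0} - {0}. d \<le> dist 0 x"
    using finite_set_avoid[of "{s. poly a s = 0} - {0}" 0] by auto
  have "poly a s \<noteq> 0" if "0 < \<bar>s\<bar>" "\<bar>s\<bar> < d" for s
    using d that by force
  with \<open>d > 0\<close> show thesis using that by blast
qed

lemma poly_sgn_at_top:
  fixes p :: "real poly"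
  assumes "p \<noteq> 0"
  shows "eventually (\<lambda>t. sgn (poly p t) = sgn (lead_coeff p)) at_top"
proof -
  have *: "eventually (\<lambda>t. poly q t > 0) at_top" if pos: "lead_coeff q > 0" for q :: "real poly"
  proof -
    obtain n where "\<forall>x\<ge>n. lead_coeff q \<le> poly q x"
      using poly_pinfty_gt_lc[OF pos] by blast
    with pos show ?thesis
      unfolding eventually_at_top_linorder by (intro exI[of _ n]) force
  qed
  show ?thesis
  proof (cases "lead_coeff p > 0")
    case True
    show ?thesis
      using *[OF True] by eventually_elim (use True in auto)
  next
    case False
    then have "lead_coeff p < 0"
      using assms by (meson leading_coeff_0_iff linorder_cases)
    then have "eventually (\<lambda>t. poly (-p) t > 0) at_top"
      by (intro *) auto
    then show ?thesis
      by eventually_elim (use \<open>lead_coeff p < 0\<close> in auto)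
  qed
qed

lemma even_degree_sgn_far_out:
  fixes p :: "real poly"
  assumes "p \<noteq> 0" "even (degree p)"
  obtains T where "\<And>t. \<bar>t\<bar> > T \<Longrightarrow> sgn (poly p t) = sgn (lead_coeff p)"
proof -
  let ?q = "pcompose p [:0, -1:]"
  have lq: "lead_coeff ?q = lead_coeff p"
    using assms(2) by (subst lead_coeff_comp) auto
  then have "?q \<noteq> 0"
    using assms(1) by (metis leading_coeff_0_iff)
  from poly_sgn_at_top[OF this] obtain T1 where T1: "\<forall>t\<ge>T1. sgn (poly ?q t) = sgn (lead_coeff p)"
    unfolding lq eventually_at_top_linorder by blast
  from poly_sgn_at_top[OF assms(1)] obtain T2 where T2: "\<forall>t\<ge>T2. sgn (poly p t) = sgn (lead_coeff p)"
    unfolding eventually_at_top_linorder by blast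
  have "sgn (poly p t) = sgn (lead_coeff p)" if "\<bar>t\<bar> > max T1 T2" for t
  proof (cases "t \<ge> 0")
    case True
    with that T2 show ?thesis by auto
  next
    case False
    with that have "sgn (poly ?q (- t)) = sgn (lead_coeff p)"
      using T1[rule_format, of "- t"] by auto
    then show ?thesis by (simp add: poly_pcompose)
  qed
  then show thesis using that by blast
qed

text \<open>
The coefficient of the highest power of \<open>t\<close> that occurs in \<open>P\<close> is a nonzero polynomial in \<open>s\<close>,
so it vanishes at no \<open>s \<noteq> 0\<close> close to \<open>0\<close>.
\<close>
lemma degree_poly_const_arg_stable:
  fixes P :: "real poly poly"
  assumes "P \<noteq> 0"
  obtains N d where "d > 0"
    "\<And>s. 0 < \<bar>s\<bar> \<Longrightarrow> \<bar>s\<bar> < d \<Longrightarrow> poly P [:s:] \<noteq> 0 \<and> degree (poly P [:s:]) = N"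
proof -
  define C where "C i = map_poly (\<lambda>a. coeff a i) P" for i
  have coeff_C: "coeff (C i) j = coeff (coeff P j) i" for i j
    by (simp add: C_def coeff_map_poly)
  define I where "I = {i. C i \<noteq> 0}"
  have "i \<le> Max ((\<lambda>j. degree (coeff P j)) ` {..degree P})" if "i \<in> I" for i
  proof -
    obtain j where j: "coeff (coeff P j) i \<noteq> 0"
      using \<open>i \<in> I\<close> by (auto simp: I_def poly_eq_iff coeff_C)
    then have "j \<le> degree P" "i \<le> degree (coeff P j)"
      by (auto intro: le_degree)
    then show ?thesis
      by (meson Max_ge atMost_iff finite_atMost finite_imageI image_eqI le_trans)
  qed
  then have "finite I"
    by (meson finite_nat_set_iff_bounded_le)
  have "coeff (coeff P (degree P)) (degree (lead_coeff P)) \<noteq> 0"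
    using assms by auto
  then have "I \<noteq> {}"
    unfolding I_def by (metis (mono_tags, lifting) coeff_0 coeff_C empty_Collect_eq)
  define N where "N = Max I"
  have "C N \<noteq> 0"
    using Max_in[OF \<open>finite I\<close> \<open>I \<noteq> {}\<close>] by (auto simp: N_def I_def)
  from poly_nonzero_near[OF this] obtain d where "d > 0"
    and d: "\<And>s. 0 < \<bar>s\<bar> \<Longrightarrow> \<bar>s\<bar> < d \<Longrightarrow> poly (C N) s \<noteq> 0" by blast
  have "poly P [:s:] \<noteq> 0 \<and> degree (poly P [:s:]) = N" if "0 < \<bar>s\<bar>" "\<bar>s\<bar> < d" for s
  proof -
    have cf: "coeff (poly P [:s:]) i = poly (C i) s" for i
      by (simp add: coeff_poly_const_arg C_def)
    have nz: "coeff (poly P [:s:]) N \<noteq> 0"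
      using d that by (simp add: cf)
    moreover have "coeff (poly P [:s:]) i = 0" if "i > N" for i
    proof -
      have "i \<notin> I"
        using that Max_ge[OF \<open>finite I\<close>, of i] by (auto simp: N_def)
      then show ?thesis by (simp add: cf I_def)
    qed
    ultimately show ?thesis
      by (metis coeff_0 degree_le le_antisym le_degree)
  qed
  with \<open>d > 0\<close> show thesis using that by blast
qed

lemma poly_no_zero_same_sign:
  fixes f :: "real poly"
  assumes "a < b" "\<And>x. a \<le> x \<Longrightarrow> x \<le> b \<Longrightarrow> poly f x \<noteq> 0"
  shows "poly f a * poly f b > 0"
proof (rule ccontr)
  assume "\<not> ?thesis"
  moreover have "poly f a * poly f b \<noteq> 0"
    using assms by auto
  ultimately have "poly f a * poly f b < 0" by linarith
  from poly_IVT[OF assms(1) this] assms(2) show False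
    by force
qed

lemma poly_simple_zero_sign_change:
  fixes f :: "real poly"
  assumes "a < z" "z < b" "poly f z = 0" "poly (pderiv f) z \<noteq> 0"
    and only: "\<And>x. a \<le> x \<Longrightarrow> x \<le> b \<Longrightarrow> poly f x = 0 \<Longrightarrow> x = z"
  shows "poly f a * poly f b < 0"
proof -
  obtain h where h: "f = [:- z, 1:] * h"
    using assms(3) by (metis dvdE poly_eq_0_iff_dvd)
  have fx: "poly f x = (x - z) * poly h x" for x
    by (simp add: h algebra_simps)
  have "poly (pderiv f) z = poly h z"
    unfolding h pderiv_mult by (simp add: pderiv_pCons)
  then have "poly h x \<noteq> 0" if "a \<le> x" "x \<le> b" for x
    using only[OF that] assms(4) by (auto simp: fx)
  then have "poly h a * poly h b > 0"
    using poly_no_zero_same_sign[of a b h] assms(1,2) by auto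
  moreover have "(a - z) * (b - z) < 0"
    using assms(1,2) by (simp add: mult_neg_pos)
  moreover have "poly f a * poly f b = ((a - z) * (b - z)) * (poly h a * poly h b)"
    by (simp add: fx)
  ultimately show ?thesis
    by (metis mult_neg_pos)
qed

text \<open>
The parity principle: a half-branch asymptotic to the \<open>t\<close>-axis cannot be alone. Suppose that it
is, and replace \<open>P\<close> by a polynomial \<open>q\<close> of least degree in \<open>s\<close> that vanishes on it. For suitable
small \<open>\<delta>\<close> the product of \<open>q \<delta> t\<close> and \<open>q (- \<delta>) t\<close> has even degree in \<open>t\<close>, hence the same sign at
both ends. At the lower end \<open>q\<close> has no zero between \<open>- \<delta>\<close> and \<open>\<delta>\<close>, so the sign is positive; at
the upper end it has exactly one zero there, simple for some large \<open>t\<close>, so the sign is negative.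
The axis \<open>s = 0\<close> is excluded from the hypotheses because in one application the change of
coordinates degenerates there.
\<close>
lemma no_single_branch:
  fixes P :: "real poly poly" and g :: "real \<Rightarrow> real"
  assumes "\<epsilon> > 0"
    and g_pos: "\<And>t. t > T \<Longrightarrow> g t > 0"
    and g_lim: "(g \<longlongrightarrow> 0) at_top"
    and right: "\<And>s t. t > T \<Longrightarrow> 0 < \<bar>s\<bar> \<Longrightarrow> \<bar>s\<bar> < \<epsilon> \<Longrightarrow> eval2 P s t = 0 \<longleftrightarrow> s = g t"
    and left: "\<And>s t. t < - T \<Longrightarrow> 0 < \<bar>s\<bar> \<Longrightarrow> \<bar>s\<bar> < \<epsilon> \<Longrightarrow> eval2 P s t \<noteq> 0"
  shows False
proof -
  \<comment> \<open>A polynomial of least degree among those satisfying \<open>V\<close> acts as the minimal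
    polynomial of the branch over the rational functions of \<open>t\<close>.\<close>
  define V where "V q \<longleftrightarrow> q \<noteq> 0 \<and> (\<forall>\<^sub>F t in at_top. eval2 q (g t) t = 0)" for q
  have "P \<noteq> 0"
    using left[of "- T - 1" "\<epsilon>/2"] \<open>\<epsilon> > 0\<close> by auto
  have g_small: "\<forall>\<^sub>F t in at_top. \<bar>g t\<bar> < e" if "e > 0" for e
    using tendstoD[OF g_lim that] by (simp add: dist_real_def)
  have gT: "\<forall>\<^sub>F t in at_top. g t > 0"
    using eventually_gt_at_top[of T] by eventually_elim (rule g_pos)
  have "V P"
    unfolding V_def
  proof
    show "\<forall>\<^sub>F t in at_top. eval2 P (g t) t = 0"
      using g_small[OF \<open>\<epsilon> > 0\<close>] eventually_gt_at_top[of T]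
      by eventually_elim (use right g_pos in fastforce)
  qed fact
  then obtain q where "V q" and q_min: "\<And>r. V r \<Longrightarrow> degree q \<le> degree r"
    using ex_has_least_nat[of V P degree] by blast
  then have "q \<noteq> 0" and q_van: "\<forall>\<^sub>F t in at_top. eval2 q (g t) t = 0"
    by (auto simp: V_def)

  have deg: "degree q > 0"
  proof (rule ccontr)
    assume "\<not> degree q > 0"
    then obtain a where a: "q = [:a:]"
      by (metis degree_eq_zeroE not_gr0)
    with \<open>q \<noteq> 0\<close> obtain S where "\<And>t. \<bar>t\<bar> > S \<Longrightarrow> poly a t \<noteq> 0"
      using poly_nonzero_far_out[of a] by auto
    moreover have "\<exists>t. t > \<bar>S\<bar> \<and> eval2 q (g t) t = 0"
      using q_van eventually_gt_at_top[of "\<bar>S\<bar>"]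
      by (metis (mono_tags, lifting) eventually_conj eventually_happens' trivial_limit_at_top_linorder)
    ultimately show False
      by (auto simp: a)
  qed

  \<comment> \<open>By minimality \<open>s\<close> does not divide \<open>q\<close>, so that far out \<open>q\<close> has no zero on the axis either.\<close>
  have c0: "coeff q 0 \<noteq> 0"
  proof
    assume "coeff q 0 = 0"
    then obtain q' where q': "q = pCons 0 q'"
      by (metis coeff_pCons_0 pCons_cases)
    have "V q'"
      unfolding V_def
    proof
      show "q' \<noteq> 0" using \<open>q \<noteq> 0\<close> q' by auto
      show "\<forall>\<^sub>F t in at_top. eval2 q' (g t) t = 0"
        using q_van gT by eventually_elim (auto simp: q')
    qed
    from q_min[OF this] \<open>q \<noteq> 0\<close> show False
      by (auto simp: q' split: if_splits)
  qed

  \<comment> \<open>The remainder vanishes on the branch, hence is \<open>0\<close>: up to a factor that depends on \<open>t\<close> alone,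
    \<open>q\<close> divides \<open>P\<close>, and far out all zeros of \<open>q\<close> are zeros of \<open>P\<close>.\<close>
  obtain a b r where a: "a \<noteq> 0" and ab: "smult a P = q * b + r" and r: "r = 0 \<or> degree r < degree q"
    using pseudo_mod[OF \<open>q \<noteq> 0\<close>, of P] by blast
  have "r = 0"
  proof (rule ccontr)
    assume "r \<noteq> 0"
    have "\<forall>\<^sub>F t in at_top. eval2 r (g t) t = 0"
      using \<open>V P\<close>[unfolded V_def, THEN conjunct2] q_van
    proof eventually_elim
      case (elim t)
      have "eval2 (smult a P) (g t) t = eval2 (q * b + r) (g t) t"
        by (simp only: ab)
      then show ?case using elim by simp
    qed
    with \<open>r \<noteq> 0\<close> have "V r" by (simp add: V_def)
    from q_min[OF this] r \<open>r \<noteq> 0\<close> show False by auto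
  qed
  from poly_nonzero_far_out[OF a] obtain T1 where T1: "\<And>t. \<bar>t\<bar> > T1 \<Longrightarrow> poly a t \<noteq> 0" by blast
  from poly_nonzero_far_out[OF c0] obtain T2 where T2: "\<And>t. \<bar>t\<bar> > T2 \<Longrightarrow> poly (coeff q 0) t \<noteq> 0" by blast
  have q_zero: "eval2 P s t = 0" if "\<bar>t\<bar> > T1" "eval2 q s t = 0" for s t
  proof -
    have "eval2 (smult a P) s t = eval2 (q * b) s t"
      using ab \<open>r = 0\<close> by simp
    with T1[OF that(1)] that(2) show ?thesis by simp
  qed
  have q_zero0: "eval2 q 0 t \<noteq> 0" if "\<bar>t\<bar> > T2" for t
  proof -
    have "poly q [:0:] = coeff q 0"
      by (metis pCons_0_0 poly_0_coeff_0)
    with T2[OF that] show ?thesis by simp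
  qed

  obtain N d where "d > 0" and
    d: "\<And>s. 0 < \<bar>s\<bar> \<Longrightarrow> \<bar>s\<bar> < d \<Longrightarrow> poly q [:s:] \<noteq> 0 \<and> degree (poly q [:s:]) = N"
    using degree_poly_const_arg_stable[OF \<open>q \<noteq> 0\<close>] by blast
  define \<delta> where "\<delta> = min d \<epsilon> / 2"
  have \<delta>: "\<delta> > 0" "\<delta> < d" "\<delta> < \<epsilon>"
    using \<open>d > 0\<close> \<open>\<epsilon> > 0\<close> by (auto simp: \<delta>_def)
  define R where "R = poly q [:\<delta>:] * poly q [:- \<delta>:]"
  have "R \<noteq> 0" "even (degree R)"
    using d[of \<delta>] d[of "- \<delta>"] \<delta> by (auto simp: R_def degree_mult_eq)
  from even_degree_sgn_far_out[OF this] obtain T3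
    where T3: "\<And>t. \<bar>t\<bar> > T3 \<Longrightarrow> sgn (poly R t) = sgn (lead_coeff R)" by blast
  define S where "S = Max {\<bar>T\<bar>, T1, T2, T3}"
  have S: "\<bar>T\<bar> \<le> S" "T1 \<le> S" "T2 \<le> S" "T3 \<le> S"
    by (auto simp: S_def)

  have "poly R (- S - 1) > 0"
  proof -
    let ?t = "- S - 1"
    let ?f = "map_poly (\<lambda>a. poly a ?t) q"
    have "poly ?f x \<noteq> 0" if "- \<delta> \<le> x" "x \<le> \<delta>" for x
    proof (cases "x = 0")
      case True
      then show ?thesis
        using q_zero0[of ?t] S unfolding eval2_conv_map_poly by auto
    next
      case False
      then show ?thesis
        using q_zero[of ?t x] left[of ?t x] S that \<delta> by (auto simp: eval2_conv_map_poly)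
    qed
    then have "poly ?f (- \<delta>) * poly ?f \<delta> > 0"
      using \<delta> by (intro poly_no_zero_same_sign) auto
    then show ?thesis
      by (simp add: R_def eval2_conv_map_poly mult.commute)
  qed
  moreover have "sgn (poly R (- S - 1)) = sgn (lead_coeff R)"
    using S by (intro T3) auto
  ultimately have lead: "sgn (lead_coeff R) = 1" by simp

  \<comment> \<open>By minimality \<open>pderiv q\<close> does not vanish on the branch from some point on, so there are
    arbitrarily large \<open>t\<close> at which the zero \<open>g t\<close> is simple.\<close>
  have "\<not> V (pderiv q)"
  proof
    assume "V (pderiv q)"
    from q_min[OF this] show False
      using deg by (simp add: degree_pderiv)
  qed
  moreover have "pderiv q \<noteq> 0"
    using deg by (auto simp: pderiv_eq_0_iff)
  ultimately have "\<exists>\<^sub>F t in at_top. eval2 (pderiv q) (g t) t \<noteq> 0"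
    by (auto simp: V_def frequently_def)
  moreover have "\<forall>\<^sub>F t in at_top. t > S \<and> \<bar>g t\<bar> < \<delta> \<and> eval2 q (g t) t = 0"
    using eventually_gt_at_top[of S] g_small[OF \<delta>(1)] q_van by eventually_elim auto
  ultimately have "\<exists>\<^sub>F t in at_top. eval2 (pderiv q) (g t) t \<noteq> 0 \<and>
      (t > S \<and> \<bar>g t\<bar> < \<delta> \<and> eval2 q (g t) t = 0)"
    by (rule frequently_eventually_frequently)
  then obtain t where t: "eval2 (pderiv q) (g t) t \<noteq> 0" "t > S" "\<bar>g t\<bar> < \<delta>" "eval2 q (g t) t = 0"
    using frequently_ex by blast
  let ?f = "map_poly (\<lambda>a. poly a t) q"
  have "poly ?f (- \<delta>) * poly ?f \<delta> < 0"
  proof (rule poly_simple_zero_sign_change[where z = "g t"])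
    show "poly (pderiv ?f) (g t) \<noteq> 0"
      using t by (simp add: pderiv_map_poly_eval eval2_conv_map_poly)
    show "x = g t" if "- \<delta> \<le> x" "x \<le> \<delta>" "poly ?f x = 0" for x
    proof -
      have "eval2 q x t = 0"
        using that by (simp add: eval2_conv_map_poly)
      then have "x \<noteq> 0" "eval2 P x t = 0"
        using q_zero0[of t] q_zero[of t x] t S by auto
      then show ?thesis
        using right[of t x] that \<delta> t S by auto
    qed
  qed (use t in \<open>auto simp: eval2_conv_map_poly\<close>)
  then have "poly R t < 0"
    by (simp add: R_def eval2_conv_map_poly mult.commute)
  moreover have "sgn (poly R t) = 1"
    using T3[of t] S t lead by auto
  ultimately show False by simp
qed


section \<open>Half-branches on the boundary of a convex set\<close>

text \<open>
Clearing denominators turns a polynomial function, composed with a projective map of the plane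
into the space, into a bivariate polynomial with the same zeros wherever the map is defined.
\<close>
lemma homogenize_real_polynomial_function:
  fixes p :: "'a::real_normed_vector \<Rightarrow> real" and a b c :: 'a
  assumes "real_polynomial_function p"
  obtains N P where "\<And>s t. \<alpha> + \<beta> * s + \<gamma> * t \<noteq> 0 \<Longrightarrow> eval2 P s t =
    (\<alpha> + \<beta> * s + \<gamma> * t) ^ N * p ((c + s *\<^sub>R a + t *\<^sub>R b) /\<^sub>R (\<alpha> + \<beta> * s + \<gamma> * t))"
proof -
  define D where "D = [: [: \<alpha>, \<gamma> :], [: \<beta> :] :]"
  have D: "eval2 D s t = \<alpha> + \<beta> * s + \<gamma> * t" for s t
    by (simp add: D_def algebra_simps)
  from assms have "\<exists>N P. \<forall>s t. eval2 D s t \<noteq> 0 \<longrightarrow>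
    eval2 P s t = eval2 D s t ^ N * p ((c + s *\<^sub>R a + t *\<^sub>R b) /\<^sub>R eval2 D s t)"
  proof induction
    case (linear f)
    interpret bounded_linear f by fact
    have "eval2 [: [: f c, f b :], [: f a :] :] s t =
        eval2 D s t ^ 1 * f ((c + s *\<^sub>R a + t *\<^sub>R b) /\<^sub>R eval2 D s t)"
      if "eval2 D s t \<noteq> 0" for s t
    proof -
      have "f ((c + s *\<^sub>R a + t *\<^sub>R b) /\<^sub>R eval2 D s t) = (f c + s * f a + t * f b) / eval2 D s t"
        by (simp only: scaleR add real_scaleR_def divide_inverse mult.commute)
      with that show ?thesis by simp
    qed
    then show ?case by blast
  next
    case (const k)
    show ?case
      by (intro exI[of _ 0] exI[of _ "[: [: k :] :]"]) auto
  next
    case (add f g)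
    then obtain N P M Q where
      "\<forall>s t. eval2 D s t \<noteq> 0 \<longrightarrow>
        eval2 P s t = eval2 D s t ^ N * f ((c + s *\<^sub>R a + t *\<^sub>R b) /\<^sub>R eval2 D s t)"
      "\<forall>s t. eval2 D s t \<noteq> 0 \<longrightarrow>
        eval2 Q s t = eval2 D s t ^ M * g ((c + s *\<^sub>R a + t *\<^sub>R b) /\<^sub>R eval2 D s t)"
      by metis
    then have "eval2 (P * D ^ M + Q * D ^ N) s t = eval2 D s t ^ (N + M) *
        (f ((c + s *\<^sub>R a + t *\<^sub>R b) /\<^sub>R eval2 D s t) + g ((c + s *\<^sub>R a + t *\<^sub>R b) /\<^sub>R eval2 D s t))"
      if "eval2 D s t \<noteq> 0" for s t
      using that by (simp add: poly_power power_add distrib_left mult.commute mult.left_commute)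
    then show ?case by blast
  next
    case (mult f g)
    then obtain N P M Q where
      "\<forall>s t. eval2 D s t \<noteq> 0 \<longrightarrow>
        eval2 P s t = eval2 D s t ^ N * f ((c + s *\<^sub>R a + t *\<^sub>R b) /\<^sub>R eval2 D s t)"
      "\<forall>s t. eval2 D s t \<noteq> 0 \<longrightarrow>
        eval2 Q s t = eval2 D s t ^ M * g ((c + s *\<^sub>R a + t *\<^sub>R b) /\<^sub>R eval2 D s t)"
      by metis
    then have "eval2 (P * Q) s t = eval2 D s t ^ (N + M) *
        (f ((c + s *\<^sub>R a + t *\<^sub>R b) /\<^sub>R eval2 D s t) * g ((c + s *\<^sub>R a + t *\<^sub>R b) /\<^sub>R eval2 D s t))"
      if "eval2 D s t \<noteq> 0" for s t
      using that by (simp add: power_add mult.commute mult.left_commute)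
    then show ?case by blast
  qed
  then show thesis
    using that unfolding D by blast
qed

lemma interior_convex_combination:
  assumes "convex K" "closed K" "x \<in> K" "y \<in> interior K" "0 \<le> u" "0 < v" "u + v = 1"
  shows "u *\<^sub>R x + v *\<^sub>R y \<in> interior (K :: 'a::euclidean_space set)"
proof -
  have "x - v *\<^sub>R (x - y) \<in> interior K"
    using assms by (intro mem_interior_closure_convex_shrink) auto
  moreover have "x - v *\<^sub>R (x - y) = u *\<^sub>R x + v *\<^sub>R y"
  proof -
    have u: "u = 1 - v" using assms(7) by simp
    show ?thesis unfolding u by (simp add: algebra_simps)
  qed
  ultimately show ?thesis by simp
qed

text \<open>
The parity principle for a planar section of a convex set in projective coordinates \<open>(s, t)\<close>. The
map \<open>\<phi>\<close> sends the lines \<open>t = const\<close> to lines of the plane. On such a line with \<open>t\<close> large, the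
points with small positive \<open>s\<close> lie outside \<open>K\<close> and those with larger \<open>s\<close> inside, and by convexity
there is exactly one boundary point in between. The three choices of the denominator used later
place the end of the half-branch at infinity with a finite asymptote (denominator \<open>1\<close>), at
infinity with the line at infinity as tangent (denominator \<open>s\<close>), and at a finite point
(denominator \<open>t\<close>).
\<close>
lemma no_single_branch_on_frontier:
  fixes K :: "'a::euclidean_space set" and a b c :: 'a and \<alpha> \<beta> \<gamma> :: real
  defines "\<phi> \<equiv> \<lambda>s t. (c + s *\<^sub>R a + t *\<^sub>R b) /\<^sub>R (\<alpha> + \<beta> * s + \<gamma> * t)"
  assumes K: "convex K" "closed K"
    and alg: "real_algebraic (frontier K)"
    and \<epsilon>: "\<epsilon> > 0"
    and den_pos: "\<And>s t. t > T \<Longrightarrow> 0 < s \<Longrightarrow> s < \<epsilon> \<Longrightarrow> \<alpha> + \<beta> * s + \<gamma> * t > 0"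
    and den_nz: "\<And>s t. \<bar>t\<bar> > T \<Longrightarrow> 0 < \<bar>s\<bar> \<Longrightarrow> \<bar>s\<bar> < \<epsilon> \<Longrightarrow> \<alpha> + \<beta> * s + \<gamma> * t \<noteq> 0"
    and inside: "\<And>s. 0 < s \<Longrightarrow> s < \<epsilon> \<Longrightarrow> \<forall>\<^sub>F t in at_top. \<phi> s t \<in> interior K"
    and outside: "\<And>t e. t > T \<Longrightarrow> e > 0 \<Longrightarrow> \<exists>s. 0 < s \<and> s < e \<and> \<phi> s t \<notin> K"
    and neg: "\<And>s t. t > T \<Longrightarrow> - \<epsilon> < s \<Longrightarrow> s < 0 \<Longrightarrow> \<phi> s t \<notin> frontier K"
    and left: "\<And>s t. t < - T \<Longrightarrow> 0 < \<bar>s\<bar> \<Longrightarrow> \<bar>s\<bar> < \<epsilon> \<Longrightarrow> \<phi> s t \<notin> frontier K"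
  shows False
proof -
  obtain p where p: "real_polynomial_function p" "frontier K = {x. p x = 0}"
    using alg by (auto simp: real_algebraic_def)
  obtain N P where NP: "\<And>s t. \<alpha> + \<beta> * s + \<gamma> * t \<noteq> 0 \<Longrightarrow> eval2 P s t =
    (\<alpha> + \<beta> * s + \<gamma> * t) ^ N * p ((c + s *\<^sub>R a + t *\<^sub>R b) /\<^sub>R (\<alpha> + \<beta> * s + \<gamma> * t))"
    using homogenize_real_polynomial_function[OF p(1)] by metis
  have zero_iff: "eval2 P s t = 0 \<longleftrightarrow> \<phi> s t \<in> frontier K"
    if "\<bar>t\<bar> > T" "0 < \<bar>s\<bar>" "\<bar>s\<bar> < \<epsilon>" for s t
    using NP[OF den_nz[OF that]] den_nz[OF that] by (simp add: p(2) \<phi>_def)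

  have between: "\<phi> y t \<in> interior K"
    if t: "t > T" and ord: "0 < x" "x < y" "y < z" "z < \<epsilon>"
      and "\<phi> x t \<in> K" "\<phi> z t \<in> interior K" for x y z t
  proof -
    \<comment> \<open>The numerator and the denominator of \<open>\<phi>\<close> are affine in \<open>s\<close>, so \<open>\<phi> y t\<close> is a convex combination
      of \<open>\<phi> x t\<close> and \<open>\<phi> z t\<close> with weights rescaled by the denominators.\<close>
    define Dn where "Dn s = \<alpha> + \<beta> * s + \<gamma> * t" for s
    define \<mu> where "\<mu> = (y - x) / (z - x)"
    have \<mu>: "0 < \<mu>" "\<mu> < 1" using ord by (auto simp: \<mu>_def)
    have pos: "Dn x > 0" "Dn y > 0" "Dn z > 0"
      using den_pos[OF t] ord by (auto simp: Dn_def)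
    have "\<mu> * (z - x) = y - x"
      using ord by (simp add: \<mu>_def)
    then have y: "y = (1 - \<mu>) * x + \<mu> * z"
      by (simp add: algebra_simps)
    have Dy: "Dn y = (1 - \<mu>) * Dn x + \<mu> * Dn z"
      unfolding Dn_def by (subst y) (simp add: algebra_simps)
    have num: "Dn s *\<^sub>R \<phi> s t = c + s *\<^sub>R a + t *\<^sub>R b" if "Dn s > 0" for s
      using that by (simp add: \<phi>_def Dn_def)
    have "Dn y *\<^sub>R \<phi> y t = (1 - \<mu>) *\<^sub>R (Dn x *\<^sub>R \<phi> x t) + \<mu> *\<^sub>R (Dn z *\<^sub>R \<phi> z t)"
    proof -
      have "c + y *\<^sub>R a + t *\<^sub>R b =
          (1 - \<mu>) *\<^sub>R (c + x *\<^sub>R a + t *\<^sub>R b) + \<mu> *\<^sub>R (c + z *\<^sub>R a + t *\<^sub>R b)"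
        by (subst y) (simp add: algebra_simps)
      then show ?thesis
        by (simp only: num pos)
    qed
    then have "(1 / Dn y) *\<^sub>R (Dn y *\<^sub>R \<phi> y t) =
        ((1 - \<mu>) * Dn x / Dn y) *\<^sub>R \<phi> x t + (\<mu> * Dn z / Dn y) *\<^sub>R \<phi> z t"
      by (simp add: scaleR_add_right)
    then have "\<phi> y t = ((1 - \<mu>) * Dn x / Dn y) *\<^sub>R \<phi> x t + (\<mu> * Dn z / Dn y) *\<^sub>R \<phi> z t"
      using pos by simp
    also have "\<dots> \<in> interior K"
    proof (rule interior_convex_combination[OF K])
      show "(1 - \<mu>) * Dn x / Dn y + \<mu> * Dn z / Dn y = 1"
        using pos(2) Dy by (metis add_divide_distrib divide_self less_irrefl)
    qed (use pos \<mu> that in auto)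
    finally show ?thesis .
  qed

  define \<epsilon>' where "\<epsilon>' = \<epsilon> / 2"
  have \<epsilon>': "0 < \<epsilon>'" "\<epsilon>' < \<epsilon>" using \<epsilon> by (auto simp: \<epsilon>'_def)
  obtain T0 where T0: "\<forall>t\<ge>T0. \<phi> \<epsilon>' t \<in> interior K"
    using inside[OF \<epsilon>'] by (auto simp: eventually_at_top_linorder)
  define T1 where "T1 = max \<bar>T\<bar> T0"
  have T1: "t > T" "\<bar>t\<bar> > T" "\<phi> \<epsilon>' t \<in> interior K" if "t > T1" for t
    using that T0 by (auto simp: T1_def)
  have ex1: "\<exists>!s. 0 < s \<and> s < \<epsilon>' \<and> \<phi> s t \<in> frontier K" if t: "t > T1" for t
  proof (rule ex_ex1I)
    obtain s0 where s0: "0 < s0" "s0 < \<epsilon>'" "\<phi> s0 t \<notin> K"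
      using outside[OF T1(1)[OF t] \<epsilon>'(1)] by blast
    have cont: "continuous_on {s0..\<epsilon>'} (\<lambda>s. \<phi> s t)"
      unfolding \<phi>_def using den_nz[OF T1(2)[OF t]] s0 \<epsilon>'
      by (intro continuous_intros) auto
    have "(\<lambda>s. \<phi> s t) ` {s0..\<epsilon>'} \<inter> frontier K \<noteq> {}"
    proof (rule connected_Int_frontier)
      show "connected ((\<lambda>s. \<phi> s t) ` {s0..\<epsilon>'})"
        using connected_continuous_image[OF cont] by simp
      have "\<phi> \<epsilon>' t \<in> K" using T1(3)[OF t] interior_subset by blast
      moreover have "\<epsilon>' \<in> {s0..\<epsilon>'}" "s0 \<in> {s0..\<epsilon>'}" using s0 by auto
      ultimately show "(\<lambda>s. \<phi> s t) ` {s0..\<epsilon>'} \<inter> K \<noteq> {}"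
          "(\<lambda>s. \<phi> s t) ` {s0..\<epsilon>'} - K \<noteq> {}"
        using s0(3) by blast+
    qed
    then obtain s where s: "s0 \<le> s" "s \<le> \<epsilon>'" "\<phi> s t \<in> frontier K" by auto
    then have "s \<noteq> \<epsilon>'"
      using T1(3)[OF t] by (auto simp: frontier_def)
    with s s0 show "\<exists>s. 0 < s \<and> s < \<epsilon>' \<and> \<phi> s t \<in> frontier K"
      by (intro exI[of _ s]) auto
  next
    have False if "0 < x" "x < y" "y < \<epsilon>'" "\<phi> x t \<in> frontier K" "\<phi> y t \<in> frontier K" for x y
    proof -
      have "\<phi> x t \<in> K" using that K frontier_subset_closed by blast
      from between[OF T1(1)[OF t] that(1-3) \<epsilon>'(2) this T1(3)[OF t]] that show False
        by (auto simp: frontier_def)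
    qed
    then show "x = y" if "0 < x \<and> x < \<epsilon>' \<and> \<phi> x t \<in> frontier K" "0 < y \<and> y < \<epsilon>' \<and> \<phi> y t \<in> frontier K" for x y
      using that by (cases x y rule: linorder_cases) blast+
  qed
  define g where "g t = (THE s. 0 < s \<and> s < \<epsilon>' \<and> \<phi> s t \<in> frontier K)" for t
  have g: "0 < g t" "g t < \<epsilon>'" "\<phi> (g t) t \<in> frontier K" if "t > T1" for t
    using theI'[OF ex1[OF that]] by (auto simp: g_def)
  have "(g \<longlongrightarrow> 0) at_top"
  proof (rule tendstoI)
    fix e :: real assume "e > 0"
    define \<delta> where "\<delta> = min e \<epsilon>' / 2"
    have \<delta>: "0 < \<delta>" "\<delta> < e" "\<delta> < \<epsilon>'" "\<delta> < \<epsilon>" using \<open>e > 0\<close> \<epsilon>' by (auto simp: \<delta>_def)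
    show "\<forall>\<^sub>F t in at_top. dist (g t) 0 < e"
      using inside[OF \<delta>(1) \<delta>(4)] eventually_gt_at_top[of T1]
    proof eventually_elim
      case (elim t)
      have "g t < \<delta>"
      proof (rule ccontr)
        assume "\<not> g t < \<delta>"
        then consider "g t = \<delta>" | "\<delta> < g t" by linarith
        then have "\<phi> (g t) t \<in> interior K"
        proof cases
          case 1
          with elim(1) show ?thesis by simp
        next
          case 2
          have "\<phi> \<delta> t \<in> K"
            using elim(1) interior_subset by blast
          from between[OF T1(1)[OF elim(2)] \<delta>(1) 2 g(2)[OF elim(2)] \<epsilon>'(2) this T1(3)[OF elim(2)]]
          show ?thesis .
        qed
        with g(3)[OF elim(2)] show False by (auto simp: frontier_def)
      qed
      with g(1)[OF elim(2)] \<delta> show ?case by (simp add: dist_real_def)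
    qed
  qed
  show False
  proof (rule no_single_branch[where P = P and T = T1 and \<epsilon> = \<epsilon>' and g = g])
    show "\<epsilon>' > 0" "(g \<longlongrightarrow> 0) at_top" by fact+
    show "g t > 0" if "t > T1" for t using g that by blast
    show "eval2 P s t = 0 \<longleftrightarrow> s = g t" if t: "t > T1" and s: "0 < \<bar>s\<bar>" "\<bar>s\<bar> < \<epsilon>'" for s t
    proof -
      have "eval2 P s t = 0 \<longleftrightarrow> \<phi> s t \<in> frontier K"
        using zero_iff[OF T1(2)[OF t]] s \<epsilon>' by auto
      also have "\<dots> \<longleftrightarrow> s = g t"
      proof
        assume *: "\<phi> s t \<in> frontier K"
        have "s > 0"
        proof (rule ccontr)
          assume "\<not> s > 0"
          with s \<epsilon>' have "- \<epsilon> < s" "s < 0" by auto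
          from neg[OF T1(1)[OF t] this] * show False by blast
        qed
        with * s ex1[OF t] g[OF t] show "s = g t" by auto
      qed (use g[OF t] in auto)
      finally show ?thesis .
    qed
    show "eval2 P s t \<noteq> 0" if t: "t < - T1" and s: "0 < \<bar>s\<bar>" "\<bar>s\<bar> < \<epsilon>'" for s t
    proof -
      have "t < - T" using t by (auto simp: T1_def)
      with left[OF this s(1)] zero_iff[of t s] s \<epsilon>' t show ?thesis
        by (auto simp: T1_def)
    qed
  qed
qed


section \<open>Recession directions of convex sets with algebraic boundary\<close>

definition recession_cone :: "'a::real_normed_vector set \<Rightarrow> 'a set" where
  "recession_cone K = {v. \<forall>x\<in>K. \<forall>r\<ge>0. x + r *\<^sub>R v \<in> K}"

lemma recession_coneD: "v \<in> recession_cone K \<Longrightarrow> x \<in> K \<Longrightarrow> r \<ge> 0 \<Longrightarrow> x + r *\<^sub>R v \<in> K"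
  by (simp add: recession_cone_def)

lemma recession_cone_zero: "0 \<in> recession_cone K"
  by (simp add: recession_cone_def)

lemma recession_cone_scaleR:
  assumes "v \<in> recession_cone K" "c \<ge> 0"
  shows "c *\<^sub>R v \<in> recession_cone K"
  unfolding recession_cone_def using recession_coneD[OF assms(1)] assms(2) by auto

lemma recession_cone_add:
  assumes "v \<in> recession_cone K" "w \<in> recession_cone K"
  shows "v + w \<in> recession_cone K"
  unfolding recession_cone_def
  using recession_coneD[OF assms(2)] recession_coneD[OF assms(1)]
  by (auto simp: scaleR_add_right add.assoc[symmetric])

lemma recession_cone_interior:
  assumes "v \<in> recession_cone K" "x \<in> interior K" "r \<ge> 0"
  shows "x + r *\<^sub>R v \<in> interior K"
proof -
  have "(+) (r *\<^sub>R v) ` K \<subseteq> K"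
  proof
    fix y assume "y \<in> (+) (r *\<^sub>R v) ` K"
    then obtain x where "x \<in> K" "y = x + r *\<^sub>R v"
      by (metis add.commute imageE)
    then show "y \<in> K"
      using recession_coneD[OF assms(1) _ assms(3)] by blast
  qed
  then have "interior ((+) (r *\<^sub>R v) ` K) \<subseteq> interior K"
    by (rule interior_mono)
  moreover have "r *\<^sub>R v + x \<in> (+) (r *\<^sub>R v) ` interior K"
    using assms(2) by blast
  ultimately have "r *\<^sub>R v + x \<in> interior K"
    unfolding interior_translation by blast
  then show ?thesis
    by (simp only: add.commute)
qed

text \<open>
The segment from \<open>a\<close> to the far point \<open>x m\<close> lies in \<open>K\<close>, and its point with weight \<open>r * e m\<close> tends
to \<open>a + r v\<close>.
\<close>
lemma recession_cone_limit:
  fixes K :: "'a::real_normed_vector set"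
  assumes "convex K" "closed K" "\<And>m::nat. x m \<in> K" "\<And>m. e m > 0" "e \<longlonglongrightarrow> 0"
    "(\<lambda>m. e m *\<^sub>R x m) \<longlonglongrightarrow> v"
  shows "v \<in> recession_cone K"
  unfolding recession_cone_def
proof (clarify)
  fix a :: 'a and r :: real assume "a \<in> K" "r \<ge> 0"
  let ?y = "\<lambda>m. (1 - r * e m) *\<^sub>R a + (r * e m) *\<^sub>R x m"
  have "?y \<longlonglongrightarrow> (1 - r * 0) *\<^sub>R a + r *\<^sub>R v"
    using assms(5,6) unfolding scaleR_scaleR[symmetric] by (intro tendsto_intros)
  then have lim: "?y \<longlonglongrightarrow> a + r *\<^sub>R v" by simp
  have "(\<lambda>m. r * e m) \<longlonglongrightarrow> r * 0"
    using assms(5) by (intro tendsto_intros)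
  then have "\<forall>\<^sub>F m in sequentially. r * e m < 1"
    by (rule order_tendstoD) simp
  then have "\<forall>\<^sub>F m in sequentially. ?y m \<in> K"
  proof eventually_elim
    case (elim m)
    then show ?case
      using convexD[OF assms(1) \<open>a \<in> K\<close> assms(3)[of m], of "1 - r * e m" "r * e m"] \<open>r \<ge> 0\<close> assms(4)[of m]
      by (auto intro: mult_nonneg_nonneg)
  qed
  from Lim_in_closed_set[OF assms(2) this _ lim] show "a + r *\<^sub>R v \<in> K" by simp
qed

lemma ray_in_recession_cone:
  fixes K :: "'a::real_normed_vector set"
  assumes "convex K" "closed K" "\<And>r. r \<ge> 0 \<Longrightarrow> a + r *\<^sub>R v \<in> K"
  shows "v \<in> recession_cone K"
proof (rule recession_cone_limit[OF assms(1,2)])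
  let ?e = "\<lambda>m::nat. inverse (real (Suc m))"
  show "a + real (Suc m) *\<^sub>R v \<in> K" for m
    by (rule assms(3)) simp
  show "?e \<longlonglongrightarrow> 0" by (rule LIMSEQ_inverse_real_of_nat)
  have "(\<lambda>m. ?e m *\<^sub>R a + v) \<longlonglongrightarrow> 0 *\<^sub>R a + v"
    by (intro tendsto_intros LIMSEQ_inverse_real_of_nat)
  moreover have "?e m *\<^sub>R (a + real (Suc m) *\<^sub>R v) = ?e m *\<^sub>R a + v" for m
    unfolding scaleR_add_right scaleR_scaleR by (simp del: of_nat_Suc)
  ultimately show "(\<lambda>m. ?e m *\<^sub>R (a + real (Suc m) *\<^sub>R v)) \<longlonglongrightarrow> v" by simp
qed auto

lemma closed_recession_cone:
  assumes "closed K"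
  shows "closed (recession_cone K)"
proof -
  have "recession_cone K = (\<Inter>x\<in>K. \<Inter>r\<in>{0..}. (\<lambda>v. x + r *\<^sub>R v) -` K)"
    by (auto simp: recession_cone_def)
  also have "closed \<dots>"
    using assms by (intro closed_INT ballI closed_vimage continuous_intros)
  finally show ?thesis .
qed

text \<open>
The ray from \<open>a\<close> in direction \<open>v\<close> has a point outside \<open>K\<close>. Nearby rays have a nearby point
outside \<open>K\<close>, and by convexity a ray starting in \<open>K\<close> never returns.
\<close>
lemma leaves_outside_recession_cone:
  fixes K :: "'a::real_normed_vector set"
  assumes "convex K" "closed K" "a \<in> K" "v \<notin> recession_cone K"
  obtains \<eta> R where "\<eta> > 0" "R > 0"
    "\<And>d r. norm (d - v) < \<eta> \<Longrightarrow> r \<ge> R \<Longrightarrow> a + r *\<^sub>R d \<notin> K"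
proof -
  obtain R where R: "R \<ge> 0" "a + R *\<^sub>R v \<notin> K"
    using ray_in_recession_cone[OF assms(1,2), of a v] assms(4) by blast
  with assms(3) have "R > 0" by (cases "R = 0") auto
  have "open ((\<lambda>d. a + R *\<^sub>R d) -` (- K))"
    using assms(2) by (intro open_vimage continuous_intros) auto
  moreover have "v \<in> (\<lambda>d. a + R *\<^sub>R d) -` (- K)" using R by simp
  ultimately obtain \<eta> where "\<eta> > 0" and \<eta>: "ball v \<eta> \<subseteq> (\<lambda>d. a + R *\<^sub>R d) -` (- K)"
    by (meson openE)
  have "a + r *\<^sub>R d \<notin> K" if "norm (d - v) < \<eta>" "r \<ge> R" for d r
  proof
    assume "a + r *\<^sub>R d \<in> K"
    then have "(1 - R / r) *\<^sub>R a + (R / r) *\<^sub>R (a + r *\<^sub>R d) \<in> K"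
      using that \<open>R > 0\<close> assms(1,3) by (intro convexD) (auto simp: field_simps)
    moreover have "(1 - R / r) *\<^sub>R a + (R / r) *\<^sub>R (a + r *\<^sub>R d) = a + R *\<^sub>R d"
      using that \<open>R > 0\<close> by (simp add: algebra_simps)
    moreover have "d \<in> ball v \<eta>"
      using that(1) by (simp add: dist_norm norm_minus_commute)
    ultimately show False using \<eta> by auto
  qed
  with \<open>\<eta> > 0\<close> \<open>R > 0\<close> show thesis using that by blast
qed

lemma real_algebraic_ray_line:
  fixes X :: "'a::euclidean_space set"
  assumes "real_algebraic X" "\<And>t. t \<ge> T \<Longrightarrow> b + t *\<^sub>R u \<in> X"
  shows "b + t *\<^sub>R u \<in> X"
proof -
  obtain p where p: "real_polynomial_function p" "X = {x. p x = 0}"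
    using assms(1) by (auto simp: real_algebraic_def)
  obtain N P where NP: "\<And>s t. 1 + 0 * s + 0 * t \<noteq> (0::real) \<Longrightarrow> eval2 P s t =
    (1 + 0 * s + 0 * t) ^ N * p ((b + s *\<^sub>R 0 + t *\<^sub>R u) /\<^sub>R (1 + 0 * s + 0 * t))"
    using homogenize_real_polynomial_function[OF p(1)] by metis
  then have eq: "poly (poly P 0) t = p (b + t *\<^sub>R u)" for t
    using NP[of 0 t] by simp
  have "poly P 0 = 0"
  proof (rule ccontr)
    assume "poly P 0 \<noteq> 0"
    from poly_nonzero_far_out[OF this] obtain S where "\<And>t. \<bar>t\<bar> > S \<Longrightarrow> poly (poly P 0) t \<noteq> 0" by blast
    moreover have "\<bar>max \<bar>S\<bar> T + 1\<bar> > S" "max \<bar>S\<bar> T + 1 \<ge> T" by auto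
    ultimately show False using assms(2)[of "max \<bar>S\<bar> T + 1"]
      by (auto simp: eq p(2))
  qed
  with eq[of t] show ?thesis by (simp add: p(2))
qed

text \<open>
Move a line parallel to \<open>u\<close> from an interior point of \<open>K\<close> towards \<open>b\<close> and stop at the first one,
through \<open>b'\<close>, that misses the interior. In the plane swept out, the boundary of \<open>K\<close> rises to
infinity along this line on one side, while nothing of \<open>K\<close> lies on the other side or near the
opposite end of the line: a half-branch without partner.
\<close>
lemma line_meets_interior:
  fixes K :: "'a::euclidean_space set"
  assumes K: "convex K" "closed K" "interior K \<noteq> {}" and alg: "real_algebraic (frontier K)"
    and u: "u \<in> recession_cone K" "- u \<notin> recession_cone K"
  shows "\<exists>\<tau>. b + \<tau> *\<^sub>R u \<in> interior K"
proof (rule ccontr)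
  assume no: "\<not> ?thesis"
  define O' where "O' = {x. \<exists>\<tau>. x + \<tau> *\<^sub>R u \<in> interior K}"
  have "O' = (\<Union>\<tau>. (\<lambda>x. x + \<tau> *\<^sub>R u) -` interior K)"
    by (auto simp: O'_def)
  also have "open \<dots>"
    by (intro open_UN ballI open_vimage continuous_intros) auto
  finally have "open O'" .
  obtain x0 where x0: "x0 \<in> interior K" using K by blast
  then have "x0 \<in> O'" by (auto simp: O'_def intro: exI[of _ 0])
  have "b \<notin> O'" using no by (auto simp: O'_def)
  define A where "A = {0..1} \<inter> (\<lambda>s. b + s *\<^sub>R (x0 - b)) -` (- O')"
  have "compact A"
    unfolding A_def using \<open>open O'\<close>
    by (intro compact_Int_closed closed_vimage continuous_intros) auto
  have "A \<noteq> {}"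
  proof -
    have "0 \<in> A" using \<open>b \<notin> O'\<close> by (simp add: A_def)
    then show ?thesis by blast
  qed
  then obtain m where "m \<in> A" and m: "\<And>s. s \<in> A \<Longrightarrow> s \<le> m"
    using compact_attains_sup[OF \<open>compact A\<close>] by blast
  have m01: "0 \<le> m" "m < 1"
    using \<open>m \<in> A\<close> \<open>x0 \<in> O'\<close> by (auto simp: A_def less_le)
  define b' where "b' = b + m *\<^sub>R (x0 - b)"
  define w where "w = x0 - b'"
  have b'_O: "b' + \<tau> *\<^sub>R u \<notin> interior K" for \<tau>
    using \<open>m \<in> A\<close> by (auto simp: A_def b'_def O'_def)
  have s_O: "\<exists>\<tau>. b' + s *\<^sub>R w + \<tau> *\<^sub>R u \<in> interior K" if "0 < s" "s \<le> 1" for s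
  proof -
    have "b' + s *\<^sub>R w = b + (m + s * (1 - m)) *\<^sub>R (x0 - b)"
      by (simp add: w_def b'_def algebra_simps)
    moreover have sm: "0 < s * (1 - m)" "s * (1 - m) \<le> 1 - m"
      using that m01 mult_right_mono[of s 1 "1 - m"] by auto
    moreover have "m + s * (1 - m) \<notin> A"
      using m[of "m + s * (1 - m)"] sm by auto
    moreover have "0 \<le> m + s * (1 - m)" "m + s * (1 - m) \<le> 1"
      using sm m01 by linarith+
    ultimately show ?thesis by (auto simp: A_def O'_def)
  qed
  have b'_K: "\<exists>t. b' + t *\<^sub>R u \<notin> K"
  proof (rule ccontr)
    assume "\<not> ?thesis"
    then have "b' + r *\<^sub>R (- u) \<in> K" for r
      by (metis scaleR_minus_left scaleR_minus_right)
    from ray_in_recession_cone[OF K(1,2) this] u show False by blast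
  qed
  \<comment> \<open>Otherwise a ray of the line lies in the boundary, hence by algebraicity the whole line does,
    and \<open>- u\<close> is a recession direction.\<close>
  have b'_out: "b' + t *\<^sub>R u \<notin> K" for t
  proof
    assume "b' + t *\<^sub>R u \<in> K"
    have "b' + r *\<^sub>R u \<in> frontier K" if "r \<ge> t" for r
    proof -
      have "b' + r *\<^sub>R u = (b' + t *\<^sub>R u) + (r - t) *\<^sub>R u"
        by (simp add: algebra_simps)
      also have "\<dots> \<in> K"
        using recession_coneD[OF u(1) \<open>b' + t *\<^sub>R u \<in> K\<close>] that by auto
      finally show ?thesis
        using b'_O[of r] K(2) by (auto simp: frontier_def)
    qed
    from real_algebraic_ray_line[OF alg this] b'_K K(2) show False
      using frontier_subset_closed by blast
  qed
  \<comment> \<open>A point below \<open>K\<close> on the line \<open>s = 1/2\<close>; with the point \<open>x0\<close> of \<open>K\<close> on the line \<open>s = 1\<close> it bounds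
    the height of \<open>K\<close> from below for \<open>0 < s < 1/2\<close>.\<close>
  have half_out: "\<exists>t. b' + (1/2) *\<^sub>R w + t *\<^sub>R u \<notin> K"
  proof (rule ccontr)
    assume "\<not> ?thesis"
    then have "b' + (1/2) *\<^sub>R w + r *\<^sub>R (- u) \<in> K" for r
      by (metis scaleR_minus_left scaleR_minus_right)
    from ray_in_recession_cone[OF K(1,2) this] u show False by blast
  qed
  then obtain \<tau>1 where \<tau>1: "b' + (1/2) *\<^sub>R w + \<tau>1 *\<^sub>R u \<notin> K" by blast
  have x0w: "b' + w = x0" by (simp add: w_def)
  have "x0 \<in> K" using x0 interior_subset by blast

  have neg_out: "b' + s *\<^sub>R w + t *\<^sub>R u \<notin> frontier K" if "s < 0" for s t
  proof
    assume "b' + s *\<^sub>R w + t *\<^sub>R u \<in> frontier K"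
    then have *: "b' + s *\<^sub>R w + t *\<^sub>R u \<in> K" using K(2) frontier_subset_closed by blast
    define \<mu> where "\<mu> = - s / (1 - s)"
    have \<mu>: "0 < \<mu>" "\<mu> < 1" "(1 - \<mu>) * s + \<mu> = 0"
      using that by (auto simp: \<mu>_def field_simps)
    have "(1 - \<mu>) *\<^sub>R (b' + s *\<^sub>R w + t *\<^sub>R u) + \<mu> *\<^sub>R (b' + w) \<in> interior K"
      using \<mu> x0 * K by (intro interior_convex_combination) (auto simp: x0w)
    also have "(1 - \<mu>) *\<^sub>R (b' + s *\<^sub>R w + t *\<^sub>R u) + \<mu> *\<^sub>R (b' + w) =
        b' + ((1 - \<mu>) * s + \<mu>) *\<^sub>R w + ((1 - \<mu>) * t) *\<^sub>R u"
      by (simp add: algebra_simps)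
    finally show False using b'_O \<mu>(3) by simp
  qed

  show False
  proof (rule no_single_branch_on_frontier[OF K(1,2) alg, where \<epsilon> = "1/2" and T = "2 * \<bar>\<tau>1\<bar>"
        and c = b' and a = w and b = u and \<alpha> = 1 and \<beta> = 0 and \<gamma> = 0]; (simp only: mult_zero_left add_0_right inverse_1 scaleR_one)?)
    show "\<forall>\<^sub>F t in at_top. b' + s *\<^sub>R w + t *\<^sub>R u \<in> interior K" if s: "0 < s" "s < 1/2" for s
    proof -
      obtain \<tau> where \<tau>: "b' + s *\<^sub>R w + \<tau> *\<^sub>R u \<in> interior K" using s_O[of s] s by auto
      show ?thesis
        using eventually_ge_at_top[of \<tau>]
      proof eventually_elim
        case (elim t)
        have "b' + s *\<^sub>R w + \<tau> *\<^sub>R u + (t - \<tau>) *\<^sub>R u \<in> interior K"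
          using recession_cone_interior[OF u(1) \<tau>] elim by simp
        then show ?case by (simp add: algebra_simps)
      qed
    qed
    show "\<exists>s>0. s < e \<and> b' + s *\<^sub>R w + t *\<^sub>R u \<notin> K" if "e > 0" for e t :: real
    proof -
      have "open ((\<lambda>s. b' + s *\<^sub>R w + t *\<^sub>R u) -` (- K))"
        using K(2) by (intro open_vimage continuous_intros) auto
      moreover have "0 \<in> (\<lambda>s. b' + s *\<^sub>R w + t *\<^sub>R u) -` (- K)" using b'_out[of t] by simp
      ultimately obtain d where d: "d > 0" "ball 0 d \<subseteq> (\<lambda>s. b' + s *\<^sub>R w + t *\<^sub>R u) -` (- K)"
        by (meson openE)
      define s where "s = min d e / 2"
      have s: "0 < s" "s < e" "s \<in> ball 0 d" using d(1) \<open>e > 0\<close> by (auto simp: s_def)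
      then have "b' + s *\<^sub>R w + t *\<^sub>R u \<notin> K" using d(2) by blast
      with s show ?thesis by blast
    qed
    show "b' + s *\<^sub>R w + t *\<^sub>R u \<notin> frontier K"
      if t: "t < - (2 * \<bar>\<tau>1\<bar>)" and s: "0 < \<bar>s\<bar>" "\<bar>s\<bar> < 1/2" for s t
    proof (cases "s > 0")
      case False
      with s show ?thesis by (intro neg_out) auto
    next
      case True
      show ?thesis
      proof
        assume "b' + s *\<^sub>R w + t *\<^sub>R u \<in> frontier K"
        then have *: "b' + s *\<^sub>R w + t *\<^sub>R u \<in> K" using K(2) frontier_subset_closed by blast
        define \<mu> where "\<mu> = (1/2 - s) / (1 - s)"
        have "\<mu> * (1 - s) = 1/2 - s"
          using s by (simp add: \<mu>_def)
        then have "(1 - \<mu>) * s + \<mu> = 1/2"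
          by (simp add: algebra_simps)
        moreover have "0 \<le> \<mu>" "\<mu> \<le> 1/2"
          using True s by (auto simp: \<mu>_def field_simps)
        ultimately have \<mu>: "0 \<le> \<mu>" "\<mu> \<le> 1/2" "(1 - \<mu>) * s + \<mu> = 1/2"
          by auto
        have "(1 - \<mu>) *\<^sub>R (b' + s *\<^sub>R w + t *\<^sub>R u) + \<mu> *\<^sub>R (b' + w) \<in> K"
          using \<mu> \<open>x0 \<in> K\<close> * K by (intro convexD) (auto simp: x0w)
        also have "(1 - \<mu>) *\<^sub>R (b' + s *\<^sub>R w + t *\<^sub>R u) + \<mu> *\<^sub>R (b' + w) =
            b' + ((1 - \<mu>) * s + \<mu>) *\<^sub>R w + ((1 - \<mu>) * t) *\<^sub>R u"
          by (simp add: algebra_simps)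
        finally have "b' + (1/2) *\<^sub>R w + ((1 - \<mu>) * t) *\<^sub>R u \<in> K" by (simp add: \<mu>(3))
        moreover have "\<tau>1 \<ge> (1 - \<mu>) * t"
        proof -
          have "(1 - \<mu>) * t \<le> 1/2 * t"
            using \<mu> t by (intro mult_right_mono_neg) auto
          also have "\<dots> \<le> \<tau>1" using t by auto
          finally show ?thesis .
        qed
        ultimately have "b' + (1/2) *\<^sub>R w + ((1 - \<mu>) * t) *\<^sub>R u + (\<tau>1 - (1 - \<mu>) * t) *\<^sub>R u \<in> K"
          by (meson recession_coneD[OF u(1)] diff_ge_0_iff_ge)
        with \<tau>1 show False by (simp add: algebra_simps)
      qed
    qed
  qed (simp_all add: neg_out)
qed

text \<open>
Suppose that there is a second recession direction \<open>v\<close>, and turn \<open>u\<close> away from \<open>v\<close> as far as the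
recession cone permits, obtaining an extreme direction \<open>w\<close>. All lines parallel to \<open>w\<close> meet the
interior of \<open>K\<close>, so in the plane through \<open>a\<close> spanned by \<open>v\<close> and \<open>w\<close> the boundary of \<open>K\<close> has no
asymptote parallel to \<open>w\<close> and becomes tangent to the line at infinity in direction \<open>w\<close>. Since
neither \<open>- w\<close> nor its neighbours are recession directions, this half-branch has no partner.
The coordinate \<open>1 / s\<close> measures the distance travelled in direction \<open>- v\<close>, and \<open>t\<close> the slope.
\<close>
lemma recession_cone_subset_ray:
  fixes K :: "'a::euclidean_space set"
  assumes K: "convex K" "closed K" "interior K \<noteq> {}" and alg: "real_algebraic (frontier K)"
    and pointed: "\<And>v. v \<in> recession_cone K \<Longrightarrow> - v \<in> recession_cone K \<Longrightarrow> v = 0"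
    and u: "u \<in> recession_cone K" "u \<noteq> 0"
    and v: "v \<in> recession_cone K"
  shows "\<exists>c\<ge>0. v = c *\<^sub>R u"
proof (rule ccontr)
  assume no: "\<not> ?thesis"
  then have "v \<noteq> 0" by (metis order_refl scale_zero_left)
  \<comment> \<open>The maximum \<open>m\<close> of \<open>E\<close> yields the extreme direction \<open>w = u - m v\<close>.\<close>
  define E where "E = {\<eta>. \<eta> \<ge> 0 \<and> u - \<eta> *\<^sub>R v \<in> recession_cone K}"
  have "0 \<in> E" using u by (simp add: E_def)
  have "E = {0..} \<inter> (\<lambda>\<eta>. u - \<eta> *\<^sub>R v) -` recession_cone K"
    by (auto simp: E_def)
  also have "closed \<dots>"
    using closed_recession_cone[OF K(2)] by (intro closed_Int closed_vimage continuous_intros) auto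
  finally have "closed E" .
  have "bdd_above E"
  proof (rule ccontr)
    assume "\<not> bdd_above E"
    then have "\<forall>m::nat. \<exists>\<eta>\<in>E. \<eta> > real (Suc m)"
      unfolding bdd_above_def by (meson not_le)
    then obtain \<eta> where \<eta>: "\<And>m::nat. \<eta> m \<in> E" "\<And>m. \<eta> m > real (Suc m)" by metis
    have pos: "\<eta> m > 0" for m using \<eta>(2)[of m] by linarith
    have lim: "(\<lambda>m. inverse (\<eta> m)) \<longlonglongrightarrow> 0"
    proof (rule tendsto_sandwich[OF _ _ tendsto_const LIMSEQ_inverse_real_of_nat])
      show "\<forall>\<^sub>F m in sequentially. 0 \<le> inverse (\<eta> m)"
        using pos by (auto simp: less_imp_le)
      show "\<forall>\<^sub>F m in sequentially. inverse (\<eta> m) \<le> inverse (real (Suc m))"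
        using \<eta>(2) by (intro always_eventually allI le_imp_inverse_le) (auto simp: less_imp_le simp del: of_nat_Suc)
    qed
    have "(\<lambda>m. inverse (\<eta> m) *\<^sub>R u - v) \<longlonglongrightarrow> 0 *\<^sub>R u - v"
      by (intro tendsto_intros lim)
    then have "(\<lambda>m. inverse (\<eta> m) *\<^sub>R u - v) \<longlonglongrightarrow> - v" by simp
    moreover have "inverse (\<eta> m) *\<^sub>R u - v \<in> recession_cone K" for m
    proof -
      have "inverse (\<eta> m) *\<^sub>R (u - \<eta> m *\<^sub>R v) \<in> recession_cone K"
        using \<eta>(1)[of m] pos[of m] by (intro recession_cone_scaleR) (auto simp: E_def)
      then show ?thesis using pos[of m] by (simp add: scaleR_diff_right)
    qed
    ultimately have "- v \<in> recession_cone K"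
      using closed_sequentially[OF closed_recession_cone[OF K(2)], of "\<lambda>m. inverse (\<eta> m) *\<^sub>R u - v"] by blast
    with pointed v \<open>v \<noteq> 0\<close> show False by blast
  qed
  define m where "m = Sup E"
  have "m \<in> E"
    unfolding m_def using closed_contains_Sup \<open>closed E\<close> \<open>bdd_above E\<close> \<open>0 \<in> E\<close> by blast
  define w where "w = u - m *\<^sub>R v"
  have w: "w \<in> recession_cone K" "m \<ge> 0" using \<open>m \<in> E\<close> by (auto simp: E_def w_def)
  have "w \<noteq> 0"
  proof
    assume "w = 0"
    then have "u = m *\<^sub>R v" by (simp add: w_def)
    with u have "m \<noteq> 0" by auto
    with \<open>u = m *\<^sub>R v\<close> have "v = (1 / m) *\<^sub>R u" by simp
    with no w(2) show False by (metis divide_nonneg_nonneg zero_le_one)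
  qed
  then have w': "- w \<notin> recession_cone K" using pointed w(1) by blast
  have extremal: "w - \<eta> *\<^sub>R v \<notin> recession_cone K" if "\<eta> > 0" for \<eta>
  proof
    assume "w - \<eta> *\<^sub>R v \<in> recession_cone K"
    then have "m + \<eta> \<in> E" using w that by (simp add: E_def w_def algebra_simps)
    then have "m + \<eta> \<le> m" unfolding m_def by (intro cSup_upper \<open>bdd_above E\<close>)
    with that show False by simp
  qed
  obtain a where a: "a \<in> interior K" using K by blast
  then have "a \<in> K" using interior_subset by blast
  obtain \<eta> R where \<eta>: "\<eta> > 0" "R > 0" and out: "\<And>d r. norm (d - (- w)) < \<eta> \<Longrightarrow> r \<ge> R \<Longrightarrow> a + r *\<^sub>R d \<notin> K"
    using leaves_outside_recession_cone[OF K(1,2) \<open>a \<in> K\<close> w'] by metis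
  \<comment> \<open>For slopes beyond \<open>T\<close> the directions \<open>- w + (1 / t) v\<close> are within \<open>\<eta>\<close> of \<open>- w\<close>, and for \<open>\<bar>s\<bar> < 1\<close>
    the distances travelled exceed \<open>R\<close>.\<close>
  define T where "T = max R (norm v / \<eta>)"
  have T: "T > 0" "R \<le> T" "norm v \<le> T * \<eta>"
    using \<eta> \<open>v \<noteq> 0\<close> by (auto simp: T_def pos_divide_le_eq[symmetric])
  have far: "a + r *\<^sub>R (- w + \<kappa> *\<^sub>R v) \<notin> K" if "r \<ge> R" "\<bar>\<kappa>\<bar> < 1 / T" for r \<kappa>
  proof (rule out)
    have "norm (\<kappa> *\<^sub>R v) < 1 / T * norm v"
      unfolding norm_scaleR using that(2) \<open>v \<noteq> 0\<close> by (intro mult_strict_right_mono) auto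
    also have "\<dots> \<le> \<eta>" using T by (simp add: field_simps)
    finally show "norm (- w + \<kappa> *\<^sub>R v - - w) < \<eta>" by simp
  qed (use that in auto)
  have \<phi>: "(- v + s *\<^sub>R a + t *\<^sub>R w) /\<^sub>R (0 + 1 * s + 0 * t) = a + (1 / s) *\<^sub>R (t *\<^sub>R w - v)"
    if "s \<noteq> 0" for s t :: real
    using that by (simp add: algebra_simps inverse_eq_divide)
  have far_r: "r * (1 / \<bar>s\<bar>) \<ge> R" if "r > T" "0 < \<bar>s\<bar>" "\<bar>s\<bar> < 1" for r s :: real
  proof -
    have "1 \<le> 1 / \<bar>s\<bar>" using that by simp
    then have "r * 1 \<le> r * (1 / \<bar>s\<bar>)" using that T by (intro mult_left_mono) auto
    with that T show ?thesis by simp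
  qed
  have fK: "frontier K \<subseteq> K" using K(2) frontier_subset_closed by blast
  show False
  proof (rule no_single_branch_on_frontier[OF K(1,2) alg, where \<epsilon> = 1 and T = T
        and c = "- v" and a = a and b = w and \<alpha> = 0 and \<beta> = 1 and \<gamma> = 0])
    show "\<forall>\<^sub>F t in at_top. (- v + s *\<^sub>R a + t *\<^sub>R w) /\<^sub>R (0 + 1 * s + 0 * t) \<in> interior K"
      if s: "0 < s" "s < 1" for s
    proof -
      obtain \<tau> where \<tau>: "(a - (1 / s) *\<^sub>R v) + \<tau> *\<^sub>R w \<in> interior K"
        using line_meets_interior[OF K alg w(1) w'] by blast
      show ?thesis
        using eventually_ge_at_top[of "\<tau> * s"]
      proof eventually_elim
        case (elim t)
        have "(a - (1 / s) *\<^sub>R v) + \<tau> *\<^sub>R w + (t / s - \<tau>) *\<^sub>R w \<in> interior K"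
          using recession_cone_interior[OF w(1) \<tau>] elim s by (simp add: pos_le_divide_eq)
        also have "(a - (1 / s) *\<^sub>R v) + \<tau> *\<^sub>R w + (t / s - \<tau>) *\<^sub>R w = a + (1 / s) *\<^sub>R (t *\<^sub>R w - v)"
          by (simp add: algebra_simps)
        finally show ?case using \<phi> s by simp
      qed
    qed
    show "\<exists>s>0. s < e \<and> (- v + s *\<^sub>R a + t *\<^sub>R w) /\<^sub>R (0 + 1 * s + 0 * t) \<notin> K"
      if t: "t > T" and "e > 0" for e t :: real
    proof -
      have "t > 0" using t T by auto
      have "t *\<^sub>R w - v \<notin> recession_cone K"
      proof
        assume "t *\<^sub>R w - v \<in> recession_cone K"
        from recession_cone_scaleR[OF this, of "1 / t"] extremal[of "1 / t"] \<open>t > 0\<close> show False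
          by (simp add: scaleR_diff_right)
      qed
      from leaves_outside_recession_cone[OF K(1,2) \<open>a \<in> K\<close> this] obtain \<eta>' R'
        where R': "\<eta>' > 0" "R' > 0" "\<And>d r. norm (d - (t *\<^sub>R w - v)) < \<eta>' \<Longrightarrow> r \<ge> R' \<Longrightarrow> a + r *\<^sub>R d \<notin> K"
        by metis
      define s where "s = min (e / 2) (1 / R')"
      have s: "0 < s" "s < e" using \<open>e > 0\<close> R' by (auto simp: s_def)
      moreover have "1 / s \<ge> R'"
      proof -
        have "s \<le> 1 / R'" by (simp add: s_def)
        then show ?thesis using s R' by (simp add: field_simps)
      qed
      then have "a + (1 / s) *\<^sub>R (t *\<^sub>R w - v) \<notin> K" using R' by simp
      ultimately show ?thesis using \<phi> by (intro exI[of _ s]) auto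
    qed
    show "(- v + s *\<^sub>R a + t *\<^sub>R w) /\<^sub>R (0 + 1 * s + 0 * t) \<notin> frontier K"
      if t: "t > T" and s: "- 1 < s" "s < 0" for s t
    proof -
      have "t > 0" using t T by auto
      have "a + (t * (1 / \<bar>s\<bar>)) *\<^sub>R (- w + (1 / t) *\<^sub>R v) \<notin> K"
        using t s T \<open>t > 0\<close> by (intro far far_r) (auto simp: field_simps)
      also have "a + (t * (1 / \<bar>s\<bar>)) *\<^sub>R (- w + (1 / t) *\<^sub>R v) = a + (1 / s) *\<^sub>R (t *\<^sub>R w - v)"
        using s \<open>t > 0\<close> by (simp add: algebra_simps)
      finally show ?thesis using \<phi> s fK by auto
    qed
    show "(- v + s *\<^sub>R a + t *\<^sub>R w) /\<^sub>R (0 + 1 * s + 0 * t) \<notin> frontier K"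
      if t: "t < - T" and s: "0 < \<bar>s\<bar>" "\<bar>s\<bar> < 1" for s t
    proof (cases "s > 0")
      case True
      have "a + (- t * (1 / \<bar>s\<bar>)) *\<^sub>R (- w + (1 / t) *\<^sub>R v) \<notin> K"
        using t s T by (intro far far_r) (auto simp: field_simps)
      also have "a + (- t * (1 / \<bar>s\<bar>)) *\<^sub>R (- w + (1 / t) *\<^sub>R v) = a + (1 / s) *\<^sub>R (t *\<^sub>R w - v)"
        using True t T by (simp add: algebra_simps)
      finally show ?thesis using \<phi>[of s t] True fK by auto
    next
      case False
      then have "s < 0" using s by auto
      have "(- t) *\<^sub>R w + v \<in> recession_cone K"
        using w(1) v t T by (intro recession_cone_add recession_cone_scaleR) auto
      from recession_cone_interior[OF this a, of "- (1 / s)"] \<open>s < 0\<close>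
      have "a + (- (1 / s)) *\<^sub>R ((- t) *\<^sub>R w + v) \<in> interior K" by simp
      also have "a + (- (1 / s)) *\<^sub>R ((- t) *\<^sub>R w + v) = a + (1 / s) *\<^sub>R (t *\<^sub>R w - v)"
        by (simp add: algebra_simps)
      finally show ?thesis using \<phi>[of s t] \<open>s < 0\<close> by (auto simp: frontier_def)
    qed
  qed auto
qed


section \<open>Supporting hyperplanes at finite points\<close>

lemma support_interior_pos:
  fixes K :: "'a::euclidean_space set"
  assumes "\<And>x. x \<in> K \<Longrightarrow> n \<bullet> (x - z) \<ge> 0" "n \<noteq> 0" "c \<in> interior K"
  shows "n \<bullet> (c - z) > 0"
proof -
  obtain e where "e > 0" "cball c e \<subseteq> K"
    using assms(3) mem_interior_cball by blast
  define d where "d = (e / norm n) *\<^sub>R n"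
  have "norm d = e" using assms(2) \<open>e > 0\<close> by (simp add: d_def)
  then have "c - d \<in> K" using \<open>cball c e \<subseteq> K\<close> by (auto simp: dist_norm)
  then have "n \<bullet> (c - d - z) \<ge> 0" by (rule assms(1))
  moreover have "n \<bullet> d > 0" using assms(2) \<open>e > 0\<close> by (simp add: d_def)
  ultimately show ?thesis by (simp add: inner_diff_right)
qed

text \<open>
If there are two supporting hyperplanes at \<open>z\<close>, some plane through \<open>z\<close> and an interior point \<open>c\<close>
cuts the tangent cone of \<open>K\<close> in an angle smaller than a half-plane. Let \<open>v\<close> span one edge of this
angle. The boundary of \<open>K\<close> leaves \<open>z\<close> tangentially to \<open>v\<close>, and no boundary point lies near the
opposite ray, which again is a half-branch without partner. In the coordinates \<open>s\<close> and \<open>t\<close>, the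
slope against \<open>v\<close> and the inverse distance from \<open>z\<close>, the curve is blown up at \<open>z\<close>.
\<close>
lemma unique_support_normal:
  fixes K :: "'a::euclidean_space set"
  assumes K: "convex K" "closed K" "interior K \<noteq> {}" and alg: "real_algebraic (frontier K)"
    and strict: "no_segments (frontier K)"
    and o: "z \<in> K"
    and n1: "norm n1 = 1" "\<And>x. x \<in> K \<Longrightarrow> n1 \<bullet> (x - z) \<ge> 0"
    and n2: "norm n2 = 1" "\<And>x. x \<in> K \<Longrightarrow> n2 \<bullet> (x - z) \<ge> 0"
  shows "n1 = n2"
proof (rule ccontr)
  assume "n1 \<noteq> n2"
  obtain c where c: "c \<in> interior K" using K by blast
  define w where "w = c - z"
  have nz: "n1 \<noteq> 0" "n2 \<noteq> 0" using n1(1) n2(1) by auto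
  have wpos: "n1 \<bullet> w > 0" "n2 \<bullet> w > 0"
    unfolding w_def using support_interior_pos[OF _ _ c] n1 n2 nz by auto
  \<comment> \<open>A direction on which the two normals disagree in sign.\<close>
  define e where "e = n2 - n1"
  have "n1 \<bullet> n2 < 1"
  proof -
    have "0 < (norm (n1 - n2))\<^sup>2" using \<open>n1 \<noteq> n2\<close> by simp
    also have "\<dots> = 2 - 2 * (n1 \<bullet> n2)"
      using n1(1) n2(1) by (simp add: power2_norm_eq_inner inner_diff norm_eq_1 inner_commute)
    finally show ?thesis by simp
  qed
  then have e: "n1 \<bullet> e < 0" "n2 \<bullet> e > 0"
    using n1(1) n2(1) by (simp_all add: e_def inner_diff_right norm_eq_1 inner_commute)
  \<comment> \<open>The open tangent cone at \<open>z\<close>. In the plane spanned by \<open>e\<close> and \<open>w\<close>, its edge on the side of \<open>e\<close> is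
    \<open>e + \<beta> w\<close> for the infimum \<open>\<beta>\<close> of \<open>S\<close>.\<close>
  define C where "C = {d. \<exists>r>0. z + r *\<^sub>R d \<in> interior K}"
  have C_pos: "n1 \<bullet> d > 0" "n2 \<bullet> d > 0" if d: "d \<in> C" for d
  proof -
    obtain r where r: "r > 0" "z + r *\<^sub>R d \<in> interior K" using d by (auto simp: C_def)
    from support_interior_pos[OF n1(2) nz(1) r(2)] support_interior_pos[OF n2(2) nz(2) r(2)] r(1)
    show "n1 \<bullet> d > 0" "n2 \<bullet> d > 0" by (simp_all add: zero_less_mult_iff)
  qed
  have "C = (\<Union>r\<in>{0<..}. (\<lambda>d. z + r *\<^sub>R d) -` interior K)"
    by (auto simp: C_def)
  also have "open \<dots>" by (intro open_UN ballI open_vimage continuous_intros) auto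
  finally have "open C" .
  have shrink: "z + r *\<^sub>R d \<in> interior K" if "z + R *\<^sub>R d \<in> interior K" "0 < r" "r \<le> R" for r R d
  proof -
    have "(1 - r / R) *\<^sub>R z + (r / R) *\<^sub>R (z + R *\<^sub>R d) \<in> interior K"
      using that K o by (intro interior_convex_combination) auto
    then show ?thesis using that by (simp add: algebra_simps)
  qed
  have C_add: "d + \<kappa> *\<^sub>R w \<in> C" if d: "r > 0" "z + r *\<^sub>R d \<in> K" and "\<kappa> > 0" for d r \<kappa>
  proof -
    define \<mu> where "\<mu> = r * \<kappa> / (1 + r * \<kappa>)"
    have p: "r * \<kappa> > 0" using that by simp
    have \<mu>: "0 < \<mu>" "\<mu> < 1" "\<mu> = (1 - \<mu>) * r * \<kappa>"
      using p by (auto simp: \<mu>_def field_simps)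
    have "(1 - \<mu>) *\<^sub>R (z + r *\<^sub>R d) + \<mu> *\<^sub>R c \<in> interior K"
      using \<mu> d c K by (intro interior_convex_combination) auto
    also have "(1 - \<mu>) *\<^sub>R (z + r *\<^sub>R d) + \<mu> *\<^sub>R c = z + ((1 - \<mu>) * r) *\<^sub>R d + \<mu> *\<^sub>R w"
      by (simp add: w_def algebra_simps)
    also have "\<dots> = z + ((1 - \<mu>) * r) *\<^sub>R (d + \<kappa> *\<^sub>R w)"
      by (subst (2) \<mu>(3)) (simp add: algebra_simps)
    finally show ?thesis unfolding C_def using \<mu> d by (auto intro!: exI[of _ "(1 - \<mu>) * r"])
  qed
  define S where "S = {\<beta>. e + \<beta> *\<^sub>R w \<in> C}"
  have "S = (\<lambda>\<beta>. e + \<beta> *\<^sub>R w) -` C" by (auto simp: S_def)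
  also have "open \<dots>" using \<open>open C\<close> by (intro open_vimage continuous_intros)
  finally have "open S" .
  have S_up: "\<beta>' \<in> S" if \<beta>: "\<beta> \<in> S" "\<beta> < \<beta>'" for \<beta> \<beta>'
  proof -
    obtain r where r: "r > 0" "z + r *\<^sub>R (e + \<beta> *\<^sub>R w) \<in> interior K"
      using \<beta>(1) by (auto simp: S_def C_def)
    then have "e + \<beta> *\<^sub>R w + (\<beta>' - \<beta>) *\<^sub>R w \<in> C"
      using \<beta>(2) interior_subset by (intro C_add[of r]) auto
    then show ?thesis by (simp add: S_def algebra_simps)
  qed
  have S_bound: "\<beta> > 0" if "\<beta> \<in> S" for \<beta>
  proof (rule ccontr)
    assume "\<not> \<beta> > 0"
    then have "\<beta> * (n1 \<bullet> w) \<le> 0" using wpos by (simp add: mult_nonpos_nonneg)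
    moreover have "n1 \<bullet> (e + \<beta> *\<^sub>R w) > 0" using that by (intro C_pos) (simp add: S_def)
    ultimately show False using e by (simp add: inner_add_right)
  qed
  have "S \<noteq> {}"
  proof -
    have "w \<in> C" using c by (auto simp: C_def w_def intro!: exI[of _ 1])
    have "open ((\<lambda>\<delta>. w + \<delta> *\<^sub>R e) -` C)" using \<open>open C\<close> by (intro open_vimage continuous_intros)
    moreover have "0 \<in> (\<lambda>\<delta>. w + \<delta> *\<^sub>R e) -` C" using \<open>w \<in> C\<close> by simp
    ultimately obtain \<delta> where "\<delta> > 0" "ball 0 \<delta> \<subseteq> (\<lambda>\<delta>. w + \<delta> *\<^sub>R e) -` C" by (meson openE)
    then have \<delta>: "w + (\<delta>/2) *\<^sub>R e \<in> C" "\<delta> > 0" by (auto simp: subset_iff)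
    then obtain r where r: "r > 0" "z + r *\<^sub>R (w + (\<delta>/2) *\<^sub>R e) \<in> interior K" by (auto simp: C_def)
    moreover have "r *\<^sub>R (w + (\<delta>/2) *\<^sub>R e) = (r * (\<delta>/2)) *\<^sub>R (e + (2/\<delta>) *\<^sub>R w)"
      using \<delta>(2) by (simp add: algebra_simps)
    ultimately have "2/\<delta> \<in> S" using \<delta>(2)
      by (auto simp: S_def C_def intro!: exI[of _ "r * (\<delta>/2)"])
    then show ?thesis by blast
  qed
  have bdd: "bdd_below S" using S_bound by (auto simp: bdd_below_def intro!: exI[of _ 0] less_imp_le)
  define \<beta> where "\<beta> = Inf S"
  have "\<beta> \<notin> S"
  proof
    assume "\<beta> \<in> S"
    then obtain d where d: "d > 0" "ball \<beta> d \<subseteq> S" using \<open>open S\<close> by (meson openE)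
    then have "\<beta> - d/2 \<in> S" by (auto simp: subset_iff dist_real_def)
    then have "\<beta> \<le> \<beta> - d/2" unfolding \<beta>_def by (intro cInf_lower bdd)
    with d show False by simp
  qed
  have above: "\<beta>' \<in> S" if "\<beta> < \<beta>'" for \<beta>'
    using that S_up \<open>S \<noteq> {}\<close> bdd unfolding \<beta>_def by (meson cInf_less_iff)
  have "\<beta> \<ge> 0" unfolding \<beta>_def using \<open>S \<noteq> {}\<close> S_bound by (intro cInf_greatest) (auto simp: less_imp_le)
  define v where "v = e + \<beta> *\<^sub>R w"
  have "v \<notin> C" using \<open>\<beta> \<notin> S\<close> by (simp add: S_def v_def)
  have v_up: "v + s *\<^sub>R w \<in> C" if "s > 0" for s
    using above[of "\<beta> + s"] that by (simp add: S_def v_def algebra_simps)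
  have n2v: "n2 \<bullet> v > 0"
    using e wpos \<open>\<beta> \<ge> 0\<close> by (simp add: v_def inner_add_right add_pos_nonneg)
  then have "v \<noteq> 0" by auto
  \<comment> \<open>For \<open>\<bar>s\<bar> < \<epsilon>\<close> the direction \<open>v + s w\<close> stays on the positive side of \<open>n2\<close>, so the opposite
    direction leads out of \<open>K\<close>.\<close>
  define \<epsilon> where "\<epsilon> = min 1 ((n2 \<bullet> v) / (n2 \<bullet> w))"
  have "\<epsilon> > 0" using n2v wpos by (simp add: \<epsilon>_def)
  have \<epsilon>: "n2 \<bullet> (v + s *\<^sub>R w) > 0" if "\<bar>s\<bar> < \<epsilon>" for s
  proof -
    have "\<bar>s\<bar> < (n2 \<bullet> v) / (n2 \<bullet> w)" using that by (simp add: \<epsilon>_def)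
    then have "\<bar>s\<bar> * (n2 \<bullet> w) < n2 \<bullet> v" using wpos by (simp add: pos_less_divide_eq)
    moreover have "- (s * (n2 \<bullet> w)) \<le> \<bar>s\<bar> * (n2 \<bullet> w)" using wpos
      by (metis abs_ge_minus_self mult_le_cancel_right mult_minus_left not_less_iff_gr_or_eq)
    ultimately show ?thesis by (simp add: inner_add_right)
  qed
  have fK: "frontier K \<subseteq> K" using K(2) frontier_subset_closed by blast
  have \<phi>: "(v + s *\<^sub>R w + t *\<^sub>R z) /\<^sub>R (0 + 0 * s + 1 * t) = z + (1 / t) *\<^sub>R (v + s *\<^sub>R w)"
    if "t \<noteq> 0" for s t :: real
    using that by (simp add: algebra_simps inverse_eq_divide)
  show False
  proof (rule no_single_branch_on_frontier[OF K(1,2) alg \<open>\<epsilon> > 0\<close>, where T = 0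
        and c = v and a = w and b = z and \<alpha> = 0 and \<beta> = 0 and \<gamma> = 1])
    show "\<forall>\<^sub>F t in at_top. (v + s *\<^sub>R w + t *\<^sub>R z) /\<^sub>R (0 + 0 * s + 1 * t) \<in> interior K"
      if s: "0 < s" "s < \<epsilon>" for s
    proof -
      obtain r where r: "r > 0" "z + r *\<^sub>R (v + s *\<^sub>R w) \<in> interior K"
        using v_up[OF s(1)] by (auto simp: C_def)
      show ?thesis
        using eventually_ge_at_top[of "1 / r"] eventually_gt_at_top[of 0]
      proof eventually_elim
        case (elim t)
        have "z + (1 / t) *\<^sub>R (v + s *\<^sub>R w) \<in> interior K"
        proof (rule shrink[OF r(2)])
          show "0 < 1 / t" using elim by simp
          show "1 / t \<le> r" using elim r(1) by (simp add: pos_divide_le_eq mult.commute)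
        qed
        with \<phi>[of t s] elim show ?case by simp
      qed
    qed
    show "\<exists>s>0. s < e \<and> (v + s *\<^sub>R w + t *\<^sub>R z) /\<^sub>R (0 + 0 * s + 1 * t) \<notin> K"
      if t: "t > 0" and "e > 0" for e t :: real
    proof (rule ccontr)
      assume "\<not> ?thesis"
      then have in_K: "z + (1 / t) *\<^sub>R (v + s *\<^sub>R w) \<in> K" if "0 < s" "s < e" for s
        using \<phi>[of t s] t that by auto
      have "((\<lambda>s. z + (1 / t) *\<^sub>R (v + s *\<^sub>R w)) \<longlongrightarrow> z + (1 / t) *\<^sub>R (v + 0 *\<^sub>R w)) (at_right 0)"
        by (intro tendsto_intros)
      moreover have "\<forall>\<^sub>F s in at_right 0. z + (1 / t) *\<^sub>R (v + s *\<^sub>R w) \<in> K"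
        unfolding eventually_at_right[OF \<open>e > 0\<close>] using in_K \<open>e > 0\<close> by blast
      ultimately have end_K: "z + (1 / t) *\<^sub>R v \<in> K"
        using Lim_in_closed_set[OF K(2), of "\<lambda>s. z + (1 / t) *\<^sub>R (v + s *\<^sub>R w)" "at_right 0"] by simp
      have seg_K: "closed_segment z (z + (1 / t) *\<^sub>R v) \<subseteq> K"
        using K(1) o end_K by (simp add: closed_segment_subset)
      have "x \<notin> interior K" if x: "x \<in> closed_segment z (z + (1 / t) *\<^sub>R v)" for x
      proof
        assume xi: "x \<in> interior K"
        obtain \<kappa> where \<kappa>: "0 \<le> \<kappa>" "x = (1 - \<kappa>) *\<^sub>R z + \<kappa> *\<^sub>R (z + (1 / t) *\<^sub>R v)"
          using x by (auto simp: closed_segment_def)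
        then have x_eq: "x = z + (\<kappa> / t) *\<^sub>R v" by (simp add: algebra_simps)
        have "\<kappa> \<noteq> 0"
        proof
          assume "\<kappa> = 0"
          with x_eq xi have "z \<in> interior K" by simp
          from support_interior_pos[OF n1(2) nz(1) this] show False by simp
        qed
        with \<kappa> t have "\<kappa> / t > 0" by simp
        with xi x_eq \<open>v \<notin> C\<close> show False by (auto simp: C_def)
      qed
      with seg_K K(2) have "closed_segment z (z + (1 / t) *\<^sub>R v) \<subseteq> frontier K"
        by (auto simp: frontier_def)
      moreover have "z \<noteq> z + (1 / t) *\<^sub>R v" using \<open>v \<noteq> 0\<close> t by simp
      ultimately show False using strict unfolding no_segments_def by blast
    qed
    show "(v + s *\<^sub>R w + t *\<^sub>R z) /\<^sub>R (0 + 0 * s + 1 * t) \<notin> frontier K"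
      if t: "t > 0" and s: "- \<epsilon> < s" "s < 0" for s t
    proof
      assume "(v + s *\<^sub>R w + t *\<^sub>R z) /\<^sub>R (0 + 0 * s + 1 * t) \<in> frontier K"
      then have "z + (1 / t) *\<^sub>R (v + s *\<^sub>R w) \<in> K" using \<phi>[of t s] t fK by auto
      from C_add[OF _ this, of "- s"] t s have "v \<in> C" by simp
      with \<open>v \<notin> C\<close> show False by blast
    qed
    show "(v + s *\<^sub>R w + t *\<^sub>R z) /\<^sub>R (0 + 0 * s + 1 * t) \<notin> frontier K"
      if t: "t < - 0" and s: "0 < \<bar>s\<bar>" "\<bar>s\<bar> < \<epsilon>" for s t
    proof
      assume "(v + s *\<^sub>R w + t *\<^sub>R z) /\<^sub>R (0 + 0 * s + 1 * t) \<in> frontier K"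
      then have "z + (1 / t) *\<^sub>R (v + s *\<^sub>R w) \<in> K" using \<phi>[of t s] t fK by auto
      from n2(2)[OF this] have "(n2 \<bullet> (v + s *\<^sub>R w)) / t \<ge> 0" by simp
      with \<epsilon>[OF s(2)] t show False by (simp add: zero_le_divide_iff)
    qed
  qed auto
qed


section \<open>Contractible convex hypersurfaces\<close>

text \<open>
If the relative boundary were contractible, its identity would extend to a map \<open>g\<close> of the whole
space into it. Using \<open>g\<close> inside \<open>C\<close> and the identity outside gives a map \<open>G\<close> that misses an
inner point \<open>a\<close> and is the identity far out. Sending \<open>x\<close> to the point opposite to \<open>G x\<close>
on a large sphere around \<open>a\<close> then gives a map without fixed points, against Brouwer.
\<close>
lemma rel_frontier_bounded_not_contractible:
  fixes C :: "'a::euclidean_space set"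
  assumes C: "convex C" "closed C" "bounded C" and ne: "rel_frontier C \<noteq> {}"
  shows "\<not> contractible (rel_frontier C)"
proof
  assume "contractible (rel_frontier C)"
  then have "\<exists>c. homotopic_with_canon (\<lambda>x. True) (rel_frontier C) (rel_frontier C) id (\<lambda>x. c)"
    by (simp add: contractible_def)
  then obtain g where g: "continuous_on UNIV g" "range g \<subseteq> rel_frontier C"
    and g_id: "\<And>x. x \<in> rel_frontier C \<Longrightarrow> g x = x"
    using nullhomotopic_into_rel_frontier_extension[of "rel_frontier C" id C] C ne
    by (auto simp: closed_rel_frontier)
  have "C \<noteq> {}" using ne by auto
  then obtain a where a: "a \<in> rel_interior C"
    using C(1) rel_interior_eq_empty by blast
  then have "a \<in> C" "a \<notin> rel_frontier C"
    using rel_interior_subset by (auto simp: rel_frontier_def)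
  obtain R where R: "R > 0" "C \<subseteq> ball a R"
    using bounded_subset_ballD[OF C(3)] by blast
  define B where "B = cball a R \<inter> affine hull C"
  have aB: "a \<in> B" using \<open>a \<in> C\<close> R by (auto simp: B_def hull_inc)
  have B: "compact B" "convex B" "B \<noteq> {}"
  proof -
    show "compact B" unfolding B_def by (intro compact_Int_closed) auto
    show "convex B" unfolding B_def
      by (intro convex_Int convex_cball affine_imp_convex affine_affine_hull)
  qed (use aB in blast)
  define G where "G x = (if x \<in> C then g x else x)" for x
  have "closed (affine hull C - rel_interior C)"
    using openin_rel_interior[of C] closed_affine_hull
    by (metis closedin_closed_trans closedin_def closedin_diff closedin_topspace topspace_euclidean_subtopology)
  then have cont_G: "continuous_on (C \<union> (affine hull C - rel_interior C)) G"
    unfolding G_def using C(2) g_id g(1)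
    by (intro continuous_on_cases)
       (auto intro: continuous_on_subset continuous_on_id simp: rel_frontier_def closure_closed)
  have "B \<subseteq> C \<union> (affine hull C - rel_interior C)"
    using rel_interior_subset by (auto simp: B_def)
  from continuous_on_subset[OF cont_G this] have cont_GB: "continuous_on B G" .
  have G_ne: "G x \<noteq> a" for x
    using g(2) \<open>a \<notin> rel_frontier C\<close> \<open>a \<in> C\<close> by (auto simp: G_def)
  have G_hull: "G x \<in> affine hull C" if "x \<in> affine hull C" for x
  proof -
    have "rel_frontier C \<subseteq> affine hull C"
      using C(2) hull_subset by (force simp: rel_frontier_def closure_closed)
    with that g(2) show ?thesis by (auto simp: G_def)
  qed
  \<comment> \<open>The antipode of the radial projection of \<open>G x\<close>.\<close>
  define h where "h x = a + (- R / norm (G x - a)) *\<^sub>R (G x - a)" for x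
  have h_dist: "dist a (h x) = R" for x
    using G_ne[of x] R by (simp add: h_def dist_norm)
  have "continuous_on B h"
    unfolding h_def using G_ne by (intro continuous_intros cont_GB) auto
  moreover have "h \<in> B \<rightarrow> B"
  proof
    fix x assume "x \<in> B"
    have "(1 - (- R / norm (G x - a))) *\<^sub>R a + (- R / norm (G x - a)) *\<^sub>R G x \<in> affine hull C"
      using \<open>x \<in> B\<close> aB G_hull by (intro mem_affine[OF affine_affine_hull]) (auto simp: B_def)
    then have "h x \<in> affine hull C" by (simp add: h_def algebra_simps)
    with h_dist show "h x \<in> B" by (simp add: B_def)
  qed
  ultimately obtain x where x: "x \<in> B" "h x = x"
    using brouwer[OF B] by blast
  then have dx: "dist a x = R" using h_dist[of x] by simp
  then have "x \<notin> C" using R by auto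
  then have "G x = x" by (simp add: G_def)
  then have "x = a + (- 1) *\<^sub>R (x - a)"
    using x(2) dx R by (simp add: h_def dist_norm norm_minus_commute algebra_simps)
  then have "2 *\<^sub>R (x - a) = 0" by (simp add: algebra_simps scaleR_2)
  with dx R show False by simp
qed

lemma subspace_symmetric_recession_cone:
  assumes "\<And>v. v \<in> recession_cone K \<Longrightarrow> - v \<in> recession_cone K"
  shows "subspace (recession_cone K)"
proof (rule subspaceI)
  show "c *\<^sub>R v \<in> recession_cone K" if "v \<in> recession_cone K" for c v
  proof (cases "c \<ge> 0")
    case False
    then have "(- c) *\<^sub>R (- v) \<in> recession_cone K"
      using that assms by (intro recession_cone_scaleR) auto
    then show ?thesis by simp
  qed (use that recession_cone_scaleR in blast)
qed (auto intro: recession_cone_zero recession_cone_add)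

text \<open>
The directions of an unbounded sequence in \<open>C\<close> accumulate at a recession direction.
\<close>
lemma bounded_if_trivial_recession:
  fixes C :: "'a::euclidean_space set"
  assumes "convex C" "closed C" "\<And>v. v \<in> recession_cone C \<Longrightarrow> v = 0"
  shows "bounded C"
proof (rule ccontr)
  assume "\<not> bounded C"
  then have "\<forall>m::nat. \<exists>x\<in>C. norm x > real (Suc m)"
    unfolding bounded_iff by (meson not_le)
  then obtain x where x: "\<And>m. x m \<in> C" "\<And>m::nat. norm (x m) > real (Suc m)" by metis
  have pos: "norm (x m) > 0" for m using x(2)[of m] by linarith
  define y where "y m = inverse (norm (x m)) *\<^sub>R x m" for m
  have "y m \<in> sphere 0 1" for m using pos[of m] by (simp add: y_def)
  then obtain v r where v: "v \<in> sphere 0 1" "strict_mono r" "(y \<circ> r) \<longlonglongrightarrow> v"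
    using compact_sphere[of "0::'a" 1] unfolding compact_def by metis
  have lim: "(\<lambda>m. inverse (norm (x m))) \<longlonglongrightarrow> 0"
  proof (rule tendsto_sandwich[OF _ _ tendsto_const LIMSEQ_inverse_real_of_nat])
    show "\<forall>\<^sub>F m in sequentially. inverse (norm (x m)) \<le> inverse (real (Suc m))"
      using x(2) by (intro always_eventually allI le_imp_inverse_le) (auto simp: less_imp_le simp del: of_nat_Suc)
  qed simp
  have "v \<in> recession_cone C"
  proof (rule recession_cone_limit[OF assms(1,2)])
    show "(x \<circ> r) m \<in> C" "inverse (norm (x (r m))) > 0" for m using x pos by auto
    show "(\<lambda>m. inverse (norm (x (r m)))) \<longlonglongrightarrow> 0"
      using LIMSEQ_subseq_LIMSEQ[OF lim v(2)] by (simp add: o_def)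
    show "(\<lambda>m. inverse (norm (x (r m))) *\<^sub>R (x \<circ> r) m) \<longlonglongrightarrow> v"
      using v(3) by (simp add: y_def o_def)
  qed
  from assms(3)[OF this] v(1) show False by simp
qed

text \<open>
If the recession cone is symmetric, it is a linear subspace \<open>L\<close>, and \<open>K\<close> is invariant under \<open>L\<close>.
The orthogonal projection along \<open>L\<close> retracts the boundary of \<open>K\<close> onto the relative boundary of a
bounded cross-section, which is not contractible.
\<close>
lemma asymmetric_recession_direction:
  fixes K :: "'a::euclidean_space set"
  assumes K: "convex K" "closed K" "interior K \<noteq> {}"
    and X: "contractible (frontier K)" "frontier K \<noteq> {}"
  obtains u where "u \<in> recession_cone K" "- u \<notin> recession_cone K"
proof (rule ccontr)
  assume "\<not> thesis"
  with that have sym: "\<And>v. v \<in> recession_cone K \<Longrightarrow> - v \<in> recession_cone K" by blast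
  define L where "L = recession_cone K"
  have "subspace L" unfolding L_def by (rule subspace_symmetric_recession_cone[OF sym])
  define P where "P = orthogonal_comp L"
  have P: "subspace P" "closed P" "convex P" "affine P" "P \<noteq> {}"
    unfolding P_def using subspace_orthogonal_comp[of L]
    by (auto simp: closed_subspace subspace_imp_convex subspace_imp_affine subspace_0 dest: subspace_0)
  define \<pi> where "\<pi> = closest_point P"
  have \<pi>_P: "\<pi> x \<in> P" for x
    unfolding \<pi>_def using P by (intro closest_point_in_set)
  have \<pi>_id: "\<pi> x = x" if "x \<in> P" for x
    unfolding \<pi>_def using that by (rule closest_point_self)
  have \<pi>_L: "x - \<pi> x \<in> L" for x
  proof -
    have le: "(x - \<pi> x) \<bullet> w \<le> 0" if "w \<in> P" for w
      using closest_point_dot[OF P(3,2), of "\<pi> x + w" x] subspace_add[OF P(1) \<pi>_P that] by (simp add: \<pi>_def)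
    have "(x - \<pi> x) \<bullet> w = 0" if "w \<in> P" for w
      using le[OF that] le[OF subspace_neg[OF P(1) that]] by simp
    then have "x - \<pi> x \<in> orthogonal_comp P"
      by (simp add: orthogonal_comp_def orthogonal_def inner_commute)
    then show ?thesis
      unfolding P_def by (simp add: orthogonal_comp_self \<open>subspace L\<close>)
  qed
  have K_L: "x + l \<in> K \<longleftrightarrow> x \<in> K" if "l \<in> L" for x l
  proof -
    have "x + l \<in> K" if "l \<in> L" "x \<in> K" for x l
      using recession_coneD[of l K x 1] that by (simp add: L_def)
    from this[OF that, of x] this[of "- l" "x + l"] sym[of l] that show ?thesis
      by (auto simp: L_def)
  qed
  have int_L: "x + l \<in> interior K \<longleftrightarrow> x \<in> interior K" if "l \<in> L" for x l
    using recession_cone_interior[of l K x 1] recession_cone_interior[of "- l" K "x + l" 1] that sym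
    by (auto simp: L_def)
  have fr_L: "\<pi> x \<in> frontier K \<longleftrightarrow> x \<in> frontier K" for x
    using K_L[OF \<pi>_L[of x], of "\<pi> x"] int_L[OF \<pi>_L[of x], of "\<pi> x"] K(2) by (simp add: frontier_def)
  have "frontier K \<inter> P retract_of frontier K"
    unfolding retract_of_def retraction_def
    using \<pi>_P \<pi>_id fr_L continuous_on_closest_point[OF P(3,2,5)]
    by (intro exI[of _ \<pi>]) (auto simp: \<pi>_def)
  from retract_of_contractible[OF X(1) this] have "contractible (frontier K \<inter> P)" .
  moreover obtain c where "c \<in> interior K" using K by blast
  then have "\<pi> c \<in> interior K \<inter> P"
    using int_L[OF \<pi>_L[of c], of "\<pi> c"] \<pi>_P by simp
  then have rf: "rel_frontier (K \<inter> P) = frontier K \<inter> P"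
    using convex_affine_rel_frontier_Int[OF K(1) P(4)] by blast
  moreover have "frontier K \<inter> P \<noteq> {}"
    using X(2) fr_L \<pi>_P by blast
  moreover have "bounded (K \<inter> P)"
  proof (rule bounded_if_trivial_recession)
    fix v assume v: "v \<in> recession_cone (K \<inter> P)"
    have *: "\<pi> c + r *\<^sub>R v \<in> K \<inter> P" if "r \<ge> 0" for r
      using recession_coneD[OF v _ that, of "\<pi> c"] \<open>\<pi> c \<in> interior K \<inter> P\<close> interior_subset by blast
    then have "v \<in> L"
      unfolding L_def using ray_in_recession_cone[OF K(1,2), of "\<pi> c" v] by blast
    moreover have "(\<pi> c + 1 *\<^sub>R v) - \<pi> c \<in> P"
      using *[of 1] \<pi>_P P(1) by (intro subspace_diff) auto
    then have "v \<in> P" by simp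
    ultimately show "v = 0"
      by (auto simp: P_def orthogonal_comp_def orthogonal_def)
  qed (use K P in \<open>auto intro: convex_Int\<close>)
  ultimately show False
    using rel_frontier_bounded_not_contractible[of "K \<inter> P"] K P by (auto simp: convex_Int)
qed


section \<open>Convex hypersurfaces with unique supporting hyperplanes\<close>

text \<open>
The closed graph theorem for compact targets, in the form that yields the continuity both of the
height function of a convex graph and of its unit normals.
\<close>
lemma continuous_on_from_closed_relation:
  fixes f :: "'a::euclidean_space \<Rightarrow> 'b::euclidean_space"
  assumes "compact T" "closed R"
    and f: "\<And>x. x \<in> S \<Longrightarrow> f x \<in> T \<and> (x, f x) \<in> R"
    and uniq: "\<And>x y. x \<in> S \<Longrightarrow> y \<in> T \<Longrightarrow> (x, y) \<in> R \<Longrightarrow> y = f x"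
  shows "continuous_on S f"
proof -
  have "(\<lambda>x. (x, f x)) ` S = (S \<times> T) \<inter> R"
    using f uniq by auto
  then have "closedin (top_of_set (S \<times> T)) ((\<lambda>x. (x, f x)) ` S)"
    using assms(2) by (metis closedin_closed_Int)
  with continuous_closed_graph_eq[OF assms(1), of f S] f show ?thesis by blast
qed

lemma supporting_unit_normal:
  fixes K :: "'a::euclidean_space set"
  assumes "convex K" "closed K" "interior K \<noteq> {}" "x \<in> frontier K"
  obtains n where "norm n = 1" "\<And>y. y \<in> K \<Longrightarrow> n \<bullet> (y - x) \<ge> 0"
proof -
  have "x \<in> K" "x \<notin> rel_interior K"
    using assms by (auto simp: frontier_def rel_interior_nonempty_interior)
  from supporting_hyperplane_rel_boundary[OF assms(1) this] obtain a
    where a: "a \<noteq> 0" "\<And>y. y \<in> K \<Longrightarrow> a \<bullet> x \<le> a \<bullet> y" by metis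
  show thesis
  proof (rule that[of "a /\<^sub>R norm a"])
    show "(a /\<^sub>R norm a) \<bullet> (y - x) \<ge> 0" if "y \<in> K" for y
      using a(2)[OF that] by (simp add: inner_diff_right mult_left_mono)
  qed (use a(1) in simp)
qed

text \<open>
The inequality at \<open>x\<close> bounds the increment of \<open>f\<close> from below, the one at \<open>y\<close> from above, and the
two bounds differ by \<open>(g y - g x) \<bullet> (y - x)\<close>.
\<close>
lemma has_derivative_from_continuous_subgradient:
  fixes f :: "'a::euclidean_space \<Rightarrow> real"
  assumes g: "continuous_on W g"
    and sub: "\<And>x y. x \<in> W \<Longrightarrow> y \<in> W \<Longrightarrow> f y - f x \<ge> g x \<bullet> (y - x)"
    and x: "x \<in> W"
  shows "(f has_derivative (\<lambda>h. g x \<bullet> h)) (at x within W)"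
  unfolding has_derivative_within_alt
proof (intro conjI allI impI)
  show "bounded_linear ((\<bullet>) (g x))" by (rule bounded_linear_inner_right)
  fix e :: real assume "e > 0"
  then obtain d where "d > 0" and d: "\<And>y. y \<in> W \<Longrightarrow> dist y x < d \<Longrightarrow> dist (g y) (g x) < e"
    using g x unfolding continuous_on_iff by meson
  have "norm (f y - f x - g x \<bullet> (y - x)) \<le> e * norm (y - x)" if "y \<in> W" "norm (y - x) < d" for y
  proof -
    have "f y - f x - g x \<bullet> (y - x) \<le> (g y - g x) \<bullet> (y - x)"
      using sub[OF that(1) x] by (simp add: inner_diff)
    also have "\<dots> \<le> norm (g y - g x) * norm (y - x)"
      by (rule norm_cauchy_schwarz)
    also have "\<dots> \<le> e * norm (y - x)"
      using d[OF that(1)] that(2) by (intro mult_right_mono) (auto simp: dist_norm)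
    finally show ?thesis
      using sub[OF x that(1)] by simp
  qed
  with \<open>d > 0\<close> show "\<exists>d>0. \<forall>y\<in>W. norm (y - x) < d \<longrightarrow>
      norm (f y - f x - g x \<bullet> (y - x)) \<le> e * norm (y - x)" by blast
qed

text \<open>
In the direction \<open>u\<close> from \<open>z\<close> to an interior point, the boundary near \<open>z\<close> is the graph of a
function \<open>f\<close>. Normals at points near \<open>z\<close> are unique, hence continuous by compactness of the unit
sphere; divided by their component along \<open>u\<close> they are subgradients of \<open>f\<close>. The set \<open>Y\<close> has to
agree with the boundary of \<open>K\<close> only on \<open>V\<close>, because at infinity the projective closure is the
boundary of a convex set only locally.
\<close>
lemma C1_graph_near_convex_frontier:
  fixes K :: "'a::euclidean_space set"
  assumes K: "convex K" "closed K" "interior K \<noteq> {}"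
    and z: "z \<in> frontier K" and V: "open V" "z \<in> V"
    and Y: "Y \<inter> V = frontier K \<inter> V"
    and uniq: "\<And>x m n. x \<in> frontier K \<Longrightarrow> x \<in> V \<Longrightarrow> norm m = 1 \<Longrightarrow> norm n = 1 \<Longrightarrow>
      (\<And>y. y \<in> K \<Longrightarrow> m \<bullet> (y - x) \<ge> 0) \<Longrightarrow> (\<And>y. y \<in> K \<Longrightarrow> n \<bullet> (y - x) \<ge> 0) \<Longrightarrow> m = n"
  shows "C1_graph_near Y z"
proof -
  have fK: "frontier K \<subseteq> K" using K(2) frontier_subset_closed by blast
  obtain c where c: "c \<in> interior K" using K by blast
  have "c \<noteq> z" using c z by (auto simp: frontier_def)
  define h where "h = norm (c - z)"
  have "h > 0" using \<open>c \<noteq> z\<close> by (simp add: h_def)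
  define u where "u = (c - z) /\<^sub>R h"
  have u: "norm u = 1" "c = z + h *\<^sub>R u" using \<open>h > 0\<close> by (auto simp: u_def h_def)
  then have uu: "u \<bullet> u = 1" by (simp add: norm_eq_1)
  have up: "z + t *\<^sub>R u \<in> interior K" if "0 < t" "t \<le> h" for t
  proof -
    have "(1 - t / h) *\<^sub>R z + (t / h) *\<^sub>R c \<in> interior K"
      using that K z fK c by (intro interior_convex_combination) auto
    then show ?thesis using that by (simp add: u algebra_simps)
  qed
  have down: "z - t *\<^sub>R u \<notin> K" if "0 < t" for t
  proof
    assume "z - t *\<^sub>R u \<in> K"
    then have "(h / (h + t)) *\<^sub>R (z - t *\<^sub>R u) + (t / (h + t)) *\<^sub>R c \<in> interior K"
      using that K c \<open>h > 0\<close> by (intro interior_convex_combination) (auto simp: add_divide_distrib[symmetric])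
    also have "(h / (h + t)) *\<^sub>R (z - t *\<^sub>R u) + (t / (h + t)) *\<^sub>R c =
        (h / (h + t) + t / (h + t)) *\<^sub>R z"
      by (simp add: u(2) algebra_simps)
    also have "\<dots> = z" using that \<open>h > 0\<close> by (simp add: add_divide_distrib[symmetric])
    finally show False using z by (simp add: frontier_def)
  qed
  obtain \<rho>0 where \<rho>0: "\<rho>0 > 0" "ball z \<rho>0 \<subseteq> V" using V openE by blast
  define r where "r = min h (\<rho>0 / 2)"
  have r: "0 < r" "r \<le> h" "r \<le> \<rho>0 / 2" using \<open>h > 0\<close> \<rho>0 by (auto simp: r_def)
  obtain \<rho>1 where \<rho>1: "\<rho>1 > 0" "ball (z + r *\<^sub>R u) \<rho>1 \<subseteq> interior K"
    using up[OF r(1,2)] open_interior openE by blast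
  have "open (- K)" "z - r *\<^sub>R u \<in> - K" using K(2) down[OF r(1)] by auto
  then obtain \<rho>2 where \<rho>2: "\<rho>2 > 0" "ball (z - r *\<^sub>R u) \<rho>2 \<subseteq> - K"
    using openE by blast
  define \<rho> where "\<rho> = Min {\<rho>1, \<rho>2, \<rho>0 / 2}"
  have \<rho>: "0 < \<rho>" "\<rho> \<le> \<rho>1" "\<rho> \<le> \<rho>2" "\<rho> \<le> \<rho>0 / 2"
    using \<rho>0 \<rho>1 \<rho>2 by (auto simp: \<rho>_def)
  define \<pi> where "\<pi> x = x - (u \<bullet> x) *\<^sub>R u" for x
  define \<tau> where "\<tau> = u \<bullet> z"
  define y0 where "y0 = \<pi> z"
  have z_eq: "z = y0 + \<tau> *\<^sub>R u" by (simp add: y0_def \<pi>_def \<tau>_def)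
  have u\<pi>: "u \<bullet> \<pi> x = 0" for x by (simp add: \<pi>_def inner_diff_right uu)
  define W where "W = {y. u \<bullet> y = 0} \<inter> ball y0 \<rho>"
  \<comment> \<open>A cylinder inside \<open>V\<close> whose top lies in the interior of \<open>K\<close> and whose bottom lies outside \<open>K\<close>;
    every line in it parallel to \<open>u\<close> meets the boundary exactly once.\<close>
  define U where "U = {x. dist y0 (\<pi> x) < \<rho> \<and> \<tau> - r < u \<bullet> x \<and> u \<bullet> x < \<tau> + r}"
  have "open U"
    unfolding U_def \<pi>_def
    by (intro open_Collect_conj open_Collect_less continuous_intros)
  have "z \<in> U" using r \<rho> by (simp add: U_def y0_def \<tau>_def)
  have "U \<subseteq> V"
  proof
    fix x assume x: "x \<in> U"
    have "x - z = (\<pi> x - y0) + (u \<bullet> x - \<tau>) *\<^sub>R u"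
      by (simp add: z_eq \<pi>_def algebra_simps)
    then have "norm (x - z) \<le> norm (\<pi> x - y0) + \<bar>u \<bullet> x - \<tau>\<bar>"
      using norm_triangle_ineq[of "\<pi> x - y0" "(u \<bullet> x - \<tau>) *\<^sub>R u"] u(1) by simp
    also have "\<bar>u \<bullet> x - \<tau>\<bar> \<le> \<rho>0 / 2"
    proof -
      have "\<bar>u \<bullet> x - \<tau>\<bar> \<le> r" using x by (simp add: U_def abs_le_iff)
      with r(3) show ?thesis by simp
    qed
    also have "norm (\<pi> x - y0) + \<rho>0 / 2 < \<rho>0 / 2 + \<rho>0 / 2"
      using x \<rho>(4) by (auto simp: U_def dist_norm norm_minus_commute)
    finally show "x \<in> V" using \<rho>0 by (auto simp: dist_norm norm_minus_commute)
  qed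
  have top: "y + (\<tau> + r) *\<^sub>R u \<in> interior K" if "y \<in> W" for y
  proof -
    have "dist (z + r *\<^sub>R u) (y + (\<tau> + r) *\<^sub>R u) = dist y0 y"
      by (simp add: z_eq dist_norm algebra_simps)
    with that \<rho>(2) have "y + (\<tau> + r) *\<^sub>R u \<in> ball (z + r *\<^sub>R u) \<rho>1" by (auto simp: W_def)
    with \<rho>1(2) show ?thesis by blast
  qed
  have bot: "y + (\<tau> - r) *\<^sub>R u \<notin> K" if "y \<in> W" for y
  proof -
    have "dist (z - r *\<^sub>R u) (y + (\<tau> - r) *\<^sub>R u) = dist y0 y"
      by (simp add: z_eq dist_norm algebra_simps)
    with that \<rho>(3) have "y + (\<tau> - r) *\<^sub>R u \<in> ball (z - r *\<^sub>R u) \<rho>2" by (auto simp: W_def)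
    with \<rho>2(2) show ?thesis by blast
  qed
  have above: "y + t' *\<^sub>R u \<in> interior K"
    if y: "y \<in> W" and t: "y + t *\<^sub>R u \<in> K" "t < t'" "t' \<le> \<tau> + r" for y t t'
  proof -
    define \<mu> where "\<mu> = (t' - t) / (\<tau> + r - t)"
    have \<mu>: "0 < \<mu>" "\<mu> \<le> 1" using t by (auto simp: \<mu>_def)
    have "\<mu> * (\<tau> + r - t) = t' - t" using t by (simp add: \<mu>_def)
    then have t': "t' = (1 - \<mu>) * t + \<mu> * (\<tau> + r)" by (simp add: algebra_simps)
    have "(1 - \<mu>) *\<^sub>R (y + t *\<^sub>R u) + \<mu> *\<^sub>R (y + (\<tau> + r) *\<^sub>R u) \<in> interior K"
      using \<mu> t top[OF y] K by (intro interior_convex_combination) auto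
    also have "(1 - \<mu>) *\<^sub>R (y + t *\<^sub>R u) + \<mu> *\<^sub>R (y + (\<tau> + r) *\<^sub>R u) = y + t' *\<^sub>R u"
      unfolding t' by (simp add: algebra_simps)
    finally show ?thesis .
  qed
  have ex: "\<exists>t. \<tau> - r < t \<and> t < \<tau> + r \<and> y + t *\<^sub>R u \<in> frontier K" if y: "y \<in> W" for y
  proof -
    let ?I = "(\<lambda>t. y + t *\<^sub>R u) ` {\<tau> - r..\<tau> + r}"
    have "?I \<inter> frontier K \<noteq> {}"
    proof (rule connected_Int_frontier)
      show "connected ?I" by (intro connected_continuous_image continuous_intros) auto
      have "\<tau> + r \<in> {\<tau> - r..\<tau> + r}" "\<tau> - r \<in> {\<tau> - r..\<tau> + r}" using r by auto
      then show "?I \<inter> K \<noteq> {}" "?I - K \<noteq> {}"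
        using top[OF y] bot[OF y] interior_subset by blast+
    qed
    then obtain t where t: "\<tau> - r \<le> t" "t \<le> \<tau> + r" "y + t *\<^sub>R u \<in> frontier K" by auto
    moreover have "t \<noteq> \<tau> + r" using t(3) top[OF y] by (auto simp: frontier_def)
    moreover have "t \<noteq> \<tau> - r" using t(3) bot[OF y] fK by auto
    ultimately show ?thesis by (intro exI[of _ t]) auto
  qed
  have one: "t = t'" if y: "y \<in> W" and t: "y + t *\<^sub>R u \<in> frontier K" "y + t' *\<^sub>R u \<in> frontier K"
    "t \<le> \<tau> + r" "t' \<le> \<tau> + r" for y t t'
  proof (rule ccontr)
    assume "t \<noteq> t'"
    then have "y + t' *\<^sub>R u \<in> interior K \<or> y + t *\<^sub>R u \<in> interior K"
      using above[OF y, of t t'] above[OF y, of t' t] t fK by (cases t t' rule: linorder_cases) auto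
    with t show False by (auto simp: frontier_def)
  qed
  define f where "f y = (SOME t. \<tau> - r < t \<and> t < \<tau> + r \<and> y + t *\<^sub>R u \<in> frontier K)" for y
  have f: "\<tau> - r < f y" "f y < \<tau> + r" "y + f y *\<^sub>R u \<in> frontier K" if "y \<in> W" for y
    using someI_ex[OF ex[OF that]] by (auto simp: f_def)
  have f_eq: "f y = t" if "y \<in> W" "y + t *\<^sub>R u \<in> frontier K" "t \<le> \<tau> + r" for y t
    using one[OF that(1) f(3)[OF that(1)] that(2)] f(2)[OF that(1)] that(3) by simp
  have graph_U: "y + f y *\<^sub>R u \<in> U" if "y \<in> W" for y
  proof -
    have "u \<bullet> (y + f y *\<^sub>R u) = f y" using that by (simp add: W_def inner_add_right uu)
    moreover from this have "\<pi> (y + f y *\<^sub>R u) = y" by (simp add: \<pi>_def)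
    ultimately show ?thesis using that f[OF that] by (simp add: U_def W_def)
  qed

  have cont_f: "continuous_on W f"
  proof (rule continuous_on_from_closed_relation)
    show "compact {\<tau> - r..\<tau> + r}" by simp
    have "closed ((\<lambda>p. fst p + snd p *\<^sub>R u) -` frontier K)"
      by (intro closed_vimage continuous_intros) auto
    then show "closed {p. fst p + snd p *\<^sub>R u \<in> frontier K}"
      by (simp add: vimage_def)
  qed (use f f_eq in \<open>auto simp: less_imp_le\<close>)

  define \<nu> where "\<nu> x = (SOME n. norm n = 1 \<and> (\<forall>y\<in>K. n \<bullet> (y - x) \<ge> 0))" for x
  have \<nu>: "norm (\<nu> x) = 1" "\<And>y. y \<in> K \<Longrightarrow> \<nu> x \<bullet> (y - x) \<ge> 0" if "x \<in> frontier K" for x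
  proof -
    have "\<exists>n. norm n = 1 \<and> (\<forall>y\<in>K. n \<bullet> (y - x) \<ge> 0)"
      using supporting_unit_normal[OF K that] by metis
    from someI_ex[OF this] show "norm (\<nu> x) = 1" "\<And>y. y \<in> K \<Longrightarrow> \<nu> x \<bullet> (y - x) \<ge> 0"
      by (auto simp: \<nu>_def)
  qed
  have cont_\<nu>: "continuous_on (frontier K \<inter> V) \<nu>"
  proof (rule continuous_on_from_closed_relation)
    show "compact (sphere (0::'a) 1)" by simp
    have "closed (\<Inter>y\<in>K. {p. snd p \<bullet> (y - fst p) \<ge> 0})"
      by (intro closed_INT ballI closed_Collect_le continuous_intros)
    then show "closed {p. \<forall>y\<in>K. snd p \<bullet> (y - fst p) \<ge> 0}"
      by (simp add: INTER_eq)
    show "n = \<nu> x" if "x \<in> frontier K \<inter> V" "n \<in> sphere 0 1"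
      "(x, n) \<in> {p. \<forall>y\<in>K. snd p \<bullet> (y - fst p) \<ge> 0}" for x n
      using that \<nu> by (intro uniq[of x n "\<nu> x"]) auto
  qed (use \<nu> in auto)
  define N where "N y = \<nu> (y + f y *\<^sub>R u)" for y
  have cont_N: "continuous_on W N"
    unfolding N_def using f(3) graph_U \<open>U \<subseteq> V\<close>
    by (intro continuous_on_compose2[OF cont_\<nu>] continuous_intros cont_f) auto
  have N: "\<And>x. x \<in> K \<Longrightarrow> N y \<bullet> (x - (y + f y *\<^sub>R u)) \<ge> 0" "N y \<bullet> u > 0" if y: "y \<in> W" for y
  proof -
    show *: "N y \<bullet> (x - (y + f y *\<^sub>R u)) \<ge> 0" if "x \<in> K" for x
      using \<nu>(2)[OF f(3)[OF y] that] by (simp add: N_def)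
    have "N y \<noteq> 0" using \<nu>(1)[OF f(3)[OF y]] by (auto simp: N_def)
    have "0 < N y \<bullet> (y + (\<tau> + r) *\<^sub>R u - (y + f y *\<^sub>R u))"
      by (rule support_interior_pos[OF * \<open>N y \<noteq> 0\<close> top[OF y]])
    also have "y + (\<tau> + r) *\<^sub>R u - (y + f y *\<^sub>R u) = (\<tau> + r - f y) *\<^sub>R u"
      by (simp add: algebra_simps)
    finally show "N y \<bullet> u > 0"
      using f(2)[OF y] by (simp add: zero_less_mult_iff)
  qed
  define g where "g y = (- (1 / (N y \<bullet> u))) *\<^sub>R N y" for y
  have cont_g: "continuous_on W g"
    unfolding g_def using N(2) by (intro continuous_intros cont_N) force
  have sub: "f y' - f y \<ge> g y \<bullet> (y' - y)" if "y \<in> W" "y' \<in> W" for y y'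
  proof -
    have "0 \<le> N y \<bullet> (y' + f y' *\<^sub>R u - (y + f y *\<^sub>R u))"
      using N(1)[OF that(1)] f(3)[OF that(2)] fK by blast
    also have "y' + f y' *\<^sub>R u - (y + f y *\<^sub>R u) = (y' - y) + (f y' - f y) *\<^sub>R u"
      by (simp add: algebra_simps)
    finally have "- (N y \<bullet> (y' - y)) \<le> (f y' - f y) * (N y \<bullet> u)"
      by (simp only: inner_add_right inner_scaleR_right)
    then have "- (N y \<bullet> (y' - y)) / (N y \<bullet> u) \<le> f y' - f y"
      by (simp only: pos_divide_le_eq[OF N(2)[OF that(1)]])
    then show ?thesis by (simp add: g_def)
  qed
  have "C1_on W f"
    unfolding C1_on_def
    using cont_g has_derivative_from_continuous_subgradient[OF cont_g sub] by blast
  moreover have "openin (top_of_set {y. u \<bullet> y = 0}) W"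
    unfolding W_def by (simp add: openin_open_Int)
  moreover have "Y \<inter> U = (\<lambda>y. y + f y *\<^sub>R u) ` W"
  proof -
    have "Y \<inter> U = frontier K \<inter> U" using Y \<open>U \<subseteq> V\<close> by blast
    also have "\<dots> = (\<lambda>y. y + f y *\<^sub>R u) ` W"
    proof (intro equalityI subsetI)
      fix x assume x: "x \<in> frontier K \<inter> U"
      then have W: "\<pi> x \<in> W" by (auto simp: U_def W_def u\<pi>)
      have x_eq: "x = \<pi> x + (u \<bullet> x) *\<^sub>R u" by (simp add: \<pi>_def)
      then have "f (\<pi> x) = u \<bullet> x"
        using x by (intro f_eq[OF W]) (auto simp: U_def)
      then have "x = \<pi> x + f (\<pi> x) *\<^sub>R u" using x_eq by simp
      then show "x \<in> (\<lambda>y. y + f y *\<^sub>R u) ` W" using W by blast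
    qed (use f(3) graph_U in auto)
    finally show ?thesis .
  qed
  ultimately show ?thesis
    unfolding C1_graph_near_def using \<open>open U\<close> \<open>z \<in> U\<close> u(1) by blast
qed


section \<open>Points of the projective closure\<close>

lemma homog_surj:
  fixes q :: "'n::finite rp"
  obtains v where "v \<noteq> 0" "q = homog v"
proof -
  have "\<exists>v. v \<noteq> 0 \<and> q = homog v"
    by (induction q rule: rp.abs_induct) (auto simp: proportional_def)
  with that show thesis by blast
qed

lemma open_homog_preimage:
  fixes U :: "'n::finite rp set"
  shows "open U \<Longrightarrow> open {v. v \<noteq> 0 \<and> homog v \<in> U}"
  by (simp add: open_rp_def)

lemma open_homog_image:
  fixes S :: "((real^'n::finite) \<times> real) set"
  assumes "open S" "0 \<notin> S"
  shows "open (homog ` S)"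
proof -
  have "{v. v \<noteq> 0 \<and> homog v \<in> homog ` S} = (\<Union>c\<in>-{0}. (*\<^sub>R) c ` S)"
  proof (intro equalityI subsetI)
    fix v assume "v \<in> {v. v \<noteq> 0 \<and> homog v \<in> homog ` S}"
    then obtain w where w: "v \<noteq> 0" "w \<in> S" "homog v = homog w" by auto
    then have "w \<noteq> 0" using assms(2) by auto
    with w obtain c where c: "v = c *\<^sub>R w" using homog_eq_iff[of v w] by auto
    with w have "c \<noteq> 0" by auto
    with c w show "v \<in> (\<Union>c\<in>-{0}. (*\<^sub>R) c ` S)" by blast
  next
    fix v assume "v \<in> (\<Union>c\<in>-{0}. (*\<^sub>R) c ` S)"
    then obtain c w where w: "c \<noteq> 0" "w \<in> S" "v = c *\<^sub>R w" by auto
    then have "w \<noteq> 0" using assms(2) by auto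
    with w have "v \<noteq> 0" "homog v = homog w" using homog_eq_iff[of v w] by auto
    with w show "v \<in> {v. v \<noteq> 0 \<and> homog v \<in> homog ` S}" by blast
  qed
  moreover have "open (\<Union>c\<in>-{0}. (*\<^sub>R) c ` S)"
    using assms(1) by (intro open_UN ballI open_scaling) auto
  ultimately show ?thesis by (simp add: open_rp_def)
qed

text \<open>
Closures can be computed in homogeneous coordinates since \<open>homog\<close> is continuous and open.
\<close>
lemma homog_in_closure_iff:
  fixes A :: "'n::finite rp set"
  assumes "v \<noteq> 0"
  shows "homog v \<in> closure A \<longleftrightarrow> v \<in> closure {w. w \<noteq> 0 \<and> homog w \<in> A}" (is "_ \<longleftrightarrow> v \<in> closure ?S")
proof
  assume *: "homog v \<in> closure A"
  show "v \<in> closure ?S"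
  proof (rule ccontr)
    assume "v \<notin> closure ?S"
    define O' where "O' = - closure ?S \<inter> - {0}"
    have "open O'" "v \<in> O'" using \<open>v \<notin> closure ?S\<close> assms by (auto simp: O'_def intro!: open_Int)
    then have "open (homog ` O')" by (intro open_homog_image) (auto simp: O'_def)
    moreover have "homog ` O' \<inter> A = {}"
      using closure_subset[of ?S] by (auto simp: O'_def)
    ultimately have "homog ` O' \<inter> closure A = {}"
      by (simp add: open_Int_closure_eq_empty)
    with * \<open>v \<in> O'\<close> show False by blast
  qed
next
  assume *: "v \<in> closure ?S"
  show "homog v \<in> closure A"
  proof (rule ccontr)
    assume "homog v \<notin> closure A"
    define O' where "O' = {w. w \<noteq> 0 \<and> homog w \<in> - closure A}"
    have "open (- closure A)" by (rule open_Compl) (rule closed_closure)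
    then have "open O'" unfolding O'_def by (rule open_homog_preimage)
    moreover have "O' \<inter> ?S = {}" using closure_subset[of A] unfolding O'_def by blast
    ultimately have "O' \<inter> closure ?S = {}" by (simp add: open_Int_closure_eq_empty)
    moreover have "v \<in> O'" using \<open>homog v \<notin> closure A\<close> assms by (simp add: O'_def)
    ultimately show False using * by blast
  qed
qed

lemma homog_in_projective_closure_iff:
  fixes X :: "(real^'n::finite) set"
  assumes "v \<noteq> 0"
  shows "homog v \<in> projective_closure X \<longleftrightarrow> v \<in> closure {(r *\<^sub>R x, r) | r x. r \<noteq> 0 \<and> x \<in> X}"
proof -
  have nz: "(x, 1::real) \<noteq> 0" for x :: "real^'n" by (metis snd_conv snd_zero zero_neq_one)
  have "{w. w \<noteq> 0 \<and> homog w \<in> rp_embed ` X} = {(r *\<^sub>R x, r) | r x. r \<noteq> 0 \<and> x \<in> X}"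
  proof (intro equalityI subsetI)
    fix w assume "w \<in> {w. w \<noteq> 0 \<and> homog w \<in> rp_embed ` X}"
    then obtain x where x: "w \<noteq> 0" "x \<in> X" "homog w = rp_embed x" by blast
    then have "homog w = homog (x, 1)" by (simp only: rp_embed_def)
    then obtain c where c: "w = c *\<^sub>R (x, 1)" using homog_eq_iff[OF x(1) nz] by blast
    have "c \<noteq> 0" using x(1) c scaleR_zero_left[of "(x, 1::real)"] by metis
    moreover have "w = (c *\<^sub>R x, c)" using c by simp
    ultimately show "w \<in> {(r *\<^sub>R x, r) | r x. r \<noteq> 0 \<and> x \<in> X}" using x(2) by blast
  next
    fix w assume "w \<in> {(r *\<^sub>R x, r) | r x. r \<noteq> 0 \<and> x \<in> X}"
    then obtain r x where "r \<noteq> 0" "x \<in> X" "w = (r *\<^sub>R x, r)" by blast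
    then have x: "r \<noteq> 0" "x \<in> X" "w = r *\<^sub>R (x, 1)" by simp_all
    then have "w \<noteq> 0" using nz[of x] by (simp only: scaleR_eq_0_iff not_False_eq_True simp_thms)
    moreover have "homog w = homog (x, 1)" using homog_eq_iff[OF \<open>w \<noteq> 0\<close> nz] x by blast
    ultimately show "w \<in> {w. w \<noteq> 0 \<and> homog w \<in> rp_embed ` X}"
      using x(2) \<open>w \<noteq> 0\<close> rp_embed_def[of x] by (metis (mono_tags, lifting) image_eqI mem_Collect_eq)
  qed
  with homog_in_closure_iff[OF assms, of "rp_embed ` X"] show ?thesis
    by (simp add: projective_closure_def)
qed

lemma projective_closure_finite_point:
  fixes X :: "(real^'n::finite) set"
  assumes "closed X" "t \<noteq> 0"
  shows "homog (y, t) \<in> projective_closure X \<longleftrightarrow> y /\<^sub>R t \<in> X"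
proof -
  have nz: "(y, t) \<noteq> 0" using assms(2) by (metis snd_conv snd_zero)
  let ?C = "{(r *\<^sub>R x, r) | r x. r \<noteq> 0 \<and> x \<in> X}"
  have "(y, t) \<in> closure ?C \<longleftrightarrow> y /\<^sub>R t \<in> X"
  proof
    assume "(y, t) \<in> closure ?C"
    then obtain f where f: "\<And>m. f m \<in> ?C" "f \<longlonglongrightarrow> (y, t)"
      by (auto simp: closure_sequential)
    have "(\<lambda>m. inverse (snd (f m)) *\<^sub>R fst (f m)) \<longlonglongrightarrow> inverse (snd (y, t)) *\<^sub>R fst (y, t)"
      using f(2) assms(2) by (intro tendsto_intros) auto
    moreover have "inverse (snd (f m)) *\<^sub>R fst (f m) \<in> X" for m
      using f(1)[of m] by auto
    ultimately show "y /\<^sub>R t \<in> X"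
      using closed_sequentially[OF assms(1), of "\<lambda>m. inverse (snd (f m)) *\<^sub>R fst (f m)"] by simp
  next
    assume "y /\<^sub>R t \<in> X"
    moreover have "(y, t) = (t *\<^sub>R (y /\<^sub>R t), t)" using assms(2) by simp
    ultimately have "(y, t) \<in> ?C" using assms(2) by blast
    then show "(y, t) \<in> closure ?C" by (rule subsetD[OF closure_subset])
  qed
  with homog_in_projective_closure_iff[OF nz, of X] show ?thesis by simp
qed

text \<open>
A point \<open>(y, 0)\<close> is a limit of points \<open>(r x, r)\<close> with \<open>x \<in> X\<close> and \<open>r\<close> tending to \<open>0\<close>. If infinitely
many of these \<open>r\<close> are positive then \<open>y\<close> is a recession direction, otherwise \<open>- y\<close> is one.
\<close>
lemma projective_closure_infinite_point:
  fixes K :: "(real^'n::finite) set"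
  assumes K: "convex K" "closed K" and "X \<subseteq> K" and "y \<noteq> 0"
    and "homog (y, 0) \<in> projective_closure X"
  shows "y \<in> recession_cone K \<or> - y \<in> recession_cone K"
proof -
  have nz: "(y, 0::real) \<noteq> 0" using \<open>y \<noteq> 0\<close> by (metis fst_conv fst_zero)
  define C where "C \<sigma> = {(r *\<^sub>R x, r) | r x. \<sigma> * r > 0 \<and> x \<in> X}" for \<sigma> :: real
  have "{(r *\<^sub>R x, r) | r x. r \<noteq> 0 \<and> x \<in> X} = C 1 \<union> C (-1)"
    by (fastforce simp: C_def)
  then have "(y, 0) \<in> closure (C 1 \<union> C (-1))"
    using homog_in_projective_closure_iff[OF nz, of X] assms(5) by simp
  then have "(y, 0) \<in> closure (C 1) \<union> closure (C (-1))"
    by (simp only: closure_Un)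
  moreover have "\<sigma> *\<^sub>R y \<in> recession_cone K" if "(y, 0) \<in> closure (C \<sigma>)" for \<sigma>
  proof -
    obtain f where f: "\<And>m. f m \<in> C \<sigma>" "f \<longlonglongrightarrow> (y, 0)"
      using \<open>(y, 0) \<in> closure (C \<sigma>)\<close> by (auto simp: closure_sequential)
    have "\<exists>x. x \<in> X \<and> \<sigma> * snd (f m) > 0 \<and> fst (f m) = snd (f m) *\<^sub>R x" for m
    proof -
      obtain r x where "f m = (r *\<^sub>R x, r)" "\<sigma> * r > 0" "x \<in> X"
        using f(1)[of m] unfolding C_def by blast
      then show ?thesis by auto
    qed
    then obtain x where x: "\<And>m. x m \<in> X" "\<And>m. \<sigma> * snd (f m) > 0"
      "\<And>m. fst (f m) = snd (f m) *\<^sub>R x m" by metis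
    show ?thesis
    proof (rule recession_cone_limit[OF K])
      show "x m \<in> K" for m using x(1) \<open>X \<subseteq> K\<close> by blast
      show "\<sigma> * snd (f m) > 0" for m by (rule x(2))
      have "(\<lambda>m. \<sigma> * snd (f m)) \<longlonglongrightarrow> \<sigma> * snd (y, 0::real)"
        using f(2) by (intro tendsto_intros)
      then show "(\<lambda>m. \<sigma> * snd (f m)) \<longlonglongrightarrow> 0" by simp
      have "(\<lambda>m. \<sigma> *\<^sub>R fst (f m)) \<longlonglongrightarrow> \<sigma> *\<^sub>R fst (y, 0::real)"
        using f(2) by (intro tendsto_intros)
      then show "(\<lambda>m. (\<sigma> * snd (f m)) *\<^sub>R x m) \<longlonglongrightarrow> \<sigma> *\<^sub>R y"
        by (simp add: x(3))
    qed
  qed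
  ultimately show ?thesis by force
qed


section \<open>Convex sets in the charts at infinity\<close>

text \<open>
The first \<open>n\<close> homogeneous coordinates of the point with local coordinates \<open>z\<close> in the \<open>k\<close>-th chart;
the last one is \<open>z $ k\<close>.
\<close>
definition chart_lift :: "'n::finite \<Rightarrow> real^'n \<Rightarrow> real^'n" where
  "chart_lift k z = z + (1 - z $ k) *\<^sub>R axis k 1"

text \<open>
The change of coordinates between the \<open>k\<close>-th chart and the affine chart. It is the same map in
both directions.
\<close>
definition perspective :: "'n::finite \<Rightarrow> real^'n \<Rightarrow> real^'n" where
  "perspective k z = chart_lift k z /\<^sub>R (z $ k)"

text \<open>
In the chart the hyperplane at infinity \<open>z $ k = 0\<close> separates the points with positive \<open>k\<close>-th
affine coordinate from those with negative one. The sign \<open>\<sigma>\<close> selects one of the two sides, on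
each of which \<open>perspective\<close> preserves convexity.
\<close>
definition perspective_image :: "'n::finite \<Rightarrow> real \<Rightarrow> (real^'n) set \<Rightarrow> (real^'n) set" where
  "perspective_image k \<sigma> K = {z. \<sigma> * z $ k > 0 \<and> perspective k z \<in> K}"

lemma chart_lift_nth: "chart_lift k z $ j = (if j = k then 1 else z $ j)"
  by (simp add: chart_lift_def axis_def)

lemma rp_param_Some_chart_lift: "rp_param (Some k) z = homog (chart_lift k z, z $ k)"
proof -
  have "(\<chi> j. if j = k then 1 else z $ j) = chart_lift k z"
    by (simp add: vec_eq_iff chart_lift_nth)
  then show ?thesis by simp
qed

lemma perspective_nth: "perspective k z $ j = (if j = k then 1 / z $ k else z $ j / z $ k)"
  by (simp add: perspective_def chart_lift_nth divide_inverse)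

lemma perspective_involution:
  assumes "z $ k \<noteq> 0"
  shows "perspective k (perspective k z) = z"
  using assms by (simp add: vec_eq_iff perspective_nth)

lemma scaleR_perspective:
  assumes "z $ k \<noteq> 0"
  shows "z $ k *\<^sub>R perspective k z = chart_lift k z"
  using assms by (simp add: perspective_def)

lemma perspective_sign:
  assumes "\<sigma> * z $ k > 0"
  shows "\<sigma> * perspective k z $ k > 0"
  using assms by (simp add: perspective_nth zero_less_mult_iff zero_less_divide_iff)

lemma continuous_on_chart_lift: "continuous_on S (chart_lift k)"
  unfolding chart_lift_def by (intro continuous_intros)

lemma continuous_on_perspective: "continuous_on {z. \<sigma> * z $ k > 0} (perspective k)"
  unfolding perspective_def
  by (intro continuous_intros continuous_on_chart_lift) auto

lemma open_coordinate_halfspace: "open {z::real^'n::finite. \<sigma> * z $ k > 0}"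
  by (intro open_Collect_less continuous_intros)

text \<open>
A projective map sends segments that do not meet the hyperplane at infinity to segments, with
the weights multiplied by the last homogeneous coordinates of the end points.
\<close>
lemma convex_perspective_image:
  fixes K :: "(real^'n::finite) set"
  assumes "convex K"
  shows "convex (perspective_image k \<sigma> K)"
proof (rule convexI)
  fix z w :: "real^'n" and a b :: real
  assume z: "z \<in> perspective_image k \<sigma> K" and w: "w \<in> perspective_image k \<sigma> K"
    and ab: "0 \<le> a" "0 \<le> b" "a + b = 1"
  define y where "y = a *\<^sub>R z + b *\<^sub>R w"
  have yk: "y $ k = a * z $ k + b * w $ k" by (simp add: y_def)
  have zw: "\<sigma> * z $ k > 0" "\<sigma> * w $ k > 0"
    using z w by (auto simp: perspective_image_def)
  have sy: "\<sigma> * y $ k = a * (\<sigma> * z $ k) + b * (\<sigma> * w $ k)"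
    by (simp add: yk algebra_simps)
  have "\<sigma> * y $ k > 0"
  proof (cases "a = 0")
    case False
    with ab zw have "a * (\<sigma> * z $ k) > 0" "b * (\<sigma> * w $ k) \<ge> 0"
      by (auto intro: mult_nonneg_nonneg mult_pos_pos less_imp_le)
    then show ?thesis unfolding sy by linarith
  next
    case True
    with ab zw show ?thesis unfolding sy by simp
  qed
  then have nz: "y $ k \<noteq> 0" "z $ k \<noteq> 0" "w $ k \<noteq> 0" using zw by auto
  have "chart_lift k y = a *\<^sub>R chart_lift k z + b *\<^sub>R chart_lift k w"
  proof -
    have b: "b = 1 - a" using ab by simp
    show ?thesis unfolding y_def chart_lift_def b by (simp add: algebra_simps)
  qed
  also have "\<dots> = (a * z $ k) *\<^sub>R perspective k z + (b * w $ k) *\<^sub>R perspective k w"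
    using scaleR_perspective[OF nz(2)] scaleR_perspective[OF nz(3)]
    by (metis scaleR_scaleR)
  finally have "perspective k y = (1 / y $ k) *\<^sub>R
      ((a * z $ k) *\<^sub>R perspective k z + (b * w $ k) *\<^sub>R perspective k w)"
    by (simp only: perspective_def inverse_eq_divide)
  also have "\<dots> = (a * z $ k / y $ k) *\<^sub>R perspective k z + (b * w $ k / y $ k) *\<^sub>R perspective k w"
    by (simp add: scaleR_add_right)
  also have "\<dots> \<in> K"
  proof (rule convexD[OF assms])
    show "perspective k z \<in> K" "perspective k w \<in> K"
      using z w by (auto simp: perspective_image_def)
    have "a * z $ k / y $ k = a * (\<sigma> * z $ k) / (\<sigma> * y $ k)"
      "b * w $ k / y $ k = b * (\<sigma> * w $ k) / (\<sigma> * y $ k)"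
      using zw by auto
    then show "0 \<le> a * z $ k / y $ k" "0 \<le> b * w $ k / y $ k"
      using ab zw \<open>\<sigma> * y $ k > 0\<close> by (metis divide_nonneg_pos less_imp_le mult_nonneg_nonneg)+
    show "a * z $ k / y $ k + b * w $ k / y $ k = 1"
      using nz yk by (metis add_divide_distrib divide_self)
  qed
  finally show "a *\<^sub>R z + b *\<^sub>R w \<in> perspective_image k \<sigma> K"
    using \<open>\<sigma> * y $ k > 0\<close> by (simp add: perspective_image_def y_def)
qed

lemma interior_perspective_image:
  fixes K :: "(real^'n::finite) set"
  shows "z \<in> interior (perspective_image k \<sigma> K) \<longleftrightarrow> \<sigma> * z $ k > 0 \<and> perspective k z \<in> interior K"
proof -
  define H where "H = {z::real^'n. \<sigma> * z $ k > 0}"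
  have "open H" unfolding H_def by (rule open_coordinate_halfspace)
  have cont: "continuous_on H (perspective k)" unfolding H_def by (rule continuous_on_perspective)
  have inv: "perspective k (perspective k x) = x" "perspective k x \<in> H" if "x \<in> H" for x
  proof -
    have "x $ k \<noteq> 0" using that by (auto simp: H_def)
    then show "perspective k (perspective k x) = x" by (rule perspective_involution)
    show "perspective k x \<in> H" using that perspective_sign[of \<sigma> x k] by (simp add: H_def)
  qed
  have pre: "open (H \<inter> perspective k -` S)" if "open S" for S
    using continuous_open_preimage[OF cont \<open>open H\<close> that] .
  have im: "perspective_image k \<sigma> K = H \<inter> perspective k -` K"
    by (auto simp: perspective_image_def H_def)
  show ?thesis
  proof
    assume z: "z \<in> interior (perspective_image k \<sigma> K)"
    then have zH: "z \<in> H" using interior_subset im by blast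
    define S where "S = H \<inter> perspective k -` interior (perspective_image k \<sigma> K)"
    have "open S" unfolding S_def by (rule pre) simp
    moreover have "S \<subseteq> K"
    proof
      fix x assume "x \<in> S"
      then have "x \<in> H" "perspective k x \<in> perspective_image k \<sigma> K"
        unfolding S_def using interior_subset by blast+
      then show "x \<in> K" using inv(1)[of x] by (simp add: im)
    qed
    moreover have "perspective k z \<in> S"
      using inv[OF zH] z by (simp add: S_def)
    ultimately have "perspective k z \<in> interior K" by (metis interiorI)
    with zH show "\<sigma> * z $ k > 0 \<and> perspective k z \<in> interior K" by (simp add: H_def)
  next
    assume z: "\<sigma> * z $ k > 0 \<and> perspective k z \<in> interior K"
    have "open (H \<inter> perspective k -` interior K)" by (rule pre) simp
    moreover have "z \<in> H \<inter> perspective k -` interior K" using z by (simp add: H_def)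
    moreover have "H \<inter> perspective k -` interior K \<subseteq> perspective_image k \<sigma> K"
      using interior_subset by (auto simp: im)
    ultimately show "z \<in> interior (perspective_image k \<sigma> K)" by (rule interiorI)
  qed
qed

lemma closure_perspective_image:
  assumes "closed K" "\<sigma> * z $ k > 0"
  shows "z \<in> closure (perspective_image k \<sigma> K) \<longleftrightarrow> perspective k z \<in> K"
proof
  assume "z \<in> closure (perspective_image k \<sigma> K)"
  then obtain f where f: "\<And>m. f m \<in> perspective_image k \<sigma> K" "f \<longlonglongrightarrow> z"
    by (auto simp: closure_sequential)
  have "continuous_on {z. \<sigma> * z $ k > 0} (perspective k)" by (rule continuous_on_perspective)
  then have "(\<lambda>m. perspective k (f m)) \<longlonglongrightarrow> perspective k z"
    using f(1) assms(2) by (intro continuous_on_tendsto_compose[OF _ f(2)]) (auto simp: perspective_image_def)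
  moreover have "\<And>m. perspective k (f m) \<in> K" using f(1) by (auto simp: perspective_image_def)
  ultimately show "perspective k z \<in> K"
    using closed_sequentially[OF assms(1), of "\<lambda>m. perspective k (f m)"] by simp
next
  assume "perspective k z \<in> K"
  then show "z \<in> closure (perspective_image k \<sigma> K)"
    using assms(2) by (intro subsetD[OF closure_subset]) (simp add: perspective_image_def)
qed

lemma closure_perspective_image_halfspace:
  fixes K :: "(real^'n::finite) set"
  assumes "z \<in> closure (perspective_image k \<sigma> K)"
  shows "\<sigma> * z $ k \<ge> 0"
proof -
  have "closed {z::real^'n. 0 \<le> \<sigma> * z $ k}"
    by (intro closed_Collect_le continuous_intros)
  moreover have "perspective_image k \<sigma> K \<subseteq> {z. 0 \<le> \<sigma> * z $ k}"
    by (auto simp: perspective_image_def)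
  ultimately show ?thesis
    using closure_minimal assms by blast
qed

text \<open>
The affine points \<open>perspective k (f m)\<close> that approximate \<open>z\<close> run to infinity, and \<open>f m $ k\<close> is the
factor by which they have to be rescaled.
\<close>
lemma closure_perspective_image_at_infinity:
  assumes K: "convex K" "closed K"
    and z: "z \<in> closure (perspective_image k \<sigma> K)" "z $ k = 0"
  shows "\<sigma> *\<^sub>R chart_lift k z \<in> recession_cone K"
proof -
  obtain f where f: "\<And>m. f m \<in> perspective_image k \<sigma> K" "f \<longlonglongrightarrow> z"
    using z(1) by (auto simp: closure_sequential)
  have pos: "\<sigma> * f m $ k > 0" "perspective k (f m) \<in> K" for m
    using f(1)[of m] by (auto simp: perspective_image_def)
  show ?thesis
  proof (rule recession_cone_limit[OF K pos(2) pos(1)])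
    have "(\<lambda>m. \<sigma> * f m $ k) \<longlonglongrightarrow> \<sigma> * z $ k"
      using f(2) by (intro tendsto_intros)
    then show "(\<lambda>m. \<sigma> * f m $ k) \<longlonglongrightarrow> 0" using z(2) by simp
    have "isCont (chart_lift k) z"
      using continuous_on_chart_lift[of UNIV k] by (simp add: continuous_on_eq_continuous_at)
    then have "(\<lambda>m. \<sigma> *\<^sub>R chart_lift k (f m)) \<longlonglongrightarrow> \<sigma> *\<^sub>R chart_lift k z"
      using f(2) by (intro tendsto_intros) (rule isCont_tendsto_compose)
    moreover have "\<sigma> *\<^sub>R chart_lift k (f m) = (\<sigma> * f m $ k) *\<^sub>R perspective k (f m)" for m
      using scaleR_perspective[of "f m" k] pos(1)[of m] by (metis mult_zero_right order_less_irrefl scaleR_scaleR)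
    ultimately show "(\<lambda>m. (\<sigma> * f m $ k) *\<^sub>R perspective k (f m)) \<longlonglongrightarrow> \<sigma> *\<^sub>R chart_lift k z"
      by simp
  qed
qed

text \<open>
Multiplied by \<open>x $ k\<close>, an affine functional of the chart becomes an affine functional of the
affine coordinates \<open>x\<close>. This translates supporting hyperplanes from one chart to the other.
\<close>
lemma perspective_functional:
  fixes m z x :: "real^'n::finite"
  assumes "x $ k \<noteq> 0"
  shows "x $ k * (m \<bullet> (perspective k x - z)) = (m - (m $ k + m \<bullet> z) *\<^sub>R axis k 1) \<bullet> x + m $ k"
proof -
  have "x $ k * (m \<bullet> (perspective k x - z)) = m \<bullet> (x $ k *\<^sub>R perspective k x) - x $ k * (m \<bullet> z)"
    by (simp add: inner_diff_right right_diff_distrib)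
  also have "\<dots> = m \<bullet> x + (1 - x $ k) * m $ k - x $ k * (m \<bullet> z)"
    unfolding scaleR_perspective[OF assms] chart_lift_def by (simp add: inner_add_right inner_axis)
  also have "\<dots> = (m - (m $ k + m \<bullet> z) *\<^sub>R axis k 1) \<bullet> x + m $ k"
    by (simp add: inner_diff_left inner_axis' algebra_simps)
  finally show ?thesis .
qed

lemma perspective_image_support:
  fixes m z x :: "real^'n::finite"
  assumes "\<And>y. y \<in> perspective_image k \<sigma> K \<Longrightarrow> m \<bullet> (y - z) \<ge> 0"
    and "x \<in> K" "\<sigma> * x $ k > 0"
  shows "\<sigma> * ((m - (m $ k + m \<bullet> z) *\<^sub>R axis k 1) \<bullet> x + m $ k) \<ge> 0"
proof -
  have "x $ k \<noteq> 0" using assms(3) by auto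
  have "perspective k x \<in> perspective_image k \<sigma> K"
    using assms(2,3) perspective_sign[OF assms(3)] perspective_involution[OF \<open>x $ k \<noteq> 0\<close>]
    by (simp add: perspective_image_def)
  then have "(\<sigma> * x $ k) * (m \<bullet> (perspective k x - z)) \<ge> 0"
    by (rule mult_nonneg_nonneg[OF less_imp_le[OF assms(3)] assms(1)])
  then show ?thesis
    using perspective_functional[OF \<open>x $ k \<noteq> 0\<close>, of m z] by (simp add: mult.assoc)
qed

text \<open>
A normal \<open>m\<close> at the point at infinity becomes an affine functional with linear part \<open>M\<close> that has
constant sign on the part of \<open>K\<close> near infinity. It is invariant under \<open>u\<close>, and every line parallel
to \<open>u\<close> reaches that part of \<open>K\<close>, so it has constant sign on the whole space and \<open>M = 0\<close>. What is
left is the functional defining the hyperplane at infinity.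
\<close>
lemma unique_normal_at_infinity:
  fixes m u :: "real^'n::finite"
  assumes lines: "\<And>b. \<exists>\<tau>. b + \<tau> *\<^sub>R u \<in> K \<and> \<sigma> * (b + \<tau> *\<^sub>R u) $ k > 0"
    and uk: "u $ k \<noteq> 0" and \<sigma>: "\<sigma> * \<sigma> = 1"
    and z: "z = (1 / u $ k) *\<^sub>R u - axis k 1"
    and m: "norm m = 1" "\<And>y. y \<in> perspective_image k \<sigma> K \<Longrightarrow> m \<bullet> (y - z) \<ge> 0"
  shows "m = \<sigma> *\<^sub>R axis k 1"
proof -
  define M where "M = m - (m $ k + m \<bullet> z) *\<^sub>R axis k 1"
  have mz: "m \<bullet> z = (m \<bullet> u) / u $ k - m $ k"
    by (simp add: z inner_diff_right inner_axis)
  then have "M \<bullet> u = 0"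
    using uk by (simp add: M_def inner_diff_left inner_axis')
  have ge: "\<sigma> * (M \<bullet> b + m $ k) \<ge> 0" for b
  proof -
    obtain \<tau> where "b + \<tau> *\<^sub>R u \<in> K" "\<sigma> * (b + \<tau> *\<^sub>R u) $ k > 0" using lines by blast
    from perspective_image_support[OF m(2) this] \<open>M \<bullet> u = 0\<close> show ?thesis
      by (simp add: M_def[symmetric] inner_add_right)
  qed
  have "M = 0"
  proof (rule ccontr)
    assume "M \<noteq> 0"
    then have MM: "M \<bullet> M > 0" by simp
    \<comment> \<open>A point so far in the direction of \<open>- \<sigma> M\<close> that the linear part outweighs the constant.\<close>
    define b where "b = (- \<sigma> * (\<bar>\<sigma> * m $ k\<bar> + 1) / (M \<bullet> M)) *\<^sub>R M"
    have "M \<bullet> b = - \<sigma> * (\<bar>\<sigma> * m $ k\<bar> + 1)" using MM by (simp add: b_def)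
    moreover have "\<sigma> * (- \<sigma> * x + y) = - (\<sigma> * \<sigma>) * x + \<sigma> * y" for x y
      by (simp add: algebra_simps)
    ultimately have "\<sigma> * (M \<bullet> b + m $ k) = - (\<sigma> * \<sigma>) * (\<bar>\<sigma> * m $ k\<bar> + 1) + \<sigma> * m $ k"
      by metis
    then have "\<sigma> * (M \<bullet> b + m $ k) = - (\<bar>\<sigma> * m $ k\<bar> + 1) + \<sigma> * m $ k"
      unfolding \<sigma> by simp
    with ge[of b] show False by linarith
  qed
  then have m_eq: "m = (m $ k + m \<bullet> z) *\<^sub>R axis k 1" by (simp add: M_def)
  have "m $ k = m $ k + m \<bullet> z" by (subst m_eq) (simp add: axis_def)
  with m_eq have m_ax: "m = m $ k *\<^sub>R axis k 1" by simp
  then have "\<bar>m $ k\<bar> = 1" using m(1) by (metis norm_axis_1 norm_scaleR mult.right_neutral)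
  moreover have "\<sigma> * m $ k \<ge> 0" using ge[of 0] by simp
  moreover have "\<sigma> = 1 \<or> \<sigma> = -1" using \<sigma> by (simp add: square_eq_1_iff)
  ultimately have "m $ k = \<sigma>" by auto
  with m_ax show ?thesis by simp
qed

text \<open>
A supporting hyperplane of the image at \<open>z\<close> becomes a supporting hyperplane of \<open>K\<close> at the affine
point \<open>x\<close>. Its normal \<open>M m\<close> determines \<open>m\<close>, because the functional vanishes at \<open>x\<close>.
\<close>
lemma unique_normal_perspective_image:
  fixes m n z :: "real^'n::finite"
  assumes K: "convex K" "closed K"
    and z: "\<sigma> * z $ k > 0" "perspective k z \<in> K"
    and uniq: "\<And>m n. norm m = 1 \<Longrightarrow> norm n = 1 \<Longrightarrow>
      (\<And>y. y \<in> K \<Longrightarrow> m \<bullet> (y - perspective k z) \<ge> 0) \<Longrightarrow>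
      (\<And>y. y \<in> K \<Longrightarrow> n \<bullet> (y - perspective k z) \<ge> 0) \<Longrightarrow> m = n"
    and m: "norm m = 1" "\<And>y. y \<in> perspective_image k \<sigma> K \<Longrightarrow> m \<bullet> (y - z) \<ge> 0"
    and n: "norm n = 1" "\<And>y. y \<in> perspective_image k \<sigma> K \<Longrightarrow> n \<bullet> (y - z) \<ge> 0"
  shows "m = n"
proof -
  define x where "x = perspective k z"
  have zk: "z $ k \<noteq> 0" using z(1) by auto
  have sx: "\<sigma> * x $ k > 0" unfolding x_def by (rule perspective_sign[OF z(1)])
  then have xk: "x $ k \<noteq> 0" by auto
  have px: "perspective k x = z" unfolding x_def by (rule perspective_involution[OF zk])
  \<comment> \<open>The linear part of the translated functional; \<open>\<sigma> M m\<close> is a normal of \<open>K\<close> at \<open>x\<close>.\<close>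
  define M where "M m = m - (m $ k + m \<bullet> z) *\<^sub>R axis k 1" for m :: "real^'n"
  have Mx: "m $ k = - (M m \<bullet> x)" for m
    using perspective_functional[OF xk, of m z] by (simp add: px M_def)
  have Mk: "m \<bullet> z = - (M m $ k)" for m by (simp add: M_def axis_def)
  have recover: "m = M m + (- (M m \<bullet> x) - M m $ k) *\<^sub>R axis k 1" for m
  proof -
    have "m = M m + (m $ k + m \<bullet> z) *\<^sub>R axis k 1" by (simp add: M_def)
    also have "m $ k + m \<bullet> z = - (M m \<bullet> x) - M m $ k"
      using Mx[of m] Mk[of m] by linarith
    finally show ?thesis .
  qed
  have M_nz: "M m \<noteq> 0" if "norm m = 1" for m
  proof
    assume "M m = 0"
    with recover[of m] have "m = 0" by simp
    with that show False by simp
  qed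
  have M_supp: "(\<sigma> *\<^sub>R M m) \<bullet> (y - x) \<ge> 0"
    if m: "\<And>y. y \<in> perspective_image k \<sigma> K \<Longrightarrow> m \<bullet> (y - z) \<ge> 0" and y: "y \<in> K" for m y
  proof -
    have "open ((\<lambda>s. x + s *\<^sub>R (y - x)) -` {z. \<sigma> * z $ k > 0})"
      by (intro open_vimage open_coordinate_halfspace continuous_intros)
    moreover have "0 \<in> (\<lambda>s. x + s *\<^sub>R (y - x)) -` {z. \<sigma> * z $ k > 0}" using sx by simp
    ultimately obtain d where d: "d > 0" "ball 0 d \<subseteq> (\<lambda>s. x + s *\<^sub>R (y - x)) -` {z. \<sigma> * z $ k > 0}"
      by (meson openE)
    define s where "s = min (d / 2) 1"
    have s: "0 < s" "s \<le> 1" "s \<in> ball 0 d" using d(1) by (auto simp: s_def)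
    have "\<sigma> * (x + s *\<^sub>R (y - x)) $ k > 0" using s(3) d(2) by blast
    moreover have "x + s *\<^sub>R (y - x) \<in> K"
    proof -
      have "(1 - s) *\<^sub>R x + s *\<^sub>R y \<in> K"
        using z(2) y s K by (intro convexD) (auto simp: x_def)
      then show ?thesis by (simp add: algebra_simps)
    qed
    ultimately have "\<sigma> * (M m \<bullet> (x + s *\<^sub>R (y - x)) + m $ k) \<ge> 0"
      using perspective_image_support[OF m] by (simp only: M_def)
    then have "s * ((\<sigma> *\<^sub>R M m) \<bullet> (y - x)) \<ge> 0"
      unfolding Mx[of m] by (simp add: inner_add_right mult.left_commute)
    then show ?thesis using s(1) by (simp add: zero_le_mult_iff)
  qed
  have "\<sigma> \<noteq> 0" using z(1) by auto
  define c where "c = norm (M m) / norm (M n)"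
  have c: "c > 0" using M_nz m(1) n(1) by (simp add: c_def)
  have "(1 / norm (\<sigma> *\<^sub>R M m)) *\<^sub>R (\<sigma> *\<^sub>R M m) = (1 / norm (\<sigma> *\<^sub>R M n)) *\<^sub>R (\<sigma> *\<^sub>R M n)"
  proof (rule uniq)
    show "norm ((1 / norm (\<sigma> *\<^sub>R M m)) *\<^sub>R (\<sigma> *\<^sub>R M m)) = 1"
      "norm ((1 / norm (\<sigma> *\<^sub>R M n)) *\<^sub>R (\<sigma> *\<^sub>R M n)) = 1"
      using M_nz m(1) n(1) \<open>\<sigma> \<noteq> 0\<close> by auto
    show "0 \<le> (1 / norm (\<sigma> *\<^sub>R M m)) *\<^sub>R (\<sigma> *\<^sub>R M m) \<bullet> (y - perspective k z)" if "y \<in> K" for y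
      unfolding inner_scaleR_left[of "1 / norm (\<sigma> *\<^sub>R M m)"]
      using M_supp[OF m(2) that] by (intro mult_nonneg_nonneg) (simp_all add: x_def)
    show "0 \<le> (1 / norm (\<sigma> *\<^sub>R M n)) *\<^sub>R (\<sigma> *\<^sub>R M n) \<bullet> (y - perspective k z)" if "y \<in> K" for y
      unfolding inner_scaleR_left[of "1 / norm (\<sigma> *\<^sub>R M n)"]
      using M_supp[OF n(2) that] by (intro mult_nonneg_nonneg) (simp_all add: x_def)
  qed
  then have "(\<bar>\<sigma>\<bar> * norm (M m) / \<sigma>) *\<^sub>R ((1 / norm (\<sigma> *\<^sub>R M m)) *\<^sub>R (\<sigma> *\<^sub>R M m)) =
      (\<bar>\<sigma>\<bar> * norm (M m) / \<sigma>) *\<^sub>R ((1 / norm (\<sigma> *\<^sub>R M n)) *\<^sub>R (\<sigma> *\<^sub>R M n))"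
    by (rule arg_cong)
  then have Mc: "M m = c *\<^sub>R M n"
    using \<open>\<sigma> \<noteq> 0\<close> M_nz[OF m(1)] by (simp add: c_def)
  have "m = c *\<^sub>R n"
  proof -
    have "c *\<^sub>R n = c *\<^sub>R (M n + (- (M n \<bullet> x) - M n $ k) *\<^sub>R axis k 1)"
      using recover[of n] by (rule arg_cong)
    also have "\<dots> = M m + (- (M m \<bullet> x) - M m $ k) *\<^sub>R axis k 1"
      unfolding Mc by (simp add: algebra_simps)
    also have "\<dots> = m" using recover[of m] by simp
    finally show ?thesis by simp
  qed
  then have "c = 1" using m(1) n(1) c by simp
  with \<open>m = c *\<^sub>R n\<close> show ?thesis by simp
qed

text \<open>
In the \<open>k\<close>-th chart the part of \<open>K\<close> on the side of \<open>u\<close> becomes a convex set \<open>K'\<close>, and the direction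
\<open>u\<close> becomes a boundary point \<open>z\<close> of its closure \<open>D\<close>. Near \<open>z\<close> the projective closure is exactly the
boundary of \<open>D\<close>: the hyperplane at infinity meets both of them only in \<open>z\<close>, and on its other side
there is nothing of \<open>K\<close>, because points close to \<open>z\<close> there are far out in directions close to \<open>- u\<close>.
\<close>
lemma C1_graph_near_point_at_infinity:
  fixes K :: "(real^'n::finite) set"
  assumes K: "convex K" "closed K" "interior K \<noteq> {}"
    and u: "u \<in> recession_cone K" "- u \<notin> recession_cone K"
    and ray: "\<And>v. v \<in> recession_cone K \<Longrightarrow> \<exists>c\<ge>0. v = c *\<^sub>R u"
    and lines: "\<And>b. \<exists>\<tau>. b + \<tau> *\<^sub>R u \<in> interior K"
    and uniq: "\<And>x m n. x \<in> K \<Longrightarrow> norm m = 1 \<Longrightarrow> norm n = 1 \<Longrightarrow>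
      (\<And>y. y \<in> K \<Longrightarrow> m \<bullet> (y - x) \<ge> 0) \<Longrightarrow> (\<And>y. y \<in> K \<Longrightarrow> n \<bullet> (y - x) \<ge> 0) \<Longrightarrow> m = n"
    and uk: "u $ k \<noteq> 0"
    and inf: "homog (u, 0) \<in> projective_closure (frontier K)"
  defines "z \<equiv> (1 / u $ k) *\<^sub>R u - axis k 1"
  shows "rp_param (Some k) z = homog (u, 0)"
    and "C1_graph_near (rp_param (Some k) -` projective_closure (frontier K)) z"
proof -
  define Y where "Y = projective_closure (frontier K)"
  have u0: "u \<noteq> 0" using uk by auto
  have zk: "z $ k = 0" using uk by (simp add: z_def)
  have lift_z: "chart_lift k z = (1 / u $ k) *\<^sub>R u"
    by (simp add: chart_lift_def zk) (simp add: z_def)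
  have nz: "(v, 0::real) \<noteq> 0" if "v \<noteq> 0" for v :: "real^'n"
    using that by (metis fst_conv fst_zero)
  have homog_u: "homog (c *\<^sub>R u, 0) = homog (u, 0)" if "c \<noteq> 0" for c
  proof -
    have "(c *\<^sub>R u, 0) = c *\<^sub>R (u, 0::real)" by simp
    then show ?thesis
      using homog_eq_iff[OF nz[of "c *\<^sub>R u"] nz[of u]] u0 that by (metis scaleR_eq_0_iff)
  qed
  show param_z: "rp_param (Some k) z = homog (u, 0)"
    unfolding rp_param_Some_chart_lift zk lift_z using uk by (intro homog_u) simp

  define \<sigma> where "\<sigma> = sgn (u $ k)"
  have \<sigma>: "\<sigma> * \<sigma> = 1" "\<sigma> * u $ k > 0" "\<sigma> \<noteq> 0"
    using uk by (auto simp: \<sigma>_def sgn_if)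
  define K' where "K' = perspective_image k \<sigma> K"
  define D where "D = closure K'"
  have convK': "convex K'" unfolding K'_def by (rule convex_perspective_image[OF K(1)])
  have D: "convex D" "closed D" "interior D = interior K'"
    unfolding D_def using convK' by (auto simp: convex_closure convex_interior_closure)
  have K'_D: "K' \<subseteq> D" unfolding D_def by (rule closure_subset)
  have frD: "frontier D = D - interior K'"
    using D by (simp add: frontier_def)
  have fK: "frontier K = K - interior K" using K(2) by (simp add: frontier_def)

  have lines': "\<exists>\<tau>. b + \<tau> *\<^sub>R u \<in> interior K \<and> \<sigma> * (b + \<tau> *\<^sub>R u) $ k > 0" for b
  proof -
    obtain \<tau> where \<tau>: "b + \<tau> *\<^sub>R u \<in> interior K" using lines by blast
    define r where "r = (\<bar>\<sigma> * (b + \<tau> *\<^sub>R u) $ k\<bar> + 1) / (\<sigma> * u $ k)"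
    have "r \<ge> 0" using \<sigma>(2) by (simp add: r_def)
    have "b + \<tau> *\<^sub>R u + r *\<^sub>R u \<in> interior K"
      by (rule recession_cone_interior[OF u(1) \<tau> \<open>r \<ge> 0\<close>])
    moreover have "r * (\<sigma> * u $ k) = \<bar>\<sigma> * (b + \<tau> *\<^sub>R u) $ k\<bar> + 1"
      unfolding r_def using \<sigma>(2) by (metis less_irrefl nonzero_eq_divide_eq)
    then have "\<sigma> * (b + \<tau> *\<^sub>R u + r *\<^sub>R u) $ k = \<sigma> * (b + \<tau> *\<^sub>R u) $ k + \<bar>\<sigma> * (b + \<tau> *\<^sub>R u) $ k\<bar> + 1"
      by (simp add: algebra_simps)
    then have "\<sigma> * (b + \<tau> *\<^sub>R u + r *\<^sub>R u) $ k > 0" by linarith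
    ultimately show ?thesis
      by (intro exI[of _ "\<tau> + r"]) (simp add: scaleR_add_left add.assoc)
  qed
  have intD: "interior D \<noteq> {}"
  proof -
    obtain \<tau> where \<tau>: "0 + \<tau> *\<^sub>R u \<in> interior K" "\<sigma> * (0 + \<tau> *\<^sub>R u) $ k > 0" using lines'[of 0] by blast
    define x where "x = 0 + \<tau> *\<^sub>R u"
    have x: "x \<in> interior K" "\<sigma> * x $ k > 0" using \<tau> by (simp_all add: x_def)
    then have "x $ k \<noteq> 0" by auto
    from perspective_involution[OF this] perspective_sign[OF x(2)] x
    have "perspective k x \<in> interior K'"
      unfolding K'_def interior_perspective_image by simp
    then show ?thesis using D(3) by blast
  qed

  have D_pos: "x \<in> frontier D \<longleftrightarrow> perspective k x \<in> frontier K" if "\<sigma> * x $ k > 0" for x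
    using closure_perspective_image[OF K(2) that] that
    unfolding frD fK by (simp add: D_def K'_def interior_perspective_image)
  have unique_at_0: "x = z" if "chart_lift k x = c *\<^sub>R u" "x $ k = 0" for x c
  proof -
    have "c * u $ k = 1" using that(1) chart_lift_nth[of k x k] by simp
    then have "c = 1 / u $ k" using uk by (simp add: field_simps)
    with that lift_z have "chart_lift k x = chart_lift k z" by simp
    then show ?thesis using that(2) zk by (simp add: chart_lift_def)
  qed
  have D_zero: "x = z" if "x \<in> D" "x $ k = 0" for x
  proof -
    have "\<sigma> *\<^sub>R chart_lift k x \<in> recession_cone K"
      using closure_perspective_image_at_infinity[OF K(1,2)] that by (simp add: D_def K'_def)
    then obtain c where "\<sigma> *\<^sub>R chart_lift k x = c *\<^sub>R u" using ray by blast
    then have "\<sigma> *\<^sub>R (\<sigma> *\<^sub>R chart_lift k x) = \<sigma> *\<^sub>R (c *\<^sub>R u)" by simp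
    then have "chart_lift k x = (\<sigma> * c) *\<^sub>R u" using \<sigma>(1) by simp
    then show ?thesis using that(2) by (rule unique_at_0)
  qed
  have z_D: "z \<in> D"
  proof -
    obtain a where a: "a \<in> K" using K(3) interior_subset by blast
    \<comment> \<open>In the chart the ray from \<open>a\<close> in direction \<open>u\<close> becomes the segment from \<open>z\<close> in direction \<open>w\<close>; the
      point with \<open>k\<close>-th affine coordinate \<open>y m\<close> is \<open>z + (1 / y m) w\<close>.\<close>
    define w where "w = a - (a $ k / u $ k) *\<^sub>R u + axis k 1"
    define y where "y m = \<sigma> * (real m + 1 + \<bar>a $ k\<bar>)" for m :: nat
    have in_K': "z + (1 / y m) *\<^sub>R w \<in> K'" for m
    proof -
      have sy: "\<sigma> * y m = real m + 1 + \<bar>a $ k\<bar>" using \<sigma>(1) by (simp add: y_def mult.assoc[symmetric])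
      then have "\<sigma> * y m > 0" by simp
      then have y0: "y m \<noteq> 0" by auto
      define t where "t = (y m - a $ k) / u $ k"
      define x where "x = a + t *\<^sub>R u"
      have "\<sigma> * (y m - a $ k) \<ge> 0"
      proof -
        have "\<sigma> * a $ k \<le> \<bar>a $ k\<bar>" using uk by (auto simp: \<sigma>_def sgn_if)
        then show ?thesis using sy by (simp add: right_diff_distrib)
      qed
      moreover have "t = (\<sigma> * (y m - a $ k)) / (\<sigma> * u $ k)" using \<sigma>(3) by (simp add: t_def)
      ultimately have "t \<ge> 0" using \<sigma>(2) by (metis divide_nonneg_pos)
      then have "x \<in> K" unfolding x_def by (rule recession_coneD[OF u(1) a])
      have xk: "x $ k = y m" using uk by (simp add: x_def t_def)
      have "perspective k x = z + (1 / y m) *\<^sub>R w"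
      proof -
        have "y m *\<^sub>R perspective k x = chart_lift k x" using scaleR_perspective[of x k] xk y0 by simp
        also have "\<dots> = y m *\<^sub>R z + w"
        proof -
          have "chart_lift k x = a + t *\<^sub>R u + (1 - y m) *\<^sub>R axis k 1"
            unfolding chart_lift_def xk by (simp add: x_def)
          also have "t = y m / u $ k - a $ k / u $ k" by (simp add: t_def diff_divide_distrib)
          finally show ?thesis by (simp add: z_def w_def algebra_simps)
        qed
        finally have "(1 / y m) *\<^sub>R (y m *\<^sub>R perspective k x) = (1 / y m) *\<^sub>R (y m *\<^sub>R z + w)" by simp
        then show ?thesis using y0 by (simp add: scaleR_add_right)
      qed
      moreover have "perspective k x \<in> K'"
        using perspective_sign[of \<sigma> x k] perspective_involution[of x k] xk y0 \<open>\<sigma> * y m > 0\<close> \<open>x \<in> K\<close>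
        by (simp add: K'_def perspective_image_def)
      ultimately show ?thesis by simp
    qed
    have "(\<lambda>m. 1 / y m) \<longlonglongrightarrow> 0"
    proof -
      have "filterlim (\<lambda>m. (1 + \<bar>a $ k\<bar>) + real m) at_top sequentially"
        by (rule filterlim_tendsto_add_at_top[OF tendsto_const filterlim_real_sequentially])
      then have "(\<lambda>m. inverse ((1 + \<bar>a $ k\<bar>) + real m)) \<longlonglongrightarrow> 0"
        by (rule tendsto_inverse_0_at_top)
      then have "(\<lambda>m. \<sigma> * inverse ((1 + \<bar>a $ k\<bar>) + real m)) \<longlonglongrightarrow> \<sigma> * 0"
        by (intro tendsto_intros)
      moreover have "\<sigma> * inverse ((1 + \<bar>a $ k\<bar>) + real m) = 1 / y m" for m
      proof -
        have "\<sigma> = 1 / \<sigma>" using \<sigma>(1,3) by (simp add: field_simps)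
        then show ?thesis by (simp add: y_def divide_inverse add.commute add.left_commute)
      qed
      ultimately show ?thesis by simp
    qed
    then have "(\<lambda>m. z + (1 / y m) *\<^sub>R w) \<longlonglongrightarrow> z + 0 *\<^sub>R w" by (intro tendsto_intros)
    then show ?thesis
      unfolding D_def closure_sequential using in_K' by (intro exI[of _ "\<lambda>m. z + (1 / y m) *\<^sub>R w"]) simp
  qed
  have z_fr: "z \<in> frontier D"
    using z_D zk unfolding frD K'_def by (simp add: interior_perspective_image)

  obtain a where a: "a \<in> K" using K(3) interior_subset by blast
  obtain \<eta> R where \<eta>: "\<eta> > 0" "R > 0"
    and out: "\<And>d r. norm (d - (- u)) < \<eta> \<Longrightarrow> r \<ge> R \<Longrightarrow> a + r *\<^sub>R d \<notin> K"
    using leaves_outside_recession_cone[OF K(1,2) a u(2)] by metis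
  \<comment> \<open>The affine point with chart coordinates \<open>x\<close> is \<open>a + r d x\<close> with \<open>r = - 1 / (x $ k * u $ k)\<close>, and
    \<open>d x\<close> tends to \<open>- u\<close> as \<open>x\<close> tends to \<open>z\<close>.\<close>
  define d where "d x = (u $ k) *\<^sub>R (x $ k *\<^sub>R a - chart_lift k x)" for x
  define V where "V = {x. norm (d x - (- u)) < \<eta>} \<inter> {x. \<bar>x $ k * u $ k\<bar> < 1 / R}"
  have "open V"
    unfolding V_def d_def
    by (intro open_Int open_Collect_less continuous_intros continuous_on_chart_lift)
  have "d z = - u" using uk by (simp add: d_def zk lift_z)
  then have "z \<in> V" using \<eta> by (simp add: V_def zk)
  have V_neg: "perspective k x \<notin> K" if "x \<in> V" "\<sigma> * x $ k < 0" for x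
  proof -
    have xk: "x $ k \<noteq> 0" using that by auto
    have "(\<sigma> * x $ k) * (\<sigma> * u $ k) < 0" using that(2) \<sigma>(2) by (rule mult_neg_pos)
    moreover have "(\<sigma> * x $ k) * (\<sigma> * u $ k) = (\<sigma> * \<sigma>) * (x $ k * u $ k)" by (simp add: algebra_simps)
    ultimately have neg: "x $ k * u $ k < 0" using \<sigma>(1) by simp
    define r where "r = - 1 / (x $ k * u $ k)"
    have "r = 1 / \<bar>x $ k * u $ k\<bar>" using neg by (simp add: r_def)
    moreover have "\<bar>x $ k * u $ k\<bar> < 1 / R" using that by (simp add: V_def)
    ultimately have "r \<ge> R" using \<eta>(2) neg by (simp add: field_simps)
    have "a + r *\<^sub>R d x \<notin> K" using that by (intro out \<open>r \<ge> R\<close>) (simp add: V_def)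
    moreover have "a + r *\<^sub>R d x = perspective k x"
    proof -
      have "r * u $ k = - 1 / x $ k" using xk uk by (simp add: r_def)
      then have "r *\<^sub>R d x = (- 1 / x $ k) *\<^sub>R (x $ k *\<^sub>R a - chart_lift k x)"
        unfolding d_def scaleR_scaleR by simp
      then show ?thesis using xk by (simp add: perspective_def scaleR_diff_right inverse_eq_divide)
    qed
    ultimately show ?thesis by simp
  qed
  have Y_iff: "x \<in> rp_param (Some k) -` Y \<longleftrightarrow> perspective k x \<in> frontier K" if "x $ k \<noteq> 0" for x
    using projective_closure_finite_point[OF frontier_closed that, of "chart_lift k x" K]
    unfolding vimage_eq rp_param_Some_chart_lift Y_def perspective_def .
  have Y_zero: "x \<in> rp_param (Some k) -` Y \<longleftrightarrow> x = z" if "x $ k = 0" for x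
  proof
    assume "x \<in> rp_param (Some k) -` Y"
    then have "homog (chart_lift k x, 0) \<in> projective_closure (frontier K)"
      unfolding vimage_eq rp_param_Some_chart_lift Y_def that .
    moreover have "chart_lift k x \<noteq> 0" using chart_lift_nth[of k x k] by auto
    moreover have "frontier K \<subseteq> K" using fK by blast
    ultimately have "chart_lift k x \<in> recession_cone K \<or> - chart_lift k x \<in> recession_cone K"
      using projective_closure_infinite_point[OF K(1,2)] by blast
    then obtain c where "chart_lift k x = c *\<^sub>R u"
      using ray by (metis add.inverse_inverse scaleR_minus_left)
    then show "x = z" using that by (rule unique_at_0)
  next
    assume "x = z"
    then show "x \<in> rp_param (Some k) -` Y"
      using param_z inf by (simp only: vimage_eq Y_def)
  qed
  have eq: "rp_param (Some k) -` Y \<inter> V = frontier D \<inter> V"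
  proof -
    have "x \<in> rp_param (Some k) -` Y \<longleftrightarrow> x \<in> frontier D" if "x \<in> V" for x
    proof -
      consider "\<sigma> * x $ k > 0" | "x $ k = 0" | "\<sigma> * x $ k < 0" using \<sigma>(3) by (meson linorder_neqE_linordered_idom mult_eq_0_iff)
      then show ?thesis
      proof cases
        case 1
        then have "x $ k \<noteq> 0" by auto
        with Y_iff D_pos[OF 1] show ?thesis by blast
      next
        case 2
        then show ?thesis using Y_zero D_zero z_fr frD by blast
      next
        case 3
        then have "x $ k \<noteq> 0" by auto
        moreover have "perspective k x \<notin> frontier K" using V_neg[OF that 3] fK by blast
        moreover have "x \<notin> D"
          using closure_perspective_image_halfspace[of x k \<sigma> K] 3 by (auto simp: D_def K'_def)
        ultimately show ?thesis using Y_iff frD by blast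
      qed
    qed
    then show ?thesis by blast
  qed
  have "C1_graph_near (rp_param (Some k) -` Y) z"
  proof (rule C1_graph_near_convex_frontier[OF D(1,2) intD z_fr \<open>open V\<close> \<open>z \<in> V\<close> eq])
    fix x m n
    assume x: "x \<in> frontier D" "x \<in> V" and mn: "norm m = 1" "norm n = 1"
      and supp: "\<And>y. y \<in> D \<Longrightarrow> m \<bullet> (y - x) \<ge> 0" "\<And>y. y \<in> D \<Longrightarrow> n \<bullet> (y - x) \<ge> 0"
    have m: "m \<bullet> (y - x) \<ge> 0" and n: "n \<bullet> (y - x) \<ge> 0" if "y \<in> perspective_image k \<sigma> K" for y
      using supp that K'_D by (auto simp: K'_def)
    have "x \<in> D" using x frD by blast
    then have "\<sigma> * x $ k \<ge> 0"
      using closure_perspective_image_halfspace by (auto simp: D_def K'_def)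
    show "m = n"
    proof (cases "x $ k = 0")
      case True
      then have "x = (1 / u $ k) *\<^sub>R u - axis k 1"
        using D_zero[OF \<open>x \<in> D\<close>] by (simp add: z_def)
      moreover have "\<exists>\<tau>. b + \<tau> *\<^sub>R u \<in> K \<and> \<sigma> * (b + \<tau> *\<^sub>R u) $ k > 0" for b
        using lines'[of b] interior_subset by blast
      ultimately show ?thesis
        using unique_normal_at_infinity[OF _ uk \<sigma>(1) _ mn(1) m]
          unique_normal_at_infinity[OF _ uk \<sigma>(1) _ mn(2) n] by metis
    next
      case False
      with \<open>\<sigma> * x $ k \<ge> 0\<close> \<sigma>(3) have pos: "\<sigma> * x $ k > 0" by (simp add: less_le)
      have "perspective k x \<in> K" using D_pos[OF pos] x(1) fK by blast
      from unique_normal_perspective_image[OF K(1,2) pos this uniq[OF this] mn(1) m mn(2) n]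
      show ?thesis by blast
    qed
  qed
  then show "C1_graph_near (rp_param (Some k) -` projective_closure (frontier K)) z"
    by (simp only: Y_def)
qed


section \<open>The two conclusions\<close>

lemma is_line_span_singleton:
  fixes u :: "'a::euclidean_space"
  assumes "u \<noteq> 0"
  shows "is_line (span {u})"
proof -
  have "dim (span {u}) = 1"
    using assms dim_eq_card_independent[of "{u}"] by (simp add: dim_span dependent_single)
  then show ?thesis
    by (simp add: is_line_def subspace_imp_affine aff_dim_subspace)
qed

lemma entire_graph_frontier:
  fixes K :: "'a::euclidean_space set"
  assumes K: "convex K" "closed K"
    and u: "u \<in> recession_cone K" "- u \<notin> recession_cone K"
    and lines: "\<And>b. \<exists>\<tau>. b + \<tau> *\<^sub>R u \<in> interior K"
  shows "entire_graph (frontier K)"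
proof -
  have "u \<noteq> 0" using u by auto
  have fK: "frontier K \<subseteq> K" using K(2) frontier_subset_closed by blast
  have "\<exists>!x. x \<in> frontier K \<inter> m" if m: "affine_parallel (span {u}) m" for m
  proof (rule ex_ex1I)
    obtain a where a: "m = (+) a ` span {u}" using m by (auto simp: affine_parallel_def)
    then have m_iff: "x \<in> m \<longleftrightarrow> (\<exists>r. x = a + r *\<^sub>R u)" for x
      by (auto simp: span_singleton)
    obtain \<tau> where \<tau>: "a + \<tau> *\<^sub>R u \<in> interior K" using lines by blast
    have "\<exists>r\<ge>0. (a + \<tau> *\<^sub>R u) + r *\<^sub>R (- u) \<notin> K"
      using ray_in_recession_cone[OF K, of "a + \<tau> *\<^sub>R u" "- u"] u(2) by blast
    then obtain r where r: "(a + \<tau> *\<^sub>R u) + r *\<^sub>R (- u) \<notin> K" by blast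
    have "m \<inter> frontier K \<noteq> {}"
    proof (rule connected_Int_frontier)
      have "affine m"
        unfolding a by (metis affine_translation subspace_imp_affine subspace_span)
      then show "connected m" by (simp add: affine_imp_convex convex_connected)
      have "a + \<tau> *\<^sub>R u \<in> m \<inter> K" using m_iff \<tau> interior_subset by blast
      then show "m \<inter> K \<noteq> {}" by blast
      have "(a + \<tau> *\<^sub>R u) + r *\<^sub>R (- u) = a + (\<tau> - r) *\<^sub>R u" by (simp add: algebra_simps)
      then show "m - K \<noteq> {}" using r m_iff by (metis Diff_iff empty_iff)
    qed
    then show "\<exists>x. x \<in> frontier K \<inter> m" by blast
    have less: False if "r1 < r2" "a + r1 *\<^sub>R u \<in> frontier K" "a + r2 *\<^sub>R u \<in> frontier K" for r1 r2
    proof -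
      \<comment> \<open>Beyond \<open>\<tau>\<close> the line stays in the interior, so a boundary point cannot lie between the
        boundary point \<open>r1\<close> and the interior point \<open>r3\<close>.\<close>
      define r3 where "r3 = max \<tau> (r2 + 1)"
      have "(a + \<tau> *\<^sub>R u) + (r3 - \<tau>) *\<^sub>R u \<in> interior K"
        by (rule recession_cone_interior[OF u(1) \<tau>]) (simp add: r3_def)
      then have int: "a + r3 *\<^sub>R u \<in> interior K" by (simp add: algebra_simps)
      define \<mu> where "\<mu> = (r2 - r1) / (r3 - r1)"
      have "r2 < r3" by (simp add: r3_def)
      then have \<mu>: "0 < \<mu>" "\<mu> \<le> 1" using that(1) by (simp_all add: \<mu>_def)
      have "\<mu> * (r3 - r1) = r2 - r1" using that(1) \<open>r2 < r3\<close> by (simp add: \<mu>_def)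
      then have r2: "r2 = (1 - \<mu>) * r1 + \<mu> * r3" by (simp add: algebra_simps)
      have "(1 - \<mu>) *\<^sub>R (a + r1 *\<^sub>R u) + \<mu> *\<^sub>R (a + r3 *\<^sub>R u) \<in> interior K"
        using that(2) fK \<mu> int K by (intro interior_convex_combination) auto
      also have "(1 - \<mu>) *\<^sub>R (a + r1 *\<^sub>R u) + \<mu> *\<^sub>R (a + r3 *\<^sub>R u) = a + r2 *\<^sub>R u"
        unfolding r2 by (simp add: algebra_simps)
      finally show False using that(3) by (simp add: frontier_def)
    qed
    show "x = y" if x: "x \<in> frontier K \<inter> m" and y: "y \<in> frontier K \<inter> m" for x y
    proof -
      obtain r1 r2 where r: "x = a + r1 *\<^sub>R u" "y = a + r2 *\<^sub>R u" using x y m_iff by blast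
      with x y less[of r1 r2] less[of r2 r1] have "r1 = r2"
        by (cases r1 r2 rule: linorder_cases) auto
      with r show ?thesis by simp
    qed
  qed
  then show ?thesis
    unfolding entire_graph_def using is_line_span_singleton[OF \<open>u \<noteq> 0\<close>] by blast
qed

text \<open>
A line in \<open>K\<close> can be translated to any point of \<open>K\<close>, and the translate through a boundary point
stays in the boundary.
\<close>
lemma pointed_recession_cone:
  fixes K :: "'a::euclidean_space set"
  assumes K: "closed K" and X: "frontier K \<noteq> {}" "no_segments (frontier K)"
    and v: "v \<in> recession_cone K" "- v \<in> recession_cone K"
  shows "v = 0"
proof (rule ccontr)
  assume "v \<noteq> 0"
  obtain x where x: "x \<in> frontier K" using X(1) by blast
  then have "x \<in> K" "x \<notin> interior K" using K by (auto simp: frontier_def)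
  have "closed_segment x (x + v) \<subseteq> frontier K"
  proof
    fix y assume "y \<in> closed_segment x (x + v)"
    then obtain s where s: "0 \<le> s" "y = (1 - s) *\<^sub>R x + s *\<^sub>R (x + v)"
      by (auto simp: closed_segment_def)
    then have y: "y = x + s *\<^sub>R v" by (simp add: algebra_simps)
    then have "y \<in> K" using recession_coneD[OF v(1) \<open>x \<in> K\<close> s(1)] by simp
    moreover have "y \<notin> interior K"
      using recession_cone_interior[OF v(2) _ s(1), of y] \<open>x \<notin> interior K\<close> by (auto simp: y)
    ultimately show "y \<in> frontier K" using K by (simp add: frontier_def)
  qed
  with X(2) \<open>v \<noteq> 0\<close> show False
    unfolding no_segments_def by (metis add_cancel_right_right)
qed

lemma rp_C1_hypersurface_projective_closure:
  fixes K :: "(real^'n::finite) set"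
  assumes K: "convex K" "closed K" "interior K \<noteq> {}"
    and alg: "real_algebraic (frontier K)" and strict: "no_segments (frontier K)"
    and ne: "frontier K \<noteq> {}"
    and u: "u \<in> recession_cone K" "- u \<notin> recession_cone K"
  shows "rp_C1_hypersurface (projective_closure (frontier K))"
proof -
  have "u \<noteq> 0" using u by auto
  have fK: "frontier K \<subseteq> K" using K(2) frontier_subset_closed by blast
  note uniq = unique_support_normal[OF K alg strict]
  note lines = line_meets_interior[OF K alg u]
  have ray: "\<exists>c\<ge>0. v = c *\<^sub>R u" if "v \<in> recession_cone K" for v
    using recession_cone_subset_ray[OF K alg pointed_recession_cone[OF K(2) ne strict] u(1) \<open>u \<noteq> 0\<close> that]
    by blast
  have "\<exists>c x. q = rp_param c x \<and> C1_graph_near (rp_param c -` projective_closure (frontier K)) x"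
    if q: "q \<in> projective_closure (frontier K)" for q
  proof -
    obtain v where v: "v \<noteq> 0" "q = homog v" by (rule homog_surj)
    obtain y t where yt: "v = (y, t)" by (cases v)
    show ?thesis
    proof (cases "t = 0")
      case False
      have vimage: "rp_param None -` projective_closure (frontier K) = frontier K"
      proof (rule set_eqI)
        fix x
        have "x \<in> rp_param None -` projective_closure (frontier K) \<longleftrightarrow>
            homog (x, 1) \<in> projective_closure (frontier K)"
          by (simp only: vimage_eq rp_param.simps)
        also have "\<dots> \<longleftrightarrow> x \<in> frontier K"
          using projective_closure_finite_point[OF frontier_closed, of 1 x K] by simp
        finally show "x \<in> rp_param None -` projective_closure (frontier K) \<longleftrightarrow> x \<in> frontier K" .
      qed
      define x where "x = y /\<^sub>R t"
      have "x \<in> frontier K"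
        using projective_closure_finite_point[OF frontier_closed False, of y K] q v(2) yt by (simp add: x_def)
      have "v = t *\<^sub>R (x, 1)" using False by (simp add: x_def yt)
      moreover have "(x, 1::real) \<noteq> 0" by (metis snd_conv snd_zero zero_neq_one)
      ultimately have q_eq: "q = rp_param None x"
        using homog_eq_iff[OF v(1), of "(x, 1)"] v(2) unfolding rp_param.simps by blast
      have "C1_graph_near (frontier K) x"
      proof (rule C1_graph_near_convex_frontier[OF K \<open>x \<in> frontier K\<close> open_UNIV UNIV_I refl])
        show "m = n" if "x \<in> frontier K" "norm m = 1" "norm n = 1"
          "\<And>y. y \<in> K \<Longrightarrow> 0 \<le> m \<bullet> (y - x)" "\<And>y. y \<in> K \<Longrightarrow> 0 \<le> n \<bullet> (y - x)" for x m n
          using uniq[of x m n] that fK by blast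
      qed
      then have "C1_graph_near (rp_param None -` projective_closure (frontier K)) x"
        unfolding vimage .
      with q_eq show ?thesis by blast
    next
      case True
      have "y \<noteq> 0" using v(1) unfolding yt True zero_prod_def by blast
      have q0: "q = homog (y, 0)" using v(2) yt True by simp
      then have "y \<in> recession_cone K \<or> - y \<in> recession_cone K"
        using projective_closure_infinite_point[OF K(1,2) fK \<open>y \<noteq> 0\<close>] q by simp
      then obtain c where c: "y = c *\<^sub>R u"
        using ray by (metis add.inverse_inverse scaleR_minus_left)
      have "(u, 0::real) \<noteq> 0" using \<open>u \<noteq> 0\<close> by (metis fst_conv fst_zero)
      moreover have "v = c *\<^sub>R (u, 0)" by (simp add: yt True c)
      ultimately have qu: "q = homog (u, 0)"
        using homog_eq_iff[OF v(1), of "(u, 0)"] v(2) by blast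
      obtain k where k: "u $ k \<noteq> 0" using \<open>u \<noteq> 0\<close> by (auto simp: vec_eq_iff)
      have inf: "homog (u, 0) \<in> projective_closure (frontier K)" using q qu by simp
      note near = C1_graph_near_point_at_infinity[OF K u ray lines uniq k inf]
      show ?thesis
        by (rule exI[of _ "Some k"], rule exI[of _ "(1 / u $ k) *\<^sub>R u - axis k 1"])
           (rule conjI[OF trans[OF qu near(1)[symmetric]] near(2)])
    qed
  qed
  then show ?thesis unfolding rp_C1_hypersurface_def by blast
qed

theorem theorem1p4:
  fixes X :: "(real^'n) set"
  assumes "real_algebraic X"
    and "convex_hypersurface X"
    and "top_of_set X homeomorphic_space Euclidean_space (CARD('n) - 1)"
  shows "entire_graph X \<and>
    (strictly_convex_hypersurface X \<longrightarrow> rp_C1_hypersurface (projective_closure X))"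
proof -
  obtain K0 where K0: "convex K0" "interior K0 \<noteq> {}" "X = frontier K0"
    using assms(2) by (auto simp: convex_hypersurface_def)
  define K where "K = closure K0"
  have K: "convex K" "closed K" "interior K \<noteq> {}"
    using K0 by (auto simp: K_def convex_closure convex_interior_closure)
  have X: "X = frontier K"
    using K0 by (simp add: K_def frontier_def convex_interior_closure)
  have alg: "real_algebraic (frontier K)" using assms(1) X by simp
  have contr: "contractible (frontier K)"
    using homeomorphic_space_contractibility[OF assms(3)] by (simp add: X)
  have ne: "frontier K \<noteq> {}"
  proof
    assume "frontier K = {}"
    then have "topspace (Euclidean_space (CARD('n) - 1)) = {}"
      using homeomorphic_empty_space[OF assms(3)] by (simp add: X)
    moreover have "(\<lambda>_. 0) \<in> topspace (Euclidean_space (CARD('n) - 1))"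
      by (simp add: topspace_Euclidean_space)
    ultimately show False by blast
  qed
  obtain u where u: "u \<in> recession_cone K" "- u \<notin> recession_cone K"
    using asymmetric_recession_direction[OF K contr ne] .
  have "entire_graph X"
    unfolding X by (rule entire_graph_frontier[OF K(1,2) u line_meets_interior[OF K alg u]])
  moreover have "rp_C1_hypersurface (projective_closure X)" if "strictly_convex_hypersurface X"
    using rp_C1_hypersurface_projective_closure[OF K alg _ ne u] that
    by (simp add: X strictly_convex_hypersurface_def)
  ultimately show ?thesis by blast
qed

end
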